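(* Let $m\ge n\ge1$, $\mathfrak g=\mathfrak{osp}(2n|2m)$ with the data below, and let $\Lambda\in\hat{\mathfrak h}^*$ have level $k\ne0$ and satisfy $(\Lambda|\beta_i)=0$ for $i=1,\dots,n$. Then $L(\Lambda)$ is integrable if and only if $\Lambda=k\Lambda_0+\sum_{i=1}^nk_i\beta_i+\sum_{i=n+1}^mk_i\epsilon_i+c\delta$ for some $c\in\mathbb{C}$ and integers $k_i$ with $k\in\mathbb{Z}_{>0}$, $k_i\in\mathbb{Z}_{\ge0}$ ($i=1,\dots,m$), and $k\ge k_m\ge k_{m-1}\ge\dots\ge k_1$.
   Context: Affine setting: $\mathfrak g$ is a basic Lie superalgebra with nondegenerate invariant supersymmetric form $(\cdot|\cdot)$ and Cartan subalgebra $\mathfrak h\subset\mathfrak g_{\bar0}$, identified with $\mathfrak h^*$. $\hat{\mathfrak g}=\mathfrak g[t,t^{-1}]\oplus\mathbb{C}K\oplus\mathbb{C}d$ with $[at^r,bt^s]=[a,b]t^{r+s}+r\delta_{r,-s}(a|b)K$, $K$ central, $[d,at^r]=rat^r$; $\hat{\mathfrak h}=\mathfrak h\oplus\mathbb{C}K\oplus\mathbb{C}d$ with form extended by $(\mathfrak h|\mathbb{C}K+\mathbb{C}d)=0$, $(K|K)=(d|d)=0$, $(K|d)=1$; $\delta,\Lambda_0$ correspond to $K,d$. Given simple roots $\Pi$ of $\mathfrak g$ with highest root $\theta$, the positive roots of $\hat{\mathfrak g}$ are the positive roots of $\mathfrak g$ and all $\alpha+r\delta$, $\alpha$ a root or $0$,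 $r>0$; simple roots $\{\alpha_0=\delta-\theta\}\cup\Pi$. $L(\Lambda)$ is the irreducible highest weight module of highest weight $\Lambda$, level $\Lambda(K)$. $L(\Lambda)$ is $\gamma$-integrable if $\hat{\mathfrak g}_{-\gamma}$ acts locally nilpotently; it is integrable if $\gamma$-integrable for all positive $\gamma\in\Delta^\#_{\bar0}$ and all $\alpha+r\delta$ with $\alpha\in\Delta^\#_{\bar0}$, $r\in\mathbb{Z}_{>0}$, where $\Delta^\#_{\bar0}$ is the root set of the distinguished subalgebra $\mathfrak g^\#_{\bar0}$. Data: $\mathfrak h^*$ has orthogonal basis $\epsilon_1,\dots,\epsilon_m,\delta_1,\dots,\delta_n$ with $(\epsilon_i|\epsilon_i)=\frac12$, $(\delta_i|\delta_i)=-\frac12$. Even roots: $\epsilon_i-\epsilon_j,\pm(\epsilon_i+\epsilon_j),\pm2\epsilon_i$ ($i\ne j\le m$), $\delta_i-\delta_j,\pm(\delta_i+\delta_j)$ ($i\ne j\le n$); odd roots $\pm(\epsilon_i\pm\delta_j)$. $\mathfrak g^\#_{\bar0}=\mathfrak{sp}(2m)$ (roots in the $\epsilon$'s). Simple roots: $\alpha_i=\epsilon_{m-i+1}-\epsilon_{m-i}$ ($1\le i\le m-n$), then $\epsilon_n-\delta_n,\ \delta_n-\epsilon_{n-1},\ \epsilon_{n-1}-\delta_{n-1},\dots,\ \delta_2-\epsilon_1,\ \epsilon_1-\delta_1,\ \epsilon_1+\delta_1$; $\theta=2\epsilon_m$. $\beta_i=\epsilon_i-\delta_i$, $i=1,\dots,n$.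 *)

theory Defs
  imports Complex_Main "HOL-Library.Function_Algebras"
begin

text \<open>Superspace V = C^{2n|2m}. Basis index (False,i), 1 <= |i| <= n: even vectors e_i, e_{-i};
  (True,j), 1 <= |j| <= m: odd vectors f_j, f_{-j}.  The first component is the parity.\<close>

type_synonym idx = "bool \<times> int"
type_synonym mat = "idx \<Rightarrow> idx \<Rightarrow> complex"

definition Idx :: "nat \<Rightarrow> nat \<Rightarrow> idx set" where
  "Idx n m = {(False, i) | i. i \<noteq> 0 \<and> \<bar>i\<bar> \<le> int n} \<union> {(True, j) | j. j \<noteq> 0 \<and> \<bar>j\<bar> \<le> int m}"

definition madd :: "mat \<Rightarrow> mat \<Rightarrow> mat" where "madd X Y = (\<lambda>p q. X p q + Y p q)"
definition msub :: "mat \<Rightarrow> mat \<Rightarrow> mat" where "msub X Y = (\<lambda>p q. X p q - Y p q)"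
definition msc :: "complex \<Rightarrow> mat \<Rightarrow> mat" where "msc c X = (\<lambda>p q. c * X p q)"
definition mmul :: "nat \<Rightarrow> nat \<Rightarrow> mat \<Rightarrow> mat \<Rightarrow> mat" where
  "mmul n m X Y = (\<lambda>p q. \<Sum>r\<in>Idx n m. X p r * Y r q)"

definition mpart :: "bool \<Rightarrow> mat \<Rightarrow> mat" where
  "mpart a X = (\<lambda>p q. if (fst p \<noteq> fst q) = a then X p q else 0)"

definition psign :: "bool \<Rightarrow> bool \<Rightarrow> complex" where
  "psign a b = (if a \<and> b then -1 else 1)"

text \<open>Even supersymmetric nondegenerate bilinear form on V:
  B(e_i,e_{-i}) = 1 (symmetric), B(f_j,f_{-j}) = 1 = -B(f_{-j},f_j) for j > 0.\<close>
definition Bf :: "idx \<Rightarrow> idx \<Rightarrow> complex" where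
  "Bf p q = (if \<not> fst p \<and> \<not> fst q \<and> snd q = - snd p then 1
             else if fst p \<and> fst q \<and> snd q = - snd p then (if snd p > 0 then 1 else -1)
             else 0)"

text \<open>Homogeneous X of parity a lies in osp iff B(Xu,v) + (-1)^{|X||u|} B(u,Xv) = 0.\<close>
definition osp_hom :: "nat \<Rightarrow> nat \<Rightarrow> bool \<Rightarrow> mat \<Rightarrow> bool" where
  "osp_hom n m a X \<longleftrightarrow>
     (\<forall>p q. p \<notin> Idx n m \<or> q \<notin> Idx n m \<longrightarrow> X p q = 0) \<and> mpart a X = X \<and>
     (\<forall>p\<in>Idx n m. \<forall>q\<in>Idx n m.
        (\<Sum>r\<in>Idx n m. X r p * Bf r q) + psign a (fst p) * (\<Sum>r\<in>Idx n m. Bf p r * X r q) = 0)"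

definition osp :: "nat \<Rightarrow> nat \<Rightarrow> mat set" where
  "osp n m = {X. osp_hom n m False (mpart False X) \<and> osp_hom n m True (mpart True X)}"

text \<open>Super bracket, extended bilinearly from homogeneous components.\<close>
definition sbr :: "nat \<Rightarrow> nat \<Rightarrow> mat \<Rightarrow> mat \<Rightarrow> mat" where
  "sbr n m X Y = (\<lambda>p q. \<Sum>a\<in>(UNIV::bool set). \<Sum>b\<in>(UNIV::bool set).
      mmul n m (mpart a X) (mpart b Y) p q - psign a b * mmul n m (mpart b Y) (mpart a X) p q)"

definition str :: "nat \<Rightarrow> nat \<Rightarrow> mat \<Rightarrow> complex" where
  "str n m Z = (\<Sum>p\<in>Idx n m. (if fst p then -1 else 1) * Z p p)"

text \<open>Invariant form, normalised so that (eps_i|eps_i) = 1/2, (delta_i|delta_i) = -1/2.\<close>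
definition bform :: "nat \<Rightarrow> nat \<Rightarrow> mat \<Rightarrow> mat \<Rightarrow> complex" where
  "bform n m X Y = - str n m (mmul n m X Y)"

definition cartan :: "nat \<Rightarrow> nat \<Rightarrow> mat set" where
  "cartan n m = {H \<in> osp n m. \<forall>p q. p \<noteq> q \<longrightarrow> H p q = 0}"

datatype widx = Ep nat | De nat

type_synonym weight = "widx \<Rightarrow> complex"

definition eps :: "nat \<Rightarrow> weight" where "eps i = (\<lambda>w. if w = Ep i then 1 else 0)"
definition del :: "nat \<Rightarrow> weight" where "del i = (\<lambda>w. if w = De i then 1 else 0)"
definition wsc :: "complex \<Rightarrow> weight \<Rightarrow> weight" where "wsc c \<mu> = (\<lambda>w. c * \<mu> w)"

text \<open>h in cartan is diag(a_1..a_n,-a_1..-a_n | b_1..b_m,-b_1..-b_m); delta_i(h)=a_i, eps_j(h)=b_j.\<close>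
definition wt_eval :: "nat \<Rightarrow> nat \<Rightarrow> weight \<Rightarrow> mat \<Rightarrow> complex" where
  "wt_eval n m \<mu> H = (\<Sum>i=1..n. \<mu> (De i) * H (False, int i) (False, int i))
                   + (\<Sum>j=1..m. \<mu> (Ep j) * H (True, int j) (True, int j))"

definition wsupp :: "nat \<Rightarrow> nat \<Rightarrow> weight \<Rightarrow> bool" where
  "wsupp n m \<mu> \<longleftrightarrow> (\<forall>w. (\<forall>i\<in>{1..m}. w \<noteq> Ep i) \<and> (\<forall>i\<in>{1..n}. w \<noteq> De i) \<longrightarrow> \<mu> w = 0)"

definition wform :: "nat \<Rightarrow> nat \<Rightarrow> weight \<Rightarrow> weight \<Rightarrow> complex" where
  "wform n m \<mu> \<nu> = (\<Sum>i=1..m. \<mu> (Ep i) * \<nu> (Ep i)) / 2 - (\<Sum>i=1..n. \<mu> (De i) * \<nu> (De i)) / 2"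

definition beta :: "nat \<Rightarrow> weight" where "beta i = eps i - del i"

definition rootspace :: "nat \<Rightarrow> nat \<Rightarrow> weight \<Rightarrow> mat set" where
  "rootspace n m \<alpha> = {X \<in> osp n m. \<forall>H\<in>cartan n m.
      msub (mmul n m H X) (mmul n m X H) = msc (wt_eval n m \<alpha> H) X}"

text \<open>Roots of g^#_0 = sp(2m).\<close>
definition roots_eps :: "nat \<Rightarrow> weight set" where
  "roots_eps m = {wsc s (eps i) + wsc t (eps j) | s t i j.
                    s \<in> {1, -1} \<and> t \<in> {1, -1} \<and> i \<in> {1..m} \<and> j \<in> {1..m} \<and> i \<noteq> j}
               \<union> {wsc (2 * s) (eps i) | s i. s \<in> {1, -1} \<and> i \<in> {1..m}}"

definition roots_del :: "nat \<Rightarrow> weight set" where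
  "roots_del n = {wsc s (del i) + wsc t (del j) | s t i j.
                    s \<in> {1, -1} \<and> t \<in> {1, -1} \<and> i \<in> {1..n} \<and> j \<in> {1..n} \<and> i \<noteq> j}"

definition roots_odd :: "nat \<Rightarrow> nat \<Rightarrow> weight set" where
  "roots_odd n m = {wsc s (eps i) + wsc t (del j) | s t i j.
                    s \<in> {1, -1} \<and> t \<in> {1, -1} \<and> i \<in> {1..m} \<and> j \<in> {1..n}}"

definition roots :: "nat \<Rightarrow> nat \<Rightarrow> weight set" where
  "roots n m = roots_eps m \<union> roots_del n \<union> roots_odd n m"

definition simple_roots :: "nat \<Rightarrow> nat \<Rightarrow> weight set" where
  "simple_roots n m = {eps (j + 1) - eps j | j. n \<le> j \<and> j < m}
                    \<union> {eps i - del i | i. 1 \<le> i \<and> i \<le> n}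
                    \<union> {del (i + 1) - eps i | i. 1 \<le> i \<and> i < n}
                    \<union> {eps 1 + del 1}"

definition pos_roots :: "nat \<Rightarrow> nat \<Rightarrow> weight set" where
  "pos_roots n m = {\<alpha> \<in> roots n m. \<exists>c :: weight \<Rightarrow> nat.
                      \<alpha> = (\<Sum>\<beta>\<in>simple_roots n m. wsc (of_nat (c \<beta>)) \<beta>)}"

text \<open>A module over U(g^) on a complex vector space (V, s): rho X r is the action of X t^r
  (X in osp), rhoK the action of K, rhod the action of d.\<close>
definition affine_module ::
  "nat \<Rightarrow> nat \<Rightarrow> (complex \<Rightarrow> 'v::ab_group_add \<Rightarrow> 'v) \<Rightarrow> (mat \<Rightarrow> int \<Rightarrow> 'v \<Rightarrow> 'v)
     \<Rightarrow> ('v \<Rightarrow> 'v) \<Rightarrow> ('v \<Rightarrow> 'v) \<Rightarrow> bool" where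
  "affine_module n m s \<rho> \<rho>K \<rho>d \<longleftrightarrow>
     vector_space s \<and> Vector_Spaces.linear s s \<rho>K \<and> Vector_Spaces.linear s s \<rho>d \<and>
     (\<forall>X\<in>osp n m. \<forall>r. Vector_Spaces.linear s s (\<rho> X r)) \<and>
     (\<forall>X\<in>osp n m. \<forall>Y\<in>osp n m. \<forall>r v. \<rho> (madd X Y) r v = \<rho> X r v + \<rho> Y r v) \<and>
     (\<forall>X\<in>osp n m. \<forall>c r v. \<rho> (msc c X) r v = s c (\<rho> X r v)) \<and>
     (\<forall>a b. \<forall>X\<in>osp n m. \<forall>Y\<in>osp n m. mpart a X = X \<longrightarrow> mpart b Y = Y \<longrightarrow>
        (\<forall>r r' v. \<rho> X r (\<rho> Y r' v) - s (psign a b) (\<rho> Y r' (\<rho> X r v))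
            = \<rho> (sbr n m X Y) (r + r') v
              + s (if r + r' = 0 then of_int r * bform n m X Y else 0) (\<rho>K v))) \<and>
     (\<forall>X\<in>osp n m. \<forall>r v. \<rho>K (\<rho> X r v) = \<rho> X r (\<rho>K v)) \<and>
     (\<forall>v. \<rho>K (\<rho>d v) = \<rho>d (\<rho>K v)) \<and>
     (\<forall>X\<in>osp n m. \<forall>r v. \<rho>d (\<rho> X r v) - \<rho> X r (\<rho>d v) = s (of_int r) (\<rho> X r v))"

text \<open>v is a highest weight vector of weight Lambda = lam + k Lambda_0 + c delta
  (lam in h^*, Lambda(K) = k, Lambda(d) = c) for the Borel given by the simple roots
  {delta - theta} \<union> Pi: killed by g_alpha (alpha > 0) and by all of g t^r, r > 0.\<close>
definition hw_vector ::
  "nat \<Rightarrow> nat \<Rightarrow> (complex \<Rightarrow> 'v::ab_group_add \<Rightarrow> 'v) \<Rightarrow> (mat \<Rightarrow> int \<Rightarrow> 'v \<Rightarrow> 'v)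
     \<Rightarrow> ('v \<Rightarrow> 'v) \<Rightarrow> ('v \<Rightarrow> 'v) \<Rightarrow> weight \<Rightarrow> complex \<Rightarrow> complex \<Rightarrow> 'v \<Rightarrow> bool" where
  "hw_vector n m s \<rho> \<rho>K \<rho>d lam k c v \<longleftrightarrow>
     v \<noteq> 0 \<and> (\<forall>H\<in>cartan n m. \<rho> H 0 v = s (wt_eval n m lam H) v) \<and>
     \<rho>K v = s k v \<and> \<rho>d v = s c v \<and>
     (\<forall>\<alpha>\<in>pos_roots n m. \<forall>X\<in>rootspace n m \<alpha>. \<rho> X 0 v = 0) \<and>
     (\<forall>r::int. r > 0 \<longrightarrow> (\<forall>X\<in>osp n m. \<rho> X r v = 0))"

definition irreducible_mod ::
  "nat \<Rightarrow> nat \<Rightarrow> (complex \<Rightarrow> 'v::ab_group_add \<Rightarrow> 'v) \<Rightarrow> (mat \<Rightarrow> int \<Rightarrow> 'v \<Rightarrow> 'v)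
     \<Rightarrow> ('v \<Rightarrow> 'v) \<Rightarrow> ('v \<Rightarrow> 'v) \<Rightarrow> bool" where
  "irreducible_mod n m s \<rho> \<rho>K \<rho>d \<longleftrightarrow>
     (\<forall>W. module.subspace s W \<and> (\<forall>X\<in>osp n m. \<forall>r. \<forall>w\<in>W. \<rho> X r w \<in> W) \<and>
          (\<forall>w\<in>W. \<rho>K w \<in> W \<and> \<rho>d w \<in> W) \<and> W \<noteq> {0} \<longrightarrow> W = UNIV)"

definition is_L ::
  "nat \<Rightarrow> nat \<Rightarrow> (complex \<Rightarrow> 'v::ab_group_add \<Rightarrow> 'v) \<Rightarrow> (mat \<Rightarrow> int \<Rightarrow> 'v \<Rightarrow> 'v)
     \<Rightarrow> ('v \<Rightarrow> 'v) \<Rightarrow> ('v \<Rightarrow> 'v) \<Rightarrow> weight \<Rightarrow> complex \<Rightarrow> complex \<Rightarrow> bool" where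
  "is_L n m s \<rho> \<rho>K \<rho>d lam k c \<longleftrightarrow>
     affine_module n m s \<rho> \<rho>K \<rho>d \<and> irreducible_mod n m s \<rho> \<rho>K \<rho>d \<and>
     (\<exists>v. hw_vector n m s \<rho> \<rho>K \<rho>d lam k c v)"

text \<open>Integrability: g^_{-gamma} acts locally nilpotently for gamma a positive root of g^#_0
  (g^_{-gamma} = g_{-gamma} t^0) and for gamma = alpha + r delta, alpha in Delta^#_0, r > 0
  (g^_{-gamma} = g_{-alpha} t^{-r}).\<close>
definition integrable ::
  "nat \<Rightarrow> nat \<Rightarrow> (mat \<Rightarrow> int \<Rightarrow> 'v::zero \<Rightarrow> 'v) \<Rightarrow> bool" where
  "integrable n m \<rho> \<longleftrightarrow>
     (\<forall>\<gamma>\<in>pos_roots n m \<inter> roots_eps m. \<forall>X\<in>rootspace n m (- \<gamma>). \<forall>v. \<exists>N. (\<rho> X 0 ^^ N) v = 0) \<and>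
     (\<forall>\<alpha>\<in>roots_eps m. \<forall>r::int. r > 0 \<longrightarrow>
        (\<forall>X\<in>rootspace n m (- \<alpha>). \<forall>v. \<exists>N. (\<rho> X (- r) ^^ N) v = 0))"

end

theory Submission
  imports Defs
begin

text \<open>
  Let \<open>v\<close> be the highest weight vector. The real roots of the affinization of \<open>sp(2m)\<close> have the
  simple roots \<open>2 eps 1\<close>, \<open>eps (x + 1) - eps x\<close> and \<open>delta - 2 eps m\<close>, and the right-hand side says
  that \<open>Lambda\<close> takes values in \<open>\<nat>\<close> on their coroots. This is necessary by \<open>sl(2)\<close> theory applied
  to \<open>v\<close>.

  For the converse, these roots \<open>gamma\<close> need not be simple for the given Borel subalgebra. But
  \<open>(Lambda | beta i) = 0\<close> makes \<open>f v\<close> singular for the root vector \<open>f\<close> of \<open>- beta i\<close>, so \<open>f v = 0\<close> by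
  irreducibility, and \<open>v\<close> is also a highest weight vector for the Borel subalgebra obtained by the odd
  reflection in \<open>beta i\<close>. One such reflection makes \<open>gamma\<close> simple; then a power of the lowering
  operator of \<open>gamma\<close> maps \<open>v\<close> to a singular vector, which vanishes, and the lowering operator is
  locally nilpotent on the whole module. Hence the set of weights is stable under the affine Weyl
  group of \<open>sp(2m)\<close>. Its translations decrease the multiple of \<open>delta\<close> in a root, so that finiteness of
  all root strings follows from the fact that the weights are bounded above.

  A Borel subalgebra is encoded by an integer linear functional on the affine roots: \<open>om\<close> gives its
  values on the weights of the natural representation and \<open>D\<close> its value on \<open>delta\<close>.
\<close>

section \<open>Matrices in \<open>osp(2n|2m)\<close>\<close>

text \<open>Uniqueness of the highest weight vector is replaced by a graded statement. A functional
  defines a grading operator; by irreducibility the module is spanned by words in lowering operators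
  applied to any singular vector, so every weight has at most the degree of that vector. A second
  singular vector of smaller degree would thus bound the degree of \<open>v\<close> by something
  smaller. The argument avoids Verma modules and ordered monomials and applies to every functional
  for which \<open>v\<close> is singular.

  Simplicity of a root is awkward to check while the Borel subalgebra varies. It is replaced by
  being the only positive root of least degree, which a well chosen integer functional provides. The
  factor 4 in front of \<open>height\<close> leaves room to move single values without creating
  ties.

  Local nilpotency is first known for the simple roots of the affine sp(2m) only. Lifting Weyl group
  elements to operators would require exponentials; instead just the set of weights is transported.
  That suffices because root vectors shift weights and weight vectors span the module.\<close>

definition ng :: "idx \<Rightarrow> idx" where "ng p = (fst p, - snd p)"

text \<open>On valid indices this is \<open>Bf p (ng p)\<close>, the only nonzero entry in row
  \<open>p\<close> of the form.\<close>

definition bsgn :: "idx \<Rightarrow> complex" where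
  "bsgn p = (if fst p \<and> snd p < 0 then -1 else 1)"

text \<open>The last factor is the Koszul sign \<open>psign a (fst p)\<close>, with \<open>a\<close>
  the parity of the entry at \<open>(q, p)\<close>. As it depends on the entry alone, one equation
  can cover both parities of a matrix.\<close>

definition osgn :: "idx \<Rightarrow> idx \<Rightarrow> complex" where
  "osgn p q = - bsgn p * bsgn q * (if fst p \<and> \<not> fst q then -1 else 1)"

lemma ng_ng [simp]: "ng (ng p) = p" and fst_ng [simp]: "fst (ng p) = fst p"
  and snd_ng [simp]: "snd (ng p) = - snd p"
  by (simp_all add: ng_def)

lemma ng_inj [simp]: "ng p = ng q \<longleftrightarrow> p = q"
  by (metis ng_ng)

lemma Idx_iff: "p \<in> Idx n m \<longleftrightarrow> snd p \<noteq> 0 \<and> \<bar>snd p\<bar> \<le> (if fst p then int m else int n)"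
  by (cases p) (auto simp: Idx_def)

lemma ng_Idx [simp]: "ng p \<in> Idx n m \<longleftrightarrow> p \<in> Idx n m"
  by (simp add: Idx_iff)

lemma ng_neq: "p \<in> Idx n m \<Longrightarrow> ng p \<noteq> p"
  by (metis Idx_iff snd_ng neg_equal_zero)

lemma finite_Idx [simp]: "finite (Idx n m)"
proof (rule finite_subset)
  show "Idx n m \<subseteq> UNIV \<times> {- int (n + m)..int (n + m)}"
    by (auto simp: Idx_def)
qed simp

lemma bsgn_mult_self [simp]: "bsgn p * bsgn p = 1" "bsgn p * (bsgn p * x) = x"
  by (auto simp: bsgn_def)

lemma Bf_left:
  assumes "q \<in> Idx n m"
  shows "(\<Sum>r\<in>Idx n m. f r * Bf r q) = f (ng q) * bsgn (ng q)"
proof -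
  have "(\<Sum>r\<in>Idx n m. f r * Bf r q) = (\<Sum>r\<in>Idx n m. if r = ng q then f r * bsgn r else 0)"
    using assms by (intro sum.cong) (auto simp: Bf_def bsgn_def ng_def Idx_iff prod_eq_iff)
  also have "\<dots> = f (ng q) * bsgn (ng q)"
    using assms by simp
  finally show ?thesis .
qed

lemma Bf_right:
  assumes "p \<in> Idx n m"
  shows "(\<Sum>r\<in>Idx n m. Bf p r * f r) = bsgn p * f (ng p)"
proof -
  have "(\<Sum>r\<in>Idx n m. Bf p r * f r) = (\<Sum>r\<in>Idx n m. if r = ng p then bsgn p * f r else 0)"
    using assms by (intro sum.cong) (auto simp: Bf_def bsgn_def ng_def Idx_iff prod_eq_iff)
  also have "\<dots> = bsgn p * f (ng p)"
    using assms by simp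
  finally show ?thesis .
qed

lemma ball_ng: "(\<forall>q\<in>Idx n m. P q) \<longleftrightarrow> (\<forall>q\<in>Idx n m. P (ng q))"
proof (intro iffI ballI)
  fix q assume "\<forall>q\<in>Idx n m. P (ng q)" "q \<in> Idx n m"
  then have "P (ng (ng q))" using ng_Idx by blast
  then show "P q" by simp
qed simp

text \<open>Testing on the basis vectors \<open>p\<close> and \<open>ng q\<close> leaves one term in
  each sum. Every entry belongs to exactly one homogeneous part, so the even and the odd condition
  merge into one relation between entries.\<close>

lemma osp_iff:
  "X \<in> osp n m \<longleftrightarrow> (\<forall>p q. p \<notin> Idx n m \<or> q \<notin> Idx n m \<longrightarrow> X p q = 0)
     \<and> (\<forall>p\<in>Idx n m. \<forall>q\<in>Idx n m. X (ng p) (ng q) = osgn p q * X q p)"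
proof -
  have mp: "mpart a (mpart a X) = mpart a X" for a
    by (auto simp: mpart_def fun_eq_iff)
  have eq: "(\<forall>a. mpart a X q p * bsgn q + psign a (fst p) * (bsgn p * mpart a X (ng p) (ng q)) = 0)
     \<longleftrightarrow> X (ng p) (ng q) = osgn p q * X q p" for p q
  proof -
    define a where "a = (fst p \<noteq> fst q)"
    define w where "w = psign a (fst p)"
    have w: "w * w = 1" by (simp add: w_def psign_def)
    have "(\<forall>a. mpart a X q p * bsgn q + psign a (fst p) * (bsgn p * mpart a X (ng p) (ng q)) = 0)
       \<longleftrightarrow> X q p * bsgn q + w * (bsgn p * X (ng p) (ng q)) = 0"
      by (cases "fst p"; cases "fst q") (simp_all add: all_bool_eq mpart_def w_def a_def)
    also have "\<dots> \<longleftrightarrow> (w * bsgn p) * (X q p * bsgn q + w * (bsgn p * X (ng p) (ng q))) = 0"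
      using w by (metis bsgn_mult_self(1) mult_eq_0_iff mult_zero_left one_neq_zero)
    also have "(w * bsgn p) * (X q p * bsgn q + w * (bsgn p * X (ng p) (ng q)))
        = w * bsgn p * bsgn q * X q p + (w * w) * (bsgn p * bsgn p) * X (ng p) (ng q)"
      by (simp only: algebra_simps)
    also have "\<dots> = X (ng p) (ng q) - osgn p q * X q p"
      unfolding w bsgn_mult_self by (cases "fst p"; cases "fst q") (simp_all add: osgn_def w_def a_def psign_def)
    finally show ?thesis by simp
  qed
  have osp_hom: "osp_hom n m a (mpart a X) \<longleftrightarrow> (\<forall>p q. p \<notin> Idx n m \<or> q \<notin> Idx n m \<longrightarrow> mpart a X p q = 0)
     \<and> (\<forall>p\<in>Idx n m. \<forall>q\<in>Idx n m. mpart a X q p * bsgn q + psign a (fst p) * (bsgn p * mpart a X (ng p) (ng q)) = 0)" for a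
  proof -
    have "(\<forall>q\<in>Idx n m. (\<Sum>r\<in>Idx n m. mpart a X r p * Bf r q) + psign a (fst p) * (\<Sum>r\<in>Idx n m. Bf p r * mpart a X r q) = 0)
      \<longleftrightarrow> (\<forall>q\<in>Idx n m. mpart a X q p * bsgn q + psign a (fst p) * (bsgn p * mpart a X (ng p) (ng q)) = 0)"
      if "p \<in> Idx n m" for p
      using that by (subst ball_ng) (simp add: Bf_left Bf_right)
    then show ?thesis
      unfolding osp_hom_def mp by (simp cong: ball_cong)
  qed
  have "X \<in> osp n m \<longleftrightarrow> (\<forall>p q. p \<notin> Idx n m \<or> q \<notin> Idx n m \<longrightarrow> (\<forall>a. mpart a X p q = 0))
     \<and> (\<forall>p\<in>Idx n m. \<forall>q\<in>Idx n m. \<forall>a. mpart a X q p * bsgn q + psign a (fst p) * (bsgn p * mpart a X (ng p) (ng q)) = 0)"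
    unfolding osp_def mem_Collect_eq osp_hom all_bool_eq by blast
  also have "(\<forall>p q. p \<notin> Idx n m \<or> q \<notin> Idx n m \<longrightarrow> (\<forall>a. mpart a X p q = 0)) \<longleftrightarrow> (\<forall>p q. p \<notin> Idx n m \<or> q \<notin> Idx n m \<longrightarrow> X p q = 0)"
    by (auto simp: mpart_def)
  finally show ?thesis unfolding eq .
qed

lemma osp_outside: "X \<in> osp n m \<Longrightarrow> p \<notin> Idx n m \<or> q \<notin> Idx n m \<Longrightarrow> X p q = 0"
  unfolding osp_iff by blast

lemma osp_ng: "X \<in> osp n m \<Longrightarrow> p \<in> Idx n m \<Longrightarrow> q \<in> Idx n m \<Longrightarrow> X (ng p) (ng q) = osgn p q * X q p"
  unfolding osp_iff by blast

lemma osp_0: "(\<lambda>p q. 0) \<in> osp n m"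
  and osp_madd: "X \<in> osp n m \<Longrightarrow> Y \<in> osp n m \<Longrightarrow> madd X Y \<in> osp n m"
  and osp_msc: "X \<in> osp n m \<Longrightarrow> msc c X \<in> osp n m"
  unfolding osp_iff by (auto simp: madd_def msc_def algebra_simps)

lemma osp_mpart: "X \<in> osp n m \<Longrightarrow> mpart a X \<in> osp n m"
  unfolding osp_iff by (auto simp: mpart_def)

lemma mpart_mpart [simp]: "mpart a (mpart a X) = mpart a X"
  by (auto simp: mpart_def fun_eq_iff)

lemma madd_mpart: "madd (mpart False X) (mpart True X) = X"
  by (auto simp: madd_def mpart_def fun_eq_iff)

lemma mpart_zeroD: "mpart a X = X \<Longrightarrow> (fst p \<noteq> fst q) \<noteq> a \<Longrightarrow> X p q = 0"
  unfolding mpart_def fun_eq_iff by (metis (full_types))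

lemma mpart_eqI: "(\<And>p q. X p q \<noteq> 0 \<Longrightarrow> (fst p \<noteq> fst q) = a) \<Longrightarrow> mpart a X = X"
  unfolding mpart_def fun_eq_iff by metis

lemma mpart_other: "mpart a X = X \<Longrightarrow> mpart b X = (if a = b then X else (\<lambda>p q. 0))"
  by (intro ext) (simp add: mpart_def[of b] mpart_zeroD)

lemma mmul_0 [simp]: "mmul n m (\<lambda>p q. 0) Y = (\<lambda>p q. 0)" "mmul n m X (\<lambda>p q. 0) = (\<lambda>p q. 0)"
  by (simp_all add: mmul_def)

lemma sbr_homogeneous:
  "mpart a X = X \<Longrightarrow> mpart b Y = Y \<Longrightarrow>
    sbr n m X Y = (\<lambda>p q. mmul n m X Y p q - psign a b * mmul n m Y X p q)"
  unfolding sbr_def mpart_other[of a X] mpart_other[of b Y]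
  by (cases a; cases b) (simp_all add: UNIV_bool psign_def)

section \<open>Closure under the super bracket and spanning matrix units\<close>

lemma sum_ng: "(\<Sum>r\<in>Idx n m. f (ng r)) = (\<Sum>r\<in>Idx n m. f r)"
  by (rule sum.reindex_bij_witness[of _ ng ng]) auto

text \<open>Elements of osp are the negatives of their superadjoints, and superadjoints reverse
  products up to a Koszul sign. The identity for \<open>osgn p r * osgn r q\<close> holds only when
  the two entries have parities \<open>a\<close> and \<open>b\<close>; all other \<open>r\<close>
  contribute zero.\<close>

lemma mmul_ng:
  assumes "X \<in> osp n m" "Y \<in> osp n m" "mpart a X = X" "mpart b Y = Y" "p \<in> Idx n m" "q \<in> Idx n m"
  shows "mmul n m X Y (ng p) (ng q) = - psign a b * osgn p q * mmul n m Y X q p"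
proof -
  have "mmul n m X Y (ng p) (ng q) = (\<Sum>r\<in>Idx n m. X (ng p) (ng r) * Y (ng r) (ng q))"
    unfolding mmul_def by (rule sum_ng[symmetric])
  also have "\<dots> = (\<Sum>r\<in>Idx n m. - psign a b * osgn p q * (Y q r * X r p))"
  proof (rule sum.cong[OF refl])
    fix r assume r: "r \<in> Idx n m"
    have os: "osgn p r * osgn r q = - psign a b * osgn p q" if "X r p \<noteq> 0" "Y q r \<noteq> 0"
    proof -
      have ab: "a = (fst r \<noteq> fst p)" "b = (fst q \<noteq> fst r)"
        using that mpart_zeroD[OF assms(3), of r p] mpart_zeroD[OF assms(4), of q r] by blast+
      show ?thesis
        unfolding ab by (cases "fst p"; cases "fst q"; cases "fst r") (simp_all add: osgn_def psign_def)
    qed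
    have "X (ng p) (ng r) * Y (ng r) (ng q) = (osgn p r * osgn r q) * (Y q r * X r p)"
      unfolding osp_ng[OF assms(1,5) r] osp_ng[OF assms(2) r assms(6)] by simp
    also have "\<dots> = - psign a b * osgn p q * (Y q r * X r p)"
      using os by (cases "X r p = 0 \<or> Y q r = 0") auto
    finally show "X (ng p) (ng r) * Y (ng r) (ng q) = - psign a b * osgn p q * (Y q r * X r p)" .
  qed
  finally show ?thesis by (simp add: mmul_def sum_distrib_left)
qed

lemma sbr_osp:
  assumes "X \<in> osp n m" "Y \<in> osp n m" "mpart a X = X" "mpart b Y = Y"
  shows "sbr n m X Y \<in> osp n m"
  unfolding osp_iff sbr_homogeneous[OF assms(3,4)]
proof (intro conjI allI ballI impI)
  fix p q assume "p \<notin> Idx n m \<or> q \<notin> Idx n m"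
  then show "mmul n m X Y p q - psign a b * mmul n m Y X p q = 0"
    using osp_outside[OF assms(1)] osp_outside[OF assms(2)] by (elim disjE) (simp_all add: mmul_def)
next
  fix p q assume p: "p \<in> Idx n m" "q \<in> Idx n m"
  have "psign a b = psign b a" "psign a b * psign b a = 1"
    by (auto simp: psign_def)
  then show "mmul n m X Y (ng p) (ng q) - psign a b * mmul n m Y X (ng p) (ng q) =
       osgn p q * (mmul n m X Y q p - psign a b * mmul n m Y X q p)"
    unfolding mmul_ng[OF assms p] mmul_ng[OF assms(2,1,4,3) p] by (simp add: algebra_simps)
qed

text \<open>For \<open>j = ng i\<close> the two entries coincide: the matrix is twice an elementary one if \<open>i\<close> is odd, and
  it vanishes if \<open>i\<close> is even.\<close>
definition osp_unit :: "idx \<Rightarrow> idx \<Rightarrow> mat" where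
  "osp_unit i j = (\<lambda>p q. (if p = i \<and> q = j then 1 else 0) + (if p = ng j \<and> q = ng i then osgn j i else 0))"

lemma osp_unit_osp:
  assumes "i \<in> Idx n m" "j \<in> Idx n m"
  shows "osp_unit i j \<in> osp n m"
proof -
  have os: "osgn (ng i) (ng j) * osgn j i = 1"
    using assms by (cases "fst i"; cases "fst j") (auto simp: osgn_def bsgn_def Idx_iff)
  show ?thesis
    unfolding osp_iff
  proof (intro conjI allI ballI impI)
    fix p q assume "p \<notin> Idx n m \<or> q \<notin> Idx n m"
    then have "\<not> (p = i \<and> q = j)" "\<not> (p = ng j \<and> q = ng i)"
      using assms ng_Idx by metis+
    then show "osp_unit i j p q = 0"
      by (simp only: osp_unit_def if_False) simp
  next
    fix p q
    show "osp_unit i j (ng p) (ng q) = osgn p q * osp_unit i j q p"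
    proof (cases "p = ng i \<and> q = ng j \<or> p = j \<and> q = i")
      case True
      show ?thesis
      proof (cases "j = ng i")
        case j: True
        have "p = ng i \<and> q = i" using True j by simp
        then show ?thesis using os by (simp add: osp_unit_def j distrib_left)
      next
        case False
        then have "ng j \<noteq> i" "i \<noteq> ng j" "ng i \<noteq> j" by auto
        then show ?thesis using os True False by (elim disjE conjE) (simp_all add: osp_unit_def)
      qed
    next
      case False
      then have "\<not> (ng p = i \<and> ng q = j)" "\<not> (ng p = ng j \<and> ng q = ng i)" "\<not> (q = i \<and> p = j)" "\<not> (q = ng j \<and> p = ng i)"
        by auto
      then show ?thesis by (simp only: osp_unit_def if_False) simp
    qed
  qed
qed

lemma osp_unit_nz:
  assumes "osp_unit i j p q \<noteq> 0"
  shows "(p = i \<and> q = j) \<or> (p = ng j \<and> q = ng i)"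
proof (rule ccontr)
  assume "\<not> ?thesis"
  then have "\<not> (p = i \<and> q = j)" "\<not> (p = ng j \<and> q = ng i)" by blast+
  then have "osp_unit i j p q = 0" by (simp only: osp_unit_def if_False) simp
  then show False using assms by blast
qed

lemma osp_unit_parity: "mpart (fst i \<noteq> fst j) (osp_unit i j) = osp_unit i j"
proof (rule mpart_eqI)
  fix p q assume "osp_unit i j p q \<noteq> 0"
  from osp_unit_nz[OF this] show "(fst p \<noteq> fst q) = (fst i \<noteq> fst j)"
    by (elim disjE conjE) auto
qed

lemma osp_unit_even_ng: "\<not> fst i \<Longrightarrow> osp_unit i (ng i) = (\<lambda>p q. 0)"
  by (simp add: osp_unit_def osgn_def bsgn_def fun_eq_iff)

text \<open>The units at \<open>(i, j)\<close> and \<open>(ng j, ng i)\<close> are proportional, and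
  for \<open>j = ng i\<close> the unit is doubled or zero. Summing over all index pairs therefore
  counts each entry twice, hence the division by 2.\<close>

lemma osp_expand:
  assumes "X \<in> osp n m"
  shows "X p q = (\<Sum>z\<in>Idx n m \<times> Idx n m. X (fst z) (snd z) / 2 * osp_unit (fst z) (snd z) p q)"
proof (cases "p \<in> Idx n m \<and> q \<in> Idx n m")
  case True
  have "(\<Sum>z\<in>Idx n m \<times> Idx n m. X (fst z) (snd z) / 2 * osp_unit (fst z) (snd z) p q)
    = (\<Sum>z\<in>Idx n m \<times> Idx n m. (if z = (p, q) then X p q / 2 else 0) +
        (if z = (ng q, ng p) then X (ng q) (ng p) / 2 * osgn (ng p) (ng q) else 0))"
  proof (intro sum.cong refl)
    fix z assume "z \<in> Idx n m \<times> Idx n m"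
    have "p = ng (snd z) \<and> q = ng (fst z) \<longleftrightarrow> z = (ng q, ng p)"
      by (metis ng_ng prod.collapse fst_conv snd_conv)
    moreover have "p = fst z \<and> q = snd z \<longleftrightarrow> z = (p, q)"
      by (metis prod.collapse fst_conv snd_conv)
    ultimately have u: "osp_unit (fst z) (snd z) p q = (if z = (p, q) then 1 else 0) + (if z = (ng q, ng p) then osgn (snd z) (fst z) else 0)"
      unfolding osp_unit_def by (simp only:)
    have calc: "x / 2 * ((if a then 1 else 0) + (if b then t else 0)) = (if a then y / 2 else 0) + (if b then y' / 2 * t' else 0)"
      if "a \<Longrightarrow> x = y" "b \<Longrightarrow> x = y'" "b \<Longrightarrow> t = t'" for a b and x y y' t t' :: complex
      using that by (cases a; cases b) (simp_all add: distrib_left)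
    show "X (fst z) (snd z) / 2 * osp_unit (fst z) (snd z) p q = (if z = (p, q) then X p q / 2 else 0) +
        (if z = (ng q, ng p) then X (ng q) (ng p) / 2 * osgn (ng p) (ng q) else 0)"
      unfolding u by (rule calc) (simp_all only: fst_conv snd_conv)
  qed
  also have "\<dots> = X p q / 2 + X (ng q) (ng p) * osgn (ng p) (ng q) / 2"
    using True by (simp add: sum.distrib)
  also have "X (ng q) (ng p) * osgn (ng p) (ng q) = X p q"
    using osp_ng[OF assms, of "ng p" "ng q"] True by simp
  finally show ?thesis by simp
next
  case False
  then have "osp_unit (fst z) (snd z) p q = 0" if "z \<in> Idx n m \<times> Idx n m" for z
    using False osp_unit_nz[of "fst z" "snd z" p q] ng_Idx that mem_Times_iff by metis
  then show ?thesis
    using osp_outside[OF assms, of p q] False by simp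
qed

text \<open>Linear induction over matrix units. Only units at nonzero entries of \<open>X\<close>
  have to be checked, which is what makes degree arguments possible for a bracket: its nonzero
  entries have a known degree.\<close>

lemma osp_expand_in:
  assumes "X \<in> osp n m" and G0: "(\<lambda>p q. 0) \<in> G"
    and Gadd: "\<And>X Y. X \<in> osp n m \<Longrightarrow> Y \<in> osp n m \<Longrightarrow> X \<in> G \<Longrightarrow> Y \<in> G \<Longrightarrow> madd X Y \<in> G"
    and Gsc: "\<And>c X. X \<in> osp n m \<Longrightarrow> X \<in> G \<Longrightarrow> msc c X \<in> G"
    and unit: "\<And>i j. i \<in> Idx n m \<Longrightarrow> j \<in> Idx n m \<Longrightarrow> X i j \<noteq> 0 \<Longrightarrow> osp_unit i j \<in> G"
  shows "X \<in> G"
proof -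
  define Y where "Y z = msc (X (fst z) (snd z) / 2) (osp_unit (fst z) (snd z))" for z
  have Y: "Y z \<in> osp n m \<and> Y z \<in> G" if "z \<in> Idx n m \<times> Idx n m" for z
  proof (cases "X (fst z) (snd z) = 0")
    case True
    then have "Y z = (\<lambda>p q. 0)" by (simp add: Y_def msc_def)
    then show ?thesis using osp_0 G0 by simp
  next
    case False
    have z: "fst z \<in> Idx n m" "snd z \<in> Idx n m" using that by auto
    show ?thesis
      unfolding Y_def using osp_msc[OF osp_unit_osp[OF z]] Gsc[OF osp_unit_osp[OF z] unit[OF z False]] by blast
  qed
  have sums: "(\<lambda>p q. \<Sum>z\<in>A. Y z p q) \<in> osp n m \<and> (\<lambda>p q. \<Sum>z\<in>A. Y z p q) \<in> G"
    if "finite A" "A \<subseteq> Idx n m \<times> Idx n m" for A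
    using that
  proof (induction A)
    case empty
    then show ?case using osp_0 G0 by simp
  next
    case (insert z A)
    have "(\<lambda>p q. \<Sum>z\<in>insert z A. Y z p q) = madd (Y z) (\<lambda>p q. \<Sum>z\<in>A. Y z p q)"
      using insert by (simp add: madd_def)
    moreover have "Y z \<in> osp n m" "Y z \<in> G" using insert.prems Y[of z] by blast+
    moreover have "(\<lambda>p q. \<Sum>z\<in>A. Y z p q) \<in> osp n m" "(\<lambda>p q. \<Sum>z\<in>A. Y z p q) \<in> G"
      using insert by blast+
    ultimately show ?case using osp_madd Gadd by metis
  qed
  have "(\<lambda>p q. \<Sum>z\<in>Idx n m \<times> Idx n m. Y z p q) = X"
    by (intro ext) (simp only: Y_def msc_def osp_expand[OF assms(1), symmetric])
  then show ?thesis using sums[OF _ order_refl] by simp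
qed

section \<open>Commutators and the Cartan subalgebra\<close>

lemma mmul_assoc: "mmul n m (mmul n m X Y) Z = mmul n m X (mmul n m Y Z)"
proof -
  have "(\<Sum>r\<in>Idx n m. (\<Sum>t\<in>Idx n m. X p t * Y t r) * Z r q)
      = (\<Sum>t\<in>Idx n m. X p t * (\<Sum>r\<in>Idx n m. Y t r * Z r q))" for p q
    by (simp add: sum_distrib_left sum_distrib_right mult.assoc) (rule sum.swap)
  then show ?thesis by (simp add: mmul_def)
qed

lemma mmul_msub: "mmul n m (msub X Y) Z = msub (mmul n m X Z) (mmul n m Y Z)"
  "mmul n m Z (msub X Y) = msub (mmul n m Z X) (mmul n m Z Y)"
  by (simp_all add: mmul_def msub_def algebra_simps sum_subtractf)

lemma mmul_madd: "mmul n m (madd X Y) Z = madd (mmul n m X Z) (mmul n m Y Z)"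
  "mmul n m Z (madd X Y) = madd (mmul n m Z X) (mmul n m Z Y)"
  by (simp_all add: mmul_def madd_def algebra_simps sum.distrib)

definition mcomm :: "nat \<Rightarrow> nat \<Rightarrow> mat \<Rightarrow> mat \<Rightarrow> mat" where
  "mcomm n m X Y = msub (mmul n m X Y) (mmul n m Y X)"

text \<open>The sign \<open>psign False b\<close> is 1, so bracketing with an even element is the
  plain commutator for both parities of \<open>Y\<close>. Elements of \<open>rootspace\<close> can
  then be treated without splitting them into homogeneous parts.\<close>

lemma mcomm_even:
  assumes "mpart False X = X"
  shows "mcomm n m X Y = madd (sbr n m X (mpart False Y)) (sbr n m X (mpart True Y))"
proof -
  have "mcomm n m X Y = mcomm n m X (madd (mpart False Y) (mpart True Y))"
    by (simp add: madd_mpart)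
  then show ?thesis
    by (simp add: sbr_homogeneous[OF assms mpart_mpart] mcomm_def mmul_madd)
      (simp add: madd_def msub_def psign_def fun_eq_iff)
qed

lemma mcomm_osp: "X \<in> osp n m \<Longrightarrow> Y \<in> osp n m \<Longrightarrow> mpart False X = X \<Longrightarrow> mcomm n m X Y \<in> osp n m"
  unfolding mcomm_even by (intro osp_madd sbr_osp[OF _ osp_mpart _ mpart_mpart])

lemma bform_madd: "bform n m X (madd Y Z) = bform n m X Y + bform n m X Z"
  by (simp add: bform_def str_def mmul_madd) (simp add: madd_def distrib_left sum.distrib)

lemma osgn_self: "osgn p p = -1"
  by (simp add: osgn_def)

lemma cartan_iff: "H \<in> cartan n m \<longleftrightarrow> (\<forall>p q. p \<noteq> q \<or> p \<notin> Idx n m \<longrightarrow> H p q = 0) \<and> (\<forall>p\<in>Idx n m. H (ng p) (ng p) = - H p p)"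
proof
  assume "H \<in> cartan n m"
  then have H: "H \<in> osp n m" "\<And>p q. p \<noteq> q \<Longrightarrow> H p q = 0"
    unfolding cartan_def by blast+
  have "H (ng p) (ng p) = - H p p" if "p \<in> Idx n m" for p
    using osp_ng[OF H(1) that that] by (simp add: osgn_self)
  then show "(\<forall>p q. p \<noteq> q \<or> p \<notin> Idx n m \<longrightarrow> H p q = 0) \<and> (\<forall>p\<in>Idx n m. H (ng p) (ng p) = - H p p)"
    using osp_outside[OF H(1)] H(2) by metis
next
  assume "(\<forall>p q. p \<noteq> q \<or> p \<notin> Idx n m \<longrightarrow> H p q = 0) \<and> (\<forall>p\<in>Idx n m. H (ng p) (ng p) = - H p p)"
  then have H: "\<And>p q. p \<noteq> q \<or> p \<notin> Idx n m \<Longrightarrow> H p q = 0" "\<And>p. p \<in> Idx n m \<Longrightarrow> H (ng p) (ng p) = - H p p"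
    by blast+
  have "H (ng p) (ng q) = osgn p q * H q p" if "p \<in> Idx n m" for p q
    using H that by (cases "p = q") (simp_all add: osgn_self)
  moreover have "H p q = 0" if "p \<notin> Idx n m \<or> q \<notin> Idx n m" for p q
    using H(1)[of p q] that by metis
  ultimately show "H \<in> cartan n m"
    unfolding cartan_def osp_iff mem_Collect_eq using H(1) by blast
qed

lemma cartan_even: "H \<in> cartan n m \<Longrightarrow> mpart False H = H"
  unfolding cartan_iff by (rule mpart_eqI) (metis (full_types))

lemma cartan_osp: "H \<in> cartan n m \<Longrightarrow> H \<in> osp n m"
  by (simp add: cartan_def)

lemma cartan_offdiag: "H \<in> cartan n m \<Longrightarrow> p \<noteq> q \<or> p \<notin> Idx n m \<Longrightarrow> H p q = 0"
  unfolding cartan_iff by blast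

section \<open>Weights of the natural representation and root vectors\<close>

lemma mmul_cartan:
  assumes "H \<in> cartan n m"
  shows "mmul n m H X p q = H p p * X p q" "mmul n m X H p q = X p q * H q q"
proof -
  note H = cartan_offdiag[OF assms]
  have "(\<Sum>r\<in>Idx n m. H p r * X r q) = (\<Sum>r\<in>Idx n m. if r = p then H p p * X p q else 0)"
    by (intro sum.cong refl) (simp add: H)
  then show "mmul n m H X p q = H p p * X p q"
    by (simp add: mmul_def H)
  have "(\<Sum>r\<in>Idx n m. X p r * H r q) = (\<Sum>r\<in>Idx n m. if r = q then X p q * H q q else 0)"
    by (intro sum.cong refl) (simp add: H)
  then show "mmul n m X H p q = X p q * H q q"
    by (simp add: mmul_def H)
qed

text \<open>The weight of the basis vector \<open>p\<close>. All roots become differences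
  \<open>wt i - wt j\<close>; the long roots of sp(2m) arise for \<open>j = ng i\<close>.\<close>

definition wt :: "idx \<Rightarrow> weight" where
  "wt p = wsc (of_int (sgn (snd p))) ((if fst p then eps else del) (nat \<bar>snd p\<bar>))"

lemma wt_ng: "wt (ng p) = - wt p"
  by (auto simp: wt_def wsc_def fun_eq_iff)

lemma wt_eval_add: "wt_eval n m (\<mu> + \<nu>) H = wt_eval n m \<mu> H + wt_eval n m \<nu> H"
  and wt_eval_minus: "wt_eval n m (- \<mu>) H = - wt_eval n m \<mu> H"
  and wt_eval_diff: "wt_eval n m (\<mu> - \<nu>) H = wt_eval n m \<mu> H - wt_eval n m \<nu> H"
  and wt_eval_wsc: "wt_eval n m (wsc c \<mu>) H = c * wt_eval n m \<mu> H"
  by (simp_all add: wt_eval_def wsc_def sum.distrib sum_negf sum_subtractf sum_distrib_left algebra_simps)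

lemma wt_eval_wt:
  assumes "H \<in> cartan n m" "p \<in> Idx n m"
  shows "wt_eval n m (wt p) H = H p p"
proof -
  have pos: "wt_eval n m (wt p) H = H p p" if "p \<in> Idx n m" "snd p > 0" for p
  proof -
    define k where "k = nat (snd p)"
    have k: "snd p = int k" "1 \<le> k" using that(2) by (auto simp: k_def)
    have *: "(\<Sum>i=Suc 0..N. (if a = i then 1 else 0) * f i) = (if Suc 0 \<le> a \<and> a \<le> N then f a else (0::complex))" for N a :: nat and f
    proof -
      have "(\<Sum>i=Suc 0..N. (if a = i then 1 else 0) * f i) = (\<Sum>i=Suc 0..N. if a = i then f i else 0)"
        by (intro sum.cong) auto
      then show ?thesis by (simp add: sum.delta')
    qed
    show ?thesis
    proof (cases p)
      case (Pair b x)
      then show ?thesis using k that(1)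
        by (cases b) (auto simp: wt_def wt_eval_def wsc_def eps_def del_def eq_commute[of _ k] * Idx_iff)
    qed
  qed
  show ?thesis
  proof (cases "snd p > 0")
    case False
    then have "snd (ng p) > 0" using assms(2) by (simp add: Idx_iff)
    then have "wt_eval n m (wt (ng p)) H = H (ng p) (ng p)" using pos assms(2) by simp
    then show ?thesis using assms by (simp add: wt_ng wt_eval_minus cartan_iff)
  qed (use pos assms in auto)
qed

lemma osp_unit_rootspace:
  assumes "i \<in> Idx n m" "j \<in> Idx n m"
  shows "osp_unit i j \<in> rootspace n m (wt i - wt j)"
proof -
  have "(H p p - H q q) * osp_unit i j p q = (H i i - H j j) * osp_unit i j p q" if H: "H \<in> cartan n m" for H p q
    using osp_unit_nz[of i j p q] H assms by (cases "osp_unit i j p q = 0") (auto simp: cartan_iff)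
  then show ?thesis
    using assms by (auto simp: rootspace_def osp_unit_osp msub_def msc_def fun_eq_iff mmul_cartan
      wt_eval_diff wt_eval_wt algebra_simps)
qed

lemma osp_unit_cartan:
  assumes "i \<in> Idx n m"
  shows "osp_unit i i \<in> cartan n m"
proof -
  have "osp_unit i i p q = 0" if "p \<noteq> q" for p q
    using osp_unit_nz[of i i p q] that by metis
  then show ?thesis
    using osp_unit_osp[OF assms assms] by (simp add: cartan_def)
qed

lemma rootspace_mcomm: "H \<in> cartan n m \<Longrightarrow> X \<in> rootspace n m \<alpha> \<Longrightarrow> mcomm n m H X = msc (wt_eval n m \<alpha> H) X"
  by (simp add: rootspace_def mcomm_def)

text \<open>Grading element: if \<open>om\<close> is odd under \<open>ng\<close>, the root
  \<open>wt i - wt j\<close> takes the value \<open>om i - om j\<close> on it.\<close>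

definition diag_of :: "nat \<Rightarrow> nat \<Rightarrow> (idx \<Rightarrow> int) \<Rightarrow> mat" where
  "diag_of n m om = (\<lambda>p q. if p = q \<and> p \<in> Idx n m then of_int (om p) else 0)"

lemma diag_of_cartan: "(\<And>p. om (ng p) = - om p) \<Longrightarrow> diag_of n m om \<in> cartan n m"
  by (auto simp: cartan_iff diag_of_def)

section \<open>Eigenvectors and \<open>sl(2)\<close> actions\<close>

locale complex_space = vector_space scale
  for scale :: "complex \<Rightarrow> 'v::ab_group_add \<Rightarrow> 'v" (infixr \<open>*s\<close> 75)
begin

definition lin :: "('v \<Rightarrow> 'v) \<Rightarrow> bool" where
  "lin f \<longleftrightarrow> (\<forall>x y. f (x + y) = f x + f y) \<and> (\<forall>c x. f (c *s x) = c *s f x)"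

lemma lin_add: "lin f \<Longrightarrow> f (x + y) = f x + f y"
  by (simp add: lin_def)

lemma lin_scale: "lin f \<Longrightarrow> f (c *s x) = c *s f x"
  by (simp add: lin_def)

lemma lin_0: "lin f \<Longrightarrow> f 0 = 0"
  using lin_scale[of f 0 0] by simp

lemma lin_minus: "lin f \<Longrightarrow> f (- x) = - f x"
  using lin_scale[of f "-1" x] by simp

lemma lin_sum: "lin f \<Longrightarrow> f (sum g A) = (\<Sum>a\<in>A. f (g a))"
  by (induction A rule: infinite_finite_induct) (simp_all add: lin_0 lin_add)

lemma lin_funpow: "lin f \<Longrightarrow> lin (f ^^ N)"
  by (induction N) (simp_all add: lin_def)

lemma lin_iff_linear: "Vector_Spaces.linear scale scale f \<longleftrightarrow> lin f"
  unfolding Vector_Spaces.linear_def module_hom_iff lin_def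
  using vector_space_axioms module_axioms by blast

lemma lin_span:
  assumes "lin f" "\<And>x. x \<in> S \<Longrightarrow> f x \<in> span T" "x \<in> span S"
  shows "f x \<in> span T"
proof -
  have "subspace {x. f x \<in> span T}"
    using assms(1) by (intro subspaceI) (auto simp: lin_0 lin_add lin_scale span_zero span_add span_scale)
  then have "span S \<subseteq> {x. f x \<in> span T}"
    using assms(2) by (intro span_minimal) auto
  then show ?thesis using assms(3) by auto
qed

text \<open>Applying \<open>A - a\<close> removes the component for \<open>a\<close> and multiplies
  the others by the nonzero numbers \<open>e - a\<close>.\<close>

lemma sum_eigenvectors_eq_0:
  assumes "lin A" "finite F"
  shows "(\<And>e. e \<in> F \<Longrightarrow> A (x e) = e *s x e) \<Longrightarrow> (\<Sum>e\<in>F. x e) = 0 \<Longrightarrow> e \<in> F \<Longrightarrow> x e = 0"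
  using assms(2)
proof (induction F arbitrary: x e)
  case (insert a F)
  have "A (\<Sum>e\<in>insert a F. x e) - a *s (\<Sum>e\<in>insert a F. x e) = 0"
    using insert.prems(2) by (simp add: lin_0[OF assms(1)])
  also have "A (\<Sum>e\<in>insert a F. x e) = (\<Sum>e\<in>insert a F. e *s x e)"
    by (subst lin_sum[OF assms(1)]) (intro sum.cong refl insert.prems(1))
  finally have *: "(\<Sum>e\<in>F. (e - a) *s x e) = 0"
    using insert.hyps by (simp add: scale_sum_right sum_subtractf scale_left_diff_distrib algebra_simps)
  have F: "x b = 0" if "b \<in> F" for b
  proof -
    have "(b - a) *s x b = 0"
    proof (rule insert.IH[OF _ * that])
      fix e assume "e \<in> F"
      then show "A ((e - a) *s x e) = e *s (e - a) *s x e"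
        using insert.prems(1)[of e] by (simp add: lin_scale[OF assms(1)] mult.commute)
    qed
    then show ?thesis using that insert.hyps(2) by auto
  qed
  then have "x a = 0"
    using insert.prems(2) insert.hyps by simp
  then show ?case using F insert.prems(3) by auto
qed simp

text \<open>If \<open>e0\<close> were outside \<open>E\<close>, then \<open>- w\<close> together
  with the components of \<open>w\<close> would be a vanishing sum of eigenvectors with distinct
  eigenvalues.\<close>

lemma eigenvalue_in_span:
  assumes A: "lin A" and S: "\<And>x. x \<in> S \<Longrightarrow> \<exists>e\<in>E. A x = e *s x"
    and w: "w \<in> span S" "A w = e0 *s w" "w \<noteq> 0"
  shows "e0 \<in> E"
proof (rule ccontr)
  assume e0: "e0 \<notin> E"
  \<comment> \<open>One component per eigenvalue, extended by zero outside \<open>F\<close>, so that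
    two such sums can be added over the union of their index sets.\<close>
  define G where "G = {y. \<exists>F x. finite F \<and> F \<subseteq> E \<and> (\<forall>e. A (x e) = e *s x e) \<and> (\<forall>e. e \<notin> F \<longrightarrow> x e = 0) \<and> y = (\<Sum>e\<in>F. x e)}"
  have "subspace G"
  proof (rule subspaceI)
    show "0 \<in> G"
      unfolding G_def by (intro CollectI exI[of _ "{}"] exI[of _ "\<lambda>_. 0"]) (simp add: lin_0[OF A])
  next
    fix y z assume "y \<in> G" "z \<in> G"
    then obtain F x F' x' where F: "finite F" "F \<subseteq> E" "\<And>e. A (x e) = e *s x e" "\<And>e. e \<notin> F \<Longrightarrow> x e = 0" "y = (\<Sum>e\<in>F. x e)"
      and F': "finite F'" "F' \<subseteq> E" "\<And>e. A (x' e) = e *s x' e" "\<And>e. e \<notin> F' \<Longrightarrow> x' e = 0" "z = (\<Sum>e\<in>F'. x' e)"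
      unfolding G_def by blast
    have "y = (\<Sum>e\<in>F \<union> F'. x e)" "z = (\<Sum>e\<in>F \<union> F'. x' e)"
      unfolding F F' using F(1,4) F'(1,4) by (intro sum.mono_neutral_left; auto)+
    then have "y + z = (\<Sum>e\<in>F \<union> F'. x e + x' e)"
      by (simp add: sum.distrib)
    then show "y + z \<in> G"
      unfolding G_def using F F'
      by (intro CollectI exI[of _ "F \<union> F'"] exI[of _ "\<lambda>e. x e + x' e"]) (simp add: lin_add[OF A] scale_right_distrib)
  next
    fix c y assume "y \<in> G"
    then obtain F x where F: "finite F" "F \<subseteq> E" "\<And>e. A (x e) = e *s x e" "\<And>e. e \<notin> F \<Longrightarrow> x e = 0" "y = (\<Sum>e\<in>F. x e)"
      unfolding G_def by blast
    then show "c *s y \<in> G"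
      unfolding G_def
      by (intro CollectI exI[of _ F] exI[of _ "\<lambda>e. c *s x e"]) (simp add: lin_scale[OF A] scale_sum_right mult.commute)
  qed
  moreover have "S \<subseteq> G"
  proof
    fix x assume "x \<in> S"
    then obtain e where e: "e \<in> E" "A x = e *s x" using S by blast
    then show "x \<in> G"
      unfolding G_def by (intro CollectI exI[of _ "{e}"] exI[of _ "\<lambda>e'. if e' = e then x else 0"]) (simp add: lin_0[OF A])
  qed
  ultimately have "w \<in> G" using span_minimal w(1) by blast
  then obtain F x where F: "finite F" "F \<subseteq> E" "\<And>e. A (x e) = e *s x e" "w = (\<Sum>e\<in>F. x e)"
    unfolding G_def by blast
  define y where "y e = (if e = e0 then - w else x e)" for e
  have e0F: "e0 \<notin> F" using e0 F(2) by blast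
  have "(\<Sum>e\<in>insert e0 F. y e) = - w + (\<Sum>e\<in>F. x e)"
    using F(1) e0F by (auto simp: y_def intro!: sum.cong)
  then have "(\<Sum>e\<in>insert e0 F. y e) = 0" using F(4) by simp
  moreover have "A (y e) = e *s y e" for e
    using F(3) w(2) by (simp add: y_def lin_minus[OF A])
  ultimately have "y e0 = 0"
    using sum_eigenvectors_eq_0[OF A, of "insert e0 F" y e0] F(1) by blast
  then show False using w(3) by (simp add: y_def)
qed

end

section \<open>Weights of sl(2) actions\<close>

locale sl2_action = complex_space scale
  for scale :: "complex \<Rightarrow> 'v::ab_group_add \<Rightarrow> 'v" (infixr \<open>*s\<close> 75) +
  fixes E F H :: "'v \<Rightarrow> 'v"
  assumes linE: "lin E" and linF: "lin F"
    and EF: "E (F u) - F (E u) = H u"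
    and HE: "H (E u) - E (H u) = 2 *s E u"
    and HF: "H (F u) - F (H u) = (-2) *s F u"
begin

lemma sl2_flip: "sl2_action scale F E (\<lambda>u. - H u)"
proof unfold_locales
  show "lin F" "lin E" by (fact linF linE)+
  fix u
  show "F (E u) - E (F u) = - H u" using EF[of u] by (simp add: algebra_simps)
  show "- H (F u) - F (- H u) = 2 *s F u"
    using HF[of u] by (simp add: lin_minus[OF linF] algebra_simps)
  show "- H (E u) - E (- H u) = (-2) *s E u"
    using HE[of u] by (simp add: lin_minus[OF linE] algebra_simps)
qed

lemma H_F_pow: "H u = b *s u \<Longrightarrow> H ((F ^^ c) u) = (b - 2 * of_nat c) *s (F ^^ c) u"
proof (induction c)
  case (Suc c)
  have "H ((F ^^ Suc c) u) = F (H ((F ^^ c) u)) + (-2) *s F ((F ^^ c) u)"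
    using HF[of "(F ^^ c) u"] by (simp add: algebra_simps)
  also have "\<dots> = (b - 2 * of_nat (Suc c)) *s (F ^^ Suc c) u"
    unfolding Suc.IH[OF Suc.prems] lin_scale[OF linF] scale_left_distrib[symmetric] by simp
  finally show ?case .
qed simp

lemma H_E: "H u = b *s u \<Longrightarrow> H (E u) = (b + 2) *s E u"
  using HE[of u] by (simp add: lin_scale[OF linE] algebra_simps)

lemma E_F_pow: "H u = b *s u \<Longrightarrow>
  E ((F ^^ Suc c) u) = (F ^^ Suc c) (E u) + (of_nat (Suc c) * (b - of_nat c)) *s (F ^^ c) u"
proof (induction c)
  case 0
  then show ?case using EF[of u] by (simp add: algebra_simps)
next
  case (Suc c)
  have "E ((F ^^ Suc (Suc c)) u) = F (E ((F ^^ Suc c) u)) + H ((F ^^ Suc c) u)"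
    using EF[of "(F ^^ Suc c) u"] by (simp add: algebra_simps)
  also have "H ((F ^^ Suc c) u) = (b - 2 * of_nat (Suc c)) *s (F ^^ Suc c) u"
    by (rule H_F_pow[OF Suc.prems])
  also have "F (E ((F ^^ Suc c) u)) = (F ^^ Suc (Suc c)) (E u) + (of_nat (Suc c) * (b - of_nat c)) *s (F ^^ Suc c) u"
    unfolding Suc.IH[OF Suc.prems] lin_add[OF linF] lin_scale[OF linF] by simp
  also have "(F ^^ Suc (Suc c)) (E u) + (of_nat (Suc c) * (b - of_nat c)) *s (F ^^ Suc c) u + (b - 2 * of_nat (Suc c)) *s (F ^^ Suc c) u
     = (F ^^ Suc (Suc c)) (E u) + (of_nat (Suc (Suc c)) * (b - of_nat (Suc c))) *s (F ^^ Suc c) u"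
    by (simp only: add.assoc scale_left_distrib[symmetric]) (simp add: algebra_simps)
  finally show ?case .
qed

text \<open>At the first vanishing power of \<open>F\<close> the factor \<open>b - of_nat c\<close>
  in \<open>E_F_pow\<close> must be zero.\<close>

lemma highest_weight_nat:
  assumes "H u = b *s u" "E u = 0" "u \<noteq> 0" "(F ^^ c) u = 0"
  shows "\<exists>i<c. b = of_nat i"
  using assms(4)
proof (induction c)
  case (Suc c)
  have "(of_nat (Suc c) * (b - of_nat c)) *s (F ^^ c) u = 0"
    using E_F_pow[OF assms(1), of c] Suc.prems assms(2)
    by (simp add: lin_0[OF linE] lin_0[OF linF] lin_0[OF lin_funpow[OF linF]])
  then have "b = of_nat c \<or> (F ^^ c) u = 0"
    by (simp del: of_nat_Suc)
  then show ?case using Suc.IH less_Suc_eq by blast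
qed (use assms in simp)

text \<open>Climb with \<open>E\<close> to a highest weight vector. Each step raises the eigenvalue
  by 2 but the killing exponent of \<open>F\<close> only by 1, so the strict bound is inherited by
  \<open>u\<close>. Strictness is what makes the power in \<open>weight_reflection\<close>
  nonzero.\<close>

lemma weight_int_less:
  assumes "H u = b *s u" "u \<noteq> 0" "(E ^^ p) u = 0" "(F ^^ c) u = 0"
  shows "\<exists>i::int. i < int c \<and> b = of_int i"
  using assms
proof (induction p arbitrary: u b c)
  case (Suc p)
  show ?case
  proof (cases "E u = 0")
    case True
    then obtain i where "i < c" "b = of_nat i"
      using highest_weight_nat Suc.prems by blast
    then show ?thesis by (intro exI[of _ "int i"]) simp
  next
    case False
    have "(F ^^ Suc c) (E u) = 0"
      using E_F_pow[OF Suc.prems(1), of c] Suc.prems(4) by (simp add: lin_0[OF linE] lin_0[OF linF])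
    moreover have "(E ^^ p) (E u) = 0"
      using Suc.prems(3) by (simp add: funpow_swap1)
    ultimately obtain i where "i < int (Suc c)" "b + 2 = of_int i"
      using Suc.IH[OF H_E[OF Suc.prems(1)] False] by blast
    then show ?thesis by (intro exI[of _ "i - 2"]) (simp add: algebra_simps)
  qed
qed simp

text \<open>If \<open>b = of_nat i\<close>, then \<open>(F ^^ i) u = 0\<close> would give
  \<open>b < i\<close> by \<open>weight_int_less\<close>; negative \<open>b\<close> follow by
  exchanging \<open>E\<close> and \<open>F\<close>. In both cases a nonzero vector of eigenvalue
  \<open>- b\<close> results, without complete reducibility.\<close>

lemma weight_reflection:
  assumes "H u = b *s u" "u \<noteq> 0" "(E ^^ p) u = 0" "(F ^^ c) u = 0"
  obtains i where "b = of_nat i" "(F ^^ i) u \<noteq> 0" | i where "b = - of_nat i" "(E ^^ i) u \<noteq> 0"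
proof -
  interpret flip: sl2_action scale F E "\<lambda>u. - H u" by (rule sl2_flip)
  obtain i :: int where i: "b = of_int i" using weight_int_less[OF assms] by blast
  show ?thesis
  proof (cases "i \<ge> 0")
    case True
    have "(F ^^ nat i) u \<noteq> 0"
    proof
      assume "(F ^^ nat i) u = 0"
      from weight_int_less[OF assms(1-3) this] show False using i True by auto
    qed
    then show ?thesis using that(1)[of "nat i"] i True by simp
  next
    case False
    have "- H u = (- b) *s u" using assms(1) by simp
    note * = flip.weight_int_less[OF this assms(2,4)]
    have "(E ^^ nat (- i)) u \<noteq> 0"
    proof
      assume "(E ^^ nat (- i)) u = 0"
      from *[OF this] obtain j where "j < - i" "of_int (- i) = (of_int j :: complex)"
        using i False by auto
      then show False by (simp only: of_int_eq_iff)
    qed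
    then show ?thesis using that(2)[of "nat (- i)"] i False by simp
  qed
qed

end

text \<open>The roots \<open>wt i - wt j\<close> and \<open>wt (ng j) - wt (ng i)\<close> coincide;
  this is why one root appears with two index pairs in \<open>minimal_root\<close>.\<close>

lemma osp_unit_ng:
  assumes "i \<in> Idx n m" "j \<in> Idx n m"
  shows "osp_unit (ng j) (ng i) = msc (osgn (ng i) (ng j)) (osp_unit i j)"
proof -
  have os: "osgn (ng i) (ng j) * osgn j i = 1"
    using assms by (cases "fst i"; cases "fst j") (auto simp: osgn_def bsgn_def Idx_iff)
  have "(if c then 1 else 0) + (if d then osgn (ng i) (ng j) else 0)
    = osgn (ng i) (ng j) * ((if d then 1 else 0) + (if c then osgn j i else 0))" for c d
    by (cases c; cases d) (use os in \<open>simp_all add: distrib_left\<close>)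
  then show ?thesis
    unfolding osp_unit_def msc_def ng_ng by blast
qed

lemma wsc_1: "wsc 1 \<alpha> = \<alpha>"
  by (simp add: wsc_def)

text \<open>Oddness of \<open>om\<close> gives both entries of a unit the same degree, and matrix
  multiplication adds degrees.\<close>

lemma mmul_osp_unit_degree:
  fixes om :: "idx \<Rightarrow> int"
  assumes om: "\<And>p. om (ng p) = - om p" and nz: "mmul n m (osp_unit p q) (osp_unit j i) p' q' \<noteq> 0"
  shows "om p' - om q' = (om p - om q) + (om j - om i)"
proof -
  obtain t where "osp_unit p q p' t * osp_unit j i t q' \<noteq> 0"
    using nz unfolding mmul_def by (meson sum.neutral)
  then have "osp_unit p q p' t \<noteq> 0" "osp_unit j i t q' \<noteq> 0" by auto
  then have "om p' - om t = om p - om q" "om t - om q' = om j - om i"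
    using osp_unit_nz[of p q p' t] osp_unit_nz[of j i t q'] om by (smt (verit))+
  then show ?thesis by simp
qed

lemma sbr_osp_unit_degree:
  fixes om :: "idx \<Rightarrow> int"
  assumes om: "\<And>p. om (ng p) = - om p" and nz: "sbr n m (osp_unit p q) (osp_unit j i) p' q' \<noteq> 0"
  shows "om p' - om q' = (om p - om q) + (om j - om i)"
proof -
  have "mmul n m (osp_unit p q) (osp_unit j i) p' q' \<noteq> 0 \<or> mmul n m (osp_unit j i) (osp_unit p q) p' q' \<noteq> 0"
    using nz unfolding sbr_homogeneous[OF osp_unit_parity osp_unit_parity] by auto
  then show ?thesis
    using mmul_osp_unit_degree[of om n m p q j i p' q', OF om] mmul_osp_unit_degree[of om n m j i p q p' q', OF om] by auto
qed

lemma bform_osp_unit_0: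
  fixes om :: "idx \<Rightarrow> int"
  assumes om: "\<And>p. om (ng p) = - om p" and "(om p - om q) + (om j - om i) \<noteq> 0"
  shows "bform n m (osp_unit p q) (osp_unit j i) = 0"
proof -
  have "mmul n m (osp_unit p q) (osp_unit j i) t t = 0" for t
    using mmul_osp_unit_degree[of om n m p q j i t t, OF om] assms(2) by auto
  then show ?thesis by (simp add: bform_def str_def)
qed

text \<open>A component of the bracket at the root \<open>wt i - wt j\<close> would have to come
  from twice that root, and no root is twice another. In terms of entries,
  \<open>osp_unit j i\<close> is zero in the columns \<open>j\<close>, \<open>ng i\<close> and in
  the rows \<open>i\<close>, \<open>ng j\<close>.\<close>

lemma sbr_lowering_entry:
  assumes "i \<in> Idx n m" "j \<in> Idx n m" "i \<noteq> j" "mpart a X = X"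
  shows "sbr n m X (osp_unit j i) i j = 0" "sbr n m X (osp_unit j i) (ng j) (ng i) = 0"
proof -
  note sb = sbr_homogeneous[OF assms(4) osp_unit_parity]
  have "osp_unit j i t j = 0" "osp_unit j i i t = 0" "osp_unit j i t (ng i) = 0" "osp_unit j i (ng j) t = 0" for t
    using osp_unit_nz[of j i t j] osp_unit_nz[of j i i t] osp_unit_nz[of j i t "ng i"] osp_unit_nz[of j i "ng j" t]
      ng_neq[OF assms(1)] ng_neq[OF assms(2)] assms(3) ng_inj by metis+
  then show "sbr n m X (osp_unit j i) i j = 0" "sbr n m X (osp_unit j i) (ng j) (ng i) = 0"
    by (simp_all add: sb mmul_def)
qed

section \<open>Highest weight modules\<close>

locale affine_osp = complex_space scale
  for scale :: "complex \<Rightarrow> 'v::ab_group_add \<Rightarrow> 'v" (infixr \<open>*s\<close> 75) +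
  fixes n m :: nat and \<rho> :: "mat \<Rightarrow> int \<Rightarrow> 'v \<Rightarrow> 'v" and \<rho>K \<rho>d :: "'v \<Rightarrow> 'v"
  assumes affine: "affine_module n m scale \<rho> \<rho>K \<rho>d"
begin

lemmas affine_conjs = affine[unfolded affine_module_def lin_iff_linear, THEN conjunct2]

lemma lin_K: "lin \<rho>K"
  by (rule affine_conjs[THEN conjunct1])

lemma lin_d: "lin \<rho>d"
  by (rule affine_conjs[THEN conjunct2, THEN conjunct1])

lemma lin_rho: "X \<in> osp n m \<Longrightarrow> lin (\<rho> X r)"
  using affine_conjs[THEN conjunct2, THEN conjunct2, THEN conjunct1] by blast

lemma rho_madd: "X \<in> osp n m \<Longrightarrow> Y \<in> osp n m \<Longrightarrow> \<rho> (madd X Y) r v = \<rho> X r v + \<rho> Y r v"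
  using affine_conjs[THEN conjunct2, THEN conjunct2, THEN conjunct2, THEN conjunct1] by blast

lemma rho_msc: "X \<in> osp n m \<Longrightarrow> \<rho> (msc c X) r v = c *s \<rho> X r v"
  using affine_conjs[THEN conjunct2, THEN conjunct2, THEN conjunct2, THEN conjunct2, THEN conjunct1] by blast

lemma rho_sbr: "X \<in> osp n m \<Longrightarrow> Y \<in> osp n m \<Longrightarrow> mpart a X = X \<Longrightarrow> mpart b Y = Y \<Longrightarrow>
    \<rho> X r (\<rho> Y r' v) - psign a b *s \<rho> Y r' (\<rho> X r v)
      = \<rho> (sbr n m X Y) (r + r') v + (if r + r' = 0 then of_int r * bform n m X Y else 0) *s \<rho>K v"
  by (rule affine_conjs[THEN conjunct2, THEN conjunct2, THEN conjunct2, THEN conjunct2, THEN conjunct2, THEN conjunct1, rule_format])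

lemma K_rho: "X \<in> osp n m \<Longrightarrow> \<rho>K (\<rho> X r v) = \<rho> X r (\<rho>K v)"
  and K_d: "\<rho>K (\<rho>d v) = \<rho>d (\<rho>K v)"
  and d_rho: "X \<in> osp n m \<Longrightarrow> \<rho>d (\<rho> X r v) - \<rho> X r (\<rho>d v) = of_int r *s \<rho> X r v"
  using affine_conjs[THEN conjunct2, THEN conjunct2, THEN conjunct2, THEN conjunct2, THEN conjunct2, THEN conjunct2] by blast+

lemma rho_0: "\<rho> (\<lambda>p q. 0) r v = 0"
  using rho_msc[OF osp_0, of 0 r v] by (simp add: msc_def)

lemma rho_comm:
  assumes X: "X \<in> osp n m" and Y: "Y \<in> osp n m" and even: "mpart False X = X"
  shows "\<rho> X r (\<rho> Y r' v) - \<rho> Y r' (\<rho> X r v)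
            = \<rho> (mcomm n m X Y) (r + r') v + (if r + r' = 0 then of_int r * bform n m X Y else 0) *s \<rho>K v"
proof -
  define Y0 Y1 where "Y0 = mpart False Y" and "Y1 = mpart True Y"
  have Y01: "Y = madd Y0 Y1" "Y0 \<in> osp n m" "Y1 \<in> osp n m" "mpart False Y0 = Y0" "mpart True Y1 = Y1"
    using Y by (simp_all add: Y0_def Y1_def madd_mpart osp_mpart)
  have sb: "sbr n m X Y0 \<in> osp n m" "sbr n m X Y1 \<in> osp n m"
    using sbr_osp X Y01 even by blast+
  have "\<rho> X r (\<rho> Y r' v) - \<rho> Y r' (\<rho> X r v) = (\<rho> X r (\<rho> Y0 r' v) - \<rho> Y0 r' (\<rho> X r v)) + (\<rho> X r (\<rho> Y1 r' v) - \<rho> Y1 r' (\<rho> X r v))"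
    by (simp add: Y01(1) rho_madd[OF Y01(2,3)] lin_add[OF lin_rho[OF X]] algebra_simps)
  also have "\<dots> = \<rho> (sbr n m X Y0) (r + r') v + \<rho> (sbr n m X Y1) (r + r') v
      + (if r + r' = 0 then of_int r * bform n m X Y0 else 0) *s \<rho>K v + (if r + r' = 0 then of_int r * bform n m X Y1 else 0) *s \<rho>K v"
    using rho_sbr[OF X Y01(2) even Y01(4), of r r' v] rho_sbr[OF X Y01(3) even Y01(5), of r r' v]
    by (simp add: psign_def algebra_simps)
  also have "\<dots> = \<rho> (mcomm n m X Y) (r + r') v + (if r + r' = 0 then of_int r * bform n m X Y else 0) *s \<rho>K v"
    unfolding mcomm_even[OF even] Y0_def[symmetric] Y1_def[symmetric] rho_madd[OF sb]
    unfolding Y01(1) bform_madd by (simp add: scale_left_distrib algebra_simps)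
  finally show ?thesis .
qed

lemma rho_in_subspace:
  assumes "X \<in> osp n m" "subspace W"
    and "\<And>i j. i \<in> Idx n m \<Longrightarrow> j \<in> Idx n m \<Longrightarrow> X i j \<noteq> 0 \<Longrightarrow> \<rho> (osp_unit i j) r u \<in> W"
  shows "\<rho> X r u \<in> W"
proof -
  have "X \<in> {Y. \<rho> Y r u \<in> W}"
    using assms(1)
  proof (rule osp_expand_in)
    show "(\<lambda>p q. 0) \<in> {Y. \<rho> Y r u \<in> W}" using assms(2) by (simp add: rho_0 subspace_0)
    show "madd X Y \<in> {Y. \<rho> Y r u \<in> W}"
      if "X \<in> osp n m" "Y \<in> osp n m" "X \<in> {Y. \<rho> Y r u \<in> W}" "Y \<in> {Y. \<rho> Y r u \<in> W}" for X Y
      using that assms(2) by (simp add: rho_madd subspace_add)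
    show "msc c X \<in> {Y. \<rho> Y r u \<in> W}" if "X \<in> osp n m" "X \<in> {Y. \<rho> Y r u \<in> W}" for c X
      using that assms(2) by (simp add: rho_msc subspace_scale)
  qed (use assms(3) in blast)
  then show ?thesis by simp
qed

text \<open>A weight of the affine Cartan subalgebra is kept as its finite part and its value on d;
  the value on K is constant by \<open>K_scalar\<close> once the module is irreducible.\<close>

definition weight_vec :: "weight \<Rightarrow> complex \<Rightarrow> 'v \<Rightarrow> bool" where
  "weight_vec \<mu> z u \<longleftrightarrow> (\<forall>H\<in>cartan n m. \<rho> H 0 u = wt_eval n m \<mu> H *s u) \<and> \<rho>d u = z *s u"

lemma weight_vec_rootspace:
  assumes "weight_vec \<mu> z u" "X \<in> rootspace n m \<alpha>"
  shows "weight_vec (\<mu> + \<alpha>) (z + of_int r) (\<rho> X r u)"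
  unfolding weight_vec_def
proof (intro conjI ballI)
  have X: "X \<in> osp n m" using assms(2) by (simp add: rootspace_def)
  fix H assume H: "H \<in> cartan n m"
  have "\<rho> H 0 (\<rho> X r u) = \<rho> X r (\<rho> H 0 u) + wt_eval n m \<alpha> H *s \<rho> X r u"
    using rho_comm[OF cartan_osp[OF H] X cartan_even[OF H], of 0 r u]
    by (simp add: rootspace_mcomm[OF H assms(2)] rho_msc[OF X] algebra_simps)
  also have "\<rho> H 0 u = wt_eval n m \<mu> H *s u"
    using assms(1) H by (simp add: weight_vec_def)
  finally show "\<rho> H 0 (\<rho> X r u) = wt_eval n m (\<mu> + \<alpha>) H *s \<rho> X r u"
    by (simp add: lin_scale[OF lin_rho[OF X]] wt_eval_add scale_left_distrib)
next
  have X: "X \<in> osp n m" using assms(2) by (simp add: rootspace_def)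
  have "\<rho>d u = z *s u" using assms(1) by (simp add: weight_vec_def)
  then show "\<rho>d (\<rho> X r u) = (z + of_int r) *s \<rho> X r u"
    using d_rho[OF X, of r u] by (simp add: lin_scale[OF lin_rho[OF X]] scale_left_distrib algebra_simps)
qed

lemma weight_vec_funpow:
  assumes "weight_vec \<mu> z u" "X \<in> rootspace n m \<alpha>"
  shows "weight_vec (\<mu> + wsc (of_nat N) \<alpha>) (z + of_nat N * of_int r) ((\<rho> X r ^^ N) u)"
proof (induction N)
  case 0
  have "\<mu> + wsc 0 \<alpha> = \<mu>" by (simp add: wsc_def fun_eq_iff)
  then show ?case using assms(1) by simp
next
  case (Suc N)
  have "\<mu> + wsc (of_nat (Suc N)) \<alpha> = \<mu> + wsc (of_nat N) \<alpha> + \<alpha>"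
    by (simp add: wsc_def fun_eq_iff algebra_simps)
  moreover have "z + of_nat (Suc N) * of_int r = z + of_nat N * of_int r + of_int r"
    by (simp add: algebra_simps)
  ultimately show ?case
    using weight_vec_rootspace[OF Suc assms(2), of r] by (simp only: funpow.simps o_apply)
qed

text \<open>Degrees are complex because weights are; within an irreducible module only their
  differences are integers.\<close>

definition degree_val :: "(idx \<Rightarrow> int) \<Rightarrow> int \<Rightarrow> weight \<Rightarrow> complex \<Rightarrow> complex" where
  "degree_val om D \<mu> z = wt_eval n m \<mu> (diag_of n m om) + of_int D * z"

section \<open>Borel subalgebras given by functionals\<close>

definition odd_fun :: "(idx \<Rightarrow> int) \<Rightarrow> bool" where
  "odd_fun om \<longleftrightarrow> (\<forall>p. om (ng p) = - om p)"

lemma degree_val_unit: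
  assumes "odd_fun om" "i \<in> Idx n m" "j \<in> Idx n m"
  shows "degree_val om D (\<mu> + wsc (of_nat N) (wt i - wt j)) (z + of_nat N * of_int r)
    = degree_val om D \<mu> z + of_nat N * of_int (om i - om j + D * r)"
proof -
  have "diag_of n m om \<in> cartan n m" using assms(1) unfolding odd_fun_def by (intro diag_of_cartan) blast
  note wt_eval_wt[OF this assms(2)] wt_eval_wt[OF this assms(3)]
  then show ?thesis using assms(2,3)
    by (simp add: degree_val_def wt_eval_add wt_eval_diff wt_eval_wsc diag_of_def algebra_simps)
qed

lemma degree_val_eigen:
  assumes "odd_fun om" "weight_vec \<mu> z u"
  shows "\<rho> (diag_of n m om) 0 u + of_int D *s \<rho>d u = degree_val om D \<mu> z *s u"
proof -
  have "diag_of n m om \<in> cartan n m" using assms(1) unfolding odd_fun_def by (intro diag_of_cartan) blast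
  then show ?thesis
    using assms(2) by (simp add: weight_vec_def degree_val_def scale_left_distrib)
qed

text \<open>No affine root has degree 0, including the imaginary roots (the case
  \<open>i = j\<close>), so every root is positive or negative. The condition
  \<open>fst i \<or> j \<noteq> ng i\<close> omits the index pairs whose unit is zero.\<close>

definition regular :: "(idx \<Rightarrow> int) \<Rightarrow> int \<Rightarrow> bool" where
  "regular om D \<longleftrightarrow> odd_fun om \<and>
     (\<forall>i\<in>Idx n m. \<forall>j\<in>Idx n m. \<forall>r. (fst i \<or> j \<noteq> ng i) \<longrightarrow> om i - om j + D * r = 0 \<longrightarrow> i = j \<and> r = 0)"

definition singular :: "(idx \<Rightarrow> int) \<Rightarrow> int \<Rightarrow> 'v \<Rightarrow> bool" where
  "singular om D u \<longleftrightarrow> (\<forall>i\<in>Idx n m. \<forall>j\<in>Idx n m. \<forall>r. om i - om j + D * r > 0 \<longrightarrow> \<rho> (osp_unit i j) r u = 0)"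

text \<open>Words in lowering operators in arbitrary order, a stand-in for a Poincare-Birkhoff-Witt
  basis: spanning is enough, independence is never asked for.\<close>

inductive_set descendants :: "(idx \<Rightarrow> int) \<Rightarrow> int \<Rightarrow> 'v \<Rightarrow> 'v set" for om D u where
  base: "u \<in> descendants om D u"
| step: "w \<in> descendants om D u \<Longrightarrow> i \<in> Idx n m \<Longrightarrow> j \<in> Idx n m \<Longrightarrow> om i - om j + D * r < 0
    \<Longrightarrow> \<rho> (osp_unit i j) r w \<in> descendants om D u"

lemma descendants_weight:
  assumes "odd_fun om" "weight_vec \<mu> z u" "w \<in> descendants om D u"
  shows "\<exists>\<mu>' z' N. weight_vec \<mu>' z' w \<and> degree_val om D \<mu>' z' = degree_val om D \<mu> z - of_nat N"
  using assms(3)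
proof induction
  case base
  show ?case using assms(2) by (intro exI[of _ \<mu>] exI[of _ z] exI[of _ 0]) simp
next
  case (step w i j r)
  then obtain \<mu>' z' N where w: "weight_vec \<mu>' z' w" "degree_val om D \<mu>' z' = degree_val om D \<mu> z - of_nat N"
    by blast
  have "degree_val om D (\<mu>' + (wt i - wt j)) (z' + of_int r) = degree_val om D \<mu>' z' + of_int (om i - om j + D * r)"
    using degree_val_unit[OF assms(1) step.hyps(2,3), of D \<mu>' 1 z' r] by (simp only: wsc_1 of_nat_1 mult_1)
  also have "\<dots> = degree_val om D \<mu> z - of_nat (N + nat (- (om i - om j + D * r)))"
    using step.hyps(4) w(2) by (simp add: algebra_simps)
  finally show ?case
    using weight_vec_rootspace[OF w(1) osp_unit_rootspace[OF step.hyps(2,3)], of r] by blast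
qed

end

section \<open>Brackets of opposite root vectors\<close>

lemma mmul_osp_unit:
  assumes "i \<in> Idx n m" "j \<in> Idx n m"
  shows "mmul n m (osp_unit i j) X p q = (if p = i then X j q else 0) + (if p = ng j then osgn j i * X (ng i) q else 0)"
proof -
  have "(\<Sum>r\<in>Idx n m. osp_unit i j p r * X r q)
     = (\<Sum>r\<in>Idx n m. (if r = j then (if p = i then X r q else 0) else 0) + (if r = ng i then (if p = ng j then osgn j i * X r q else 0) else 0))"
    by (intro sum.cong refl) (simp add: osp_unit_def distrib_right)
  also have "\<dots> = (if p = i then X j q else 0) + (if p = ng j then osgn j i * X (ng i) q else 0)"
    using assms by (simp add: sum.distrib)
  finally show ?thesis by (simp add: mmul_def)
qed

lemma mmul_osp_unit_transpose:
  assumes "i \<in> Idx n m" "j \<in> Idx n m" "i \<noteq> j" "j \<noteq> ng i"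
  shows "mmul n m (osp_unit i j) (osp_unit j i) p q = (if p = i \<and> q = i then 1 else 0)
     + (if p = ng j \<and> q = ng j then osgn j i * osgn i j else 0)"
proof -
  have "osp_unit j i j q = (if q = i then 1 else 0)"
    using assms by (simp add: osp_unit_def)
  moreover have "osp_unit j i (ng i) q = (if q = ng j then osgn i j else 0)"
    using assms by (simp add: osp_unit_def)
  ultimately show ?thesis
    unfolding mmul_osp_unit[OF assms(1,2)] by (cases "p = i"; cases "p = ng j") simp_all
qed

lemma sbr_osp_unit_transpose:
  assumes "i \<in> Idx n m" "j \<in> Idx n m" "i \<noteq> j" "j \<noteq> ng i"
  shows "sbr n m (osp_unit i j) (osp_unit j i)
    = msub (osp_unit i i) (msc (if fst i = fst j then 1 else -1) (osp_unit j j))"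
proof (intro ext)
  fix p q
  have s: "osgn j i * osgn i j = (if fst i = fst j then 1 else -1)" "osgn i j * osgn j i = (if fst i = fst j then 1 else -1)"
    "psign (fst i \<noteq> fst j) (fst j \<noteq> fst i) = (if fst i = fst j then 1 else -1)"
    by (auto simp: osgn_def psign_def bsgn_def)
  have ji: "i \<noteq> ng j" using assms(4) by auto
  note e = mmul_osp_unit_transpose[OF assms] mmul_osp_unit_transpose[OF assms(2,1) assms(3)[symmetric] ji]
  show "sbr n m (osp_unit i j) (osp_unit j i) p q = msub (osp_unit i i) (msc (if fst i = fst j then 1 else -1) (osp_unit j j)) p q"
    unfolding sbr_homogeneous[OF osp_unit_parity osp_unit_parity]
    unfolding e s msub_def msc_def
    unfolding osp_unit_def osgn_self
    by (cases "fst i = fst j"; simp only: if_True if_False) (simp_all add: algebra_simps)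
qed

lemma osp_unit_long: "fst i \<Longrightarrow> i \<in> Idx n m \<Longrightarrow> osp_unit i (ng i) = (\<lambda>p q. if p = i \<and> q = ng i then 2 else 0)"
  by (auto simp: osp_unit_def fun_eq_iff osgn_def bsgn_def Idx_iff)

lemma mmul_long_transpose:
  assumes "i \<in> Idx n m" "fst i"
  shows "mmul n m (osp_unit i (ng i)) (osp_unit (ng i) i) p q = (if p = i \<and> q = i then 4 else 0)"
proof -
  have u: "osp_unit (ng i) i = (\<lambda>p q. if p = ng i \<and> q = i then 2 else 0)"
    using osp_unit_long[of "ng i" n m] assms by simp
  have "(\<Sum>r\<in>Idx n m. osp_unit i (ng i) p r * osp_unit (ng i) i r q) = (\<Sum>r\<in>Idx n m. if r = ng i then (if p = i \<and> q = i then 4 else 0) else 0)"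
    unfolding osp_unit_long[OF assms(2,1)] u by (intro sum.cong refl) simp
  then show ?thesis using assms by (simp add: mmul_def)
qed

lemma sbr_long_transpose:
  assumes "i \<in> Idx n m" "fst i"
  shows "sbr n m (osp_unit i (ng i)) (osp_unit (ng i) i) = msc 4 (osp_unit i i)"
proof (intro ext)
  fix p q
  have ps: "psign (fst i \<noteq> fst (ng i)) (fst (ng i) \<noteq> fst i) = 1" by (simp add: psign_def)
  have e: "mmul n m (osp_unit (ng i) i) (osp_unit i (ng i)) p q = (if p = ng i \<and> q = ng i then 4 else 0)"
    using mmul_long_transpose[of "ng i" n m p q] assms by simp
  show "sbr n m (osp_unit i (ng i)) (osp_unit (ng i) i) p q = msc 4 (osp_unit i i) p q"
    unfolding sbr_homogeneous[OF osp_unit_parity osp_unit_parity]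
    unfolding ps e mmul_long_transpose[OF assms]
    unfolding msc_def osp_unit_def osgn_self
    by (simp add: distrib_left)
qed

lemma bform_long_transpose:
  assumes "i \<in> Idx n m" "fst i"
  shows "bform n m (osp_unit i (ng i)) (osp_unit (ng i) i) = 4"
proof -
  have "(\<Sum>p\<in>Idx n m. (if fst p then - 1 else 1) * (if p = i \<and> p = i then 4 else 0)) = (\<Sum>p\<in>Idx n m. if p = i then (-4 :: complex) else 0)"
    using assms by (intro sum.cong refl) auto
  then show ?thesis
    using assms(1) by (simp add: bform_def str_def mmul_long_transpose[OF assms])
qed

lemma mmul_lowering_self:
  assumes "i \<in> Idx n m" "j \<in> Idx n m" "i \<noteq> j"
  shows "mmul n m (osp_unit j i) (osp_unit j i) = (\<lambda>p q. 0)"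
proof (intro ext)
  fix p q
  have "osp_unit j i i q = 0" "osp_unit j i (ng j) q = 0"
    using osp_unit_nz[of j i i q] osp_unit_nz[of j i "ng j" q] assms(3) ng_neq[OF assms(1)] ng_neq[OF assms(2)] ng_inj by metis+
  then show "mmul n m (osp_unit j i) (osp_unit j i) p q = 0"
    unfolding mmul_osp_unit[OF assms(2,1)] by simp
qed

text \<open>Each term in the expansion of ad(Y)^3 X has at least two adjacent factors
  \<open>Y\<close> on one side of \<open>X\<close>.\<close>

lemma mcomm_cube_eq_0:
  assumes "mmul n m Y Y = (\<lambda>p q. 0)"
  shows "mcomm n m Y (mcomm n m Y (mcomm n m Y X)) = (\<lambda>p q. 0)"
proof -
  have z: "mmul n m Y (mmul n m Y A) = (\<lambda>p q. 0)" for A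
    by (simp add: mmul_assoc[symmetric] assms)
  show ?thesis
    unfolding mcomm_def by (simp add: mmul_msub mmul_assoc z assms) (simp add: msub_def)
qed

section \<open>Locally nilpotent operators\<close>

context complex_space
begin

primrec ad_nilpotent :: "('v \<Rightarrow> 'v) \<Rightarrow> nat \<Rightarrow> ('v \<Rightarrow> 'v) \<Rightarrow> bool" where
  "ad_nilpotent F 0 T \<longleftrightarrow> (\<forall>x. T x = 0)"
| "ad_nilpotent F (Suc j) T \<longleftrightarrow> ad_nilpotent F j (\<lambda>x. F (T x) - T (F x))"

text \<open>Leibniz rule: F^(N+j) T is a combination of terms ad(F)^a(T) F^b with a + b = N + j, so
  a \<ge> j or b > N. The double induction unrolls it through F T = ad(F)(T) + T F.\<close>

lemma ad_nilpotent_funpow: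
  assumes F: "lin F"
  shows "lin T \<Longrightarrow> ad_nilpotent F j T \<Longrightarrow> (F ^^ N) x = 0 \<Longrightarrow> (F ^^ (N + j)) (T x) = 0"
proof (induction j arbitrary: T N x)
  case 0
  then show ?case by (simp add: lin_0[OF lin_funpow[OF F]])
next
  case (Suc j)
  note IHj = Suc.IH
  from Suc.prems(3) show ?case
  proof (induction N arbitrary: x)
    case 0
    then show ?case by (simp add: lin_0[OF Suc.prems(1)] lin_0[OF lin_funpow[OF F]] lin_0[OF F])
  next
    case (Suc N)
    define T' where "T' = (\<lambda>x. F (T x) - T (F x))"
    have "lin T'"
      using F \<open>lin T\<close> unfolding T'_def lin_def by (simp add: algebra_simps)
    moreover have "ad_nilpotent F j T'"
      using \<open>ad_nilpotent F (Suc j) T\<close> by (simp add: T'_def)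
    ultimately have "(F ^^ (Suc N + j)) (T' x) = 0"
      using IHj Suc.prems by blast
    moreover have "(F ^^ (N + Suc j)) (T (F x)) = 0"
      using Suc.IH[of "F x"] Suc.prems by (simp add: funpow_swap1)
    moreover have "(F ^^ (Suc N + Suc j)) (T x) = (F ^^ (Suc N + j)) (F (T x))"
      by (simp add: funpow_swap1)
    moreover have "F (T x) = T' x + T (F x)"
      by (simp add: T'_def)
    ultimately show ?case
      by (simp add: lin_add[OF lin_funpow[OF F]] lin_add[OF F])
  qed
qed

lemma locally_nilpotent_subspace:
  assumes F: "lin F"
  shows "subspace {x. \<exists>N. (F ^^ N) x = 0}"
proof (rule subspaceI)
  show "0 \<in> {x. \<exists>N. (F ^^ N) x = 0}" by (auto intro: exI[of _ 0])
next
  have up: "(F ^^ (N + M)) x = 0" if "(F ^^ N) x = 0" for N M x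
    using that by (simp add: add.commute[of N] funpow_add lin_0[OF lin_funpow[OF F]])
  fix x y assume "x \<in> {x. \<exists>N. (F ^^ N) x = 0}" "y \<in> {x. \<exists>N. (F ^^ N) x = 0}"
  then obtain N M where "(F ^^ N) x = 0" "(F ^^ M) y = 0" by blast
  then have "(F ^^ (N + M)) (x + y) = 0"
    using up[of N x M] up[of M y N] by (simp add: lin_add[OF lin_funpow[OF F]] add.commute)
  then show "x + y \<in> {x. \<exists>N. (F ^^ N) x = 0}" by blast
next
  fix c x assume "x \<in> {x. \<exists>N. (F ^^ N) x = 0}"
  then show "c *s x \<in> {x. \<exists>N. (F ^^ N) x = 0}"
    by (auto simp: lin_scale[OF lin_funpow[OF F]])
qed

end

section \<open>Generation by a singular vector and the degree bound\<close>

locale highest_weight_osp = affine_osp +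
  fixes lam :: weight and k c :: complex and v
  assumes irreducible: "irreducible_mod n m scale \<rho> \<rho>K \<rho>d"
    and hw: "hw_vector n m scale \<rho> \<rho>K \<rho>d lam k c v"
begin

lemma v_nonzero: "v \<noteq> 0"
  using hw by (simp add: hw_vector_def)

lemma v_weight: "weight_vec lam c v"
  using hw by (simp add: hw_vector_def weight_vec_def)

lemma submodule_UNIV:
  assumes "subspace W" "\<And>X r w. X \<in> osp n m \<Longrightarrow> w \<in> W \<Longrightarrow> \<rho> X r w \<in> W"
    "\<And>w. w \<in> W \<Longrightarrow> \<rho>K w \<in> W" "\<And>w. w \<in> W \<Longrightarrow> \<rho>d w \<in> W" "w0 \<in> W" "w0 \<noteq> 0"
  shows "W = UNIV"
  using irreducible[unfolded irreducible_mod_def, THEN spec, of W] assms by blast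

lemma K_scalar: "\<rho>K u = k *s u"
proof -
  have "{u. \<rho>K u = k *s u} = UNIV"
  proof (rule submodule_UNIV[of _ v])
    show "subspace {u. \<rho>K u = k *s u}"
      by (rule subspaceI) (simp_all add: lin_0[OF lin_K] lin_add[OF lin_K] lin_scale[OF lin_K] scale_right_distrib mult.commute)
    show "v \<in> {u. \<rho>K u = k *s u}"
      using hw by (simp add: hw_vector_def)
  qed (simp_all add: v_nonzero K_rho lin_scale[OF lin_rho] lin_scale[OF lin_K] K_d lin_scale[OF lin_d])
  then show ?thesis by blast
qed

text \<open>A unit acting on a word is moved past the outermost letter: the swapped term is a letter
  applied to the span, the bracket acts on a shorter word, and the central term is a scalar. On
  \<open>u\<close> itself positive units vanish, negative ones give words, and those of degree 0 are
  zero or lie in the Cartan subalgebra by regularity.\<close>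

lemma span_descendants:
  assumes reg: "regular om D" and sing: "singular om D u" and u: "weight_vec \<mu> z u" "u \<noteq> 0"
  shows "span (descendants om D u) = UNIV"
proof -
  define W where "W = span (descendants om D u)"
  have sub: "subspace W" unfolding W_def by simp
  have gen: "w \<in> descendants om D u \<Longrightarrow> w \<in> W" for w
    unfolding W_def by (rule span_base)
  have unit: "\<forall>i\<in>Idx n m. \<forall>j\<in>Idx n m. \<forall>r. \<rho> (osp_unit i j) r w \<in> W" if "w \<in> descendants om D u" for w
    using that
  proof induction
    case base
    show ?case
    proof (intro ballI allI)
      fix i j r assume ij: "i \<in> Idx n m" "j \<in> Idx n m"
      consider "om i - om j + D * r < 0" | "om i - om j + D * r > 0" | "om i - om j + D * r = 0" by linarith
      then show "\<rho> (osp_unit i j) r u \<in> W"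
      proof cases
        case 1
        then show ?thesis using descendants.step[OF descendants.base ij] gen by blast
      next
        case 2
        then show ?thesis using sing ij sub by (simp add: singular_def subspace_0)
      next
        case 3
        show ?thesis
        proof (cases "fst i \<or> j \<noteq> ng i")
          case True
          then have "i = j" "r = 0" using reg ij 3 unfolding regular_def by blast+
          then show ?thesis
            using u(1) osp_unit_cartan[OF ij(1)] gen[OF descendants.base] sub
            by (simp add: weight_vec_def subspace_scale)
        next
          case False
          then show ?thesis using sub by (simp add: osp_unit_even_ng rho_0 subspace_0)
        qed
      qed
    qed
  next
    case (step w i j r)
    show ?case
    proof (intro ballI allI)
      fix p q r' assume pq: "p \<in> Idx n m" "q \<in> Idx n m"
      note X = osp_unit_osp[OF pq] and Y = osp_unit_osp[OF step.hyps(2,3)]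
      have "\<rho> (osp_unit i j) r (\<rho> (osp_unit p q) r' w) \<in> W"
        unfolding W_def
      proof (rule lin_span[OF lin_rho[OF Y]])
        show "\<rho> (osp_unit i j) r x \<in> span (descendants om D u)" if "x \<in> descendants om D u" for x
          using descendants.step[OF that step.hyps(2-4)] by (rule span_base)
        show "\<rho> (osp_unit p q) r' w \<in> span (descendants om D u)"
          using step.IH pq unfolding W_def by blast
      qed
      moreover have "\<rho> (sbr n m (osp_unit p q) (osp_unit i j)) (r' + r) w \<in> W"
        using rho_in_subspace[OF sbr_osp[OF X Y osp_unit_parity osp_unit_parity] sub] step.IH by blast
      moreover have "\<rho>K w \<in> W"
        using gen[OF step.hyps(1)] sub by (simp add: K_scalar subspace_scale)
      moreover have "\<rho> (osp_unit p q) r' (\<rho> (osp_unit i j) r w) =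
          psign (fst p \<noteq> fst q) (fst i \<noteq> fst j) *s \<rho> (osp_unit i j) r (\<rho> (osp_unit p q) r' w)
          + (\<rho> (sbr n m (osp_unit p q) (osp_unit i j)) (r' + r) w
          + (if r' + r = 0 then of_int r' * bform n m (osp_unit p q) (osp_unit i j) else 0) *s \<rho>K w)"
        using rho_sbr[OF X Y osp_unit_parity osp_unit_parity, of r' r w] by (simp add: algebra_simps)
      ultimately show "\<rho> (osp_unit p q) r' (\<rho> (osp_unit i j) r w) \<in> W"
        using sub by (simp only: subspace_add subspace_scale)
    qed
  qed
  have odd: "odd_fun om" using reg by (simp add: regular_def)
  have "W = UNIV"
  proof (rule submodule_UNIV[OF sub])
    show "u \<in> W" "u \<noteq> 0" using gen[OF descendants.base] u(2) by auto
    show "\<rho>K w \<in> W" if "w \<in> W" for w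
      using that sub by (simp add: K_scalar subspace_scale)
    show "\<rho>d w \<in> W" if "w \<in> W" for w
      using that unfolding W_def
    proof (rule lin_span[OF lin_d, rotated])
      fix x assume "x \<in> descendants om D u"
      then show "\<rho>d x \<in> span (descendants om D u)"
        using descendants_weight[OF odd u(1), of x D] span_scale[OF span_base, of x "descendants om D u"]
        unfolding weight_vec_def by auto
    qed
    show "\<rho> X r w \<in> W" if "X \<in> osp n m" "w \<in> W" for X r w
      using that(2) unfolding W_def
    proof (rule lin_span[OF lin_rho[OF that(1)], rotated])
      fix x assume "x \<in> descendants om D u"
      then show "\<rho> X r x \<in> span (descendants om D u)"
        using rho_in_subspace[OF that(1) sub] unit unfolding W_def by blast
    qed
  qed
  then show ?thesis by (simp add: W_def)
qed

text \<open>The grading operator is diagonal on the spanning words, with eigenvalues obtained from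
  that of \<open>u\<close> by subtracting naturals. Hence two singular vectors for one functional
  have equal degree.\<close>

lemma degree_bound:
  assumes reg: "regular om D" and sing: "singular om D u" and u: "weight_vec \<mu> z u" "u \<noteq> 0"
    and w: "weight_vec \<mu>' z' w" "w \<noteq> 0"
  shows "\<exists>N. degree_val om D \<mu>' z' = degree_val om D \<mu> z - of_nat N"
proof -
  have odd: "odd_fun om" using reg by (simp add: regular_def)
  have "diag_of n m om \<in> osp n m"
    using odd cartan_osp[OF diag_of_cartan] by (simp only: odd_fun_def)
  then have "lin (\<lambda>x. \<rho> (diag_of n m om) 0 x + of_int D *s \<rho>d x)"
    using lin_rho lin_d unfolding lin_def by (simp add: algebra_simps)
  moreover have "\<exists>e\<in>range (\<lambda>N. degree_val om D \<mu> z - of_nat N). \<rho> (diag_of n m om) 0 x + of_int D *s \<rho>d x = e *s x"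
    if "x \<in> descendants om D u" for x
    using descendants_weight[OF odd u(1) that] degree_val_eigen[OF odd, of _ _ x D] by fastforce
  moreover have "w \<in> span (descendants om D u)"
    using span_descendants[OF reg sing u] by simp
  ultimately have "degree_val om D \<mu>' z' \<in> range (\<lambda>N. degree_val om D \<mu> z - of_nat N)"
    using eigenvalue_in_span[where A = "\<lambda>x. \<rho> (diag_of n m om) 0 x + of_int D *s \<rho>d x"
        and S = "descendants om D u" and w = w, OF _ _ _ degree_val_eigen[OF odd w(1)] w(2)] by blast
  then show ?thesis by blast
qed

end

section \<open>Coroots and sl(2) triples of sp(2m)\<close>

definition coord :: "weight \<Rightarrow> idx \<Rightarrow> complex" where
  "coord \<mu> p = of_int (sgn (snd p)) * \<mu> ((if fst p then Ep else De) (nat \<bar>snd p\<bar>))"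

lemma wt_eval_osp_unit:
  assumes "p \<in> Idx n m"
  shows "wt_eval n m \<mu> (osp_unit p p) = coord \<mu> p"
proof -
  obtain b x where p: "p = (b, x)" by (cases p)
  define a where "a = nat \<bar>x\<bar>"
  have a: "Suc 0 \<le> a" "a \<le> (if b then m else n)"
    using assms by (auto simp: p a_def Idx_iff)
  have e: "osp_unit p p (b', int i) (b', int i) = (if b' = b \<and> i = a then of_int (sgn x) else 0)" if "Suc 0 \<le> i" for b' i
  proof -
    have "ng (b, x) = (b, - x)" by (simp add: ng_def)
    then show ?thesis
      using that a(1) unfolding osp_unit_def osgn_self p by (auto simp: a_def sgn_if)
  qed
  have "(\<Sum>i=1..n. \<mu> (De i) * osp_unit p p (False, int i) (False, int i)) = (\<Sum>i=1..n. if i = a then (if b then 0 else \<mu> (De a) * of_int (sgn x)) else 0)"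
    by (intro sum.cong refl) (simp add: e)
  moreover have "(\<Sum>i=1..m. \<mu> (Ep i) * osp_unit p p (True, int i) (True, int i)) = (\<Sum>i=1..m. if i = a then (if b then \<mu> (Ep a) * of_int (sgn x) else 0) else 0)"
    by (intro sum.cong refl) (simp add: e)
  ultimately show ?thesis
    using a unfolding wt_eval_def coord_def p by (simp add: a_def[symmetric] split: if_splits)
qed

text \<open>The coroot of \<open>wt i - wt j\<close> for indices of sp(2m). For a long root the two
  diagonal units are negatives of each other, and their difference would be twice the
  coroot.\<close>

definition hmat :: "idx \<Rightarrow> idx \<Rightarrow> mat" where
  "hmat i j = (if j = ng i then osp_unit i i else msub (osp_unit i i) (osp_unit j j))"

lemma hmat_cartan:
  assumes "i \<in> Idx n m" "j \<in> Idx n m"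
  shows "hmat i j \<in> cartan n m"
proof -
  have "msub A B \<in> cartan n m" if "A \<in> cartan n m" "B \<in> cartan n m" for A B
    using that unfolding cartan_iff msub_def by simp
  then show ?thesis
    using assms osp_unit_cartan by (simp add: hmat_def)
qed

lemma wt_eval_hmat:
  assumes "i \<in> Idx n m" "j \<in> Idx n m"
  shows "wt_eval n m \<mu> (hmat i j) = coord \<mu> i - (if j = ng i then 0 else coord \<mu> j)"
proof -
  have "wt_eval n m \<mu> (msub A B) = wt_eval n m \<mu> A - wt_eval n m \<mu> B" for A B
    by (simp add: wt_eval_def msub_def sum_subtractf algebra_simps)
  then show ?thesis using assms by (simp add: hmat_def wt_eval_osp_unit)
qed

lemma hmat_root:
  assumes "i \<in> Idx n m" "j \<in> Idx n m" "i \<noteq> j"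
  shows "wt_eval n m (wt i - wt j) (hmat i j) = 2"
proof -
  have "hmat i j i i - hmat i j j j = 2"
    using assms(3) ng_neq[OF assms(1)] ng_neq[OF assms(2)]
    by (auto simp: hmat_def msub_def osp_unit_def osgn_self)
  then show ?thesis
    using wt_eval_wt[OF hmat_cartan[OF assms(1,2)] assms(1)] wt_eval_wt[OF hmat_cartan[OF assms(1,2)] assms(2)]
    by (simp add: wt_eval_diff)
qed

lemma rootspace_msc: "X \<in> rootspace n m \<alpha> \<Longrightarrow> msc c X \<in> rootspace n m \<alpha>"
proof -
  have "mmul n m H (msc c X) = msc c (mmul n m H X)" "mmul n m (msc c X) H = msc c (mmul n m X H)" for H
    by (simp_all add: mmul_def msc_def sum_distrib_left mult.commute mult.left_commute)
  moreover have "msub (msc c A) (msc c B) = msc c (msub A B)" for A B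
    by (simp add: msub_def msc_def algebra_simps)
  moreover have "msc c (msc d X) = msc d (msc c X)" for d
    by (simp add: msc_def mult.left_commute)
  ultimately show "X \<in> rootspace n m \<alpha> \<Longrightarrow> msc c X \<in> rootspace n m \<alpha>"
    by (simp add: rootspace_def osp_msc)
qed

context highest_weight_osp
begin

text \<open>The factor compensates for \<^const>\<open>osp_unit\<close> being twice an elementary matrix on long roots.\<close>
definition raise :: "idx \<Rightarrow> idx \<Rightarrow> int \<Rightarrow> 'a \<Rightarrow> 'a" where
  "raise i j r = \<rho> (msc (if j = ng i then 1 / 4 else 1) (osp_unit i j)) r"

definition lower :: "idx \<Rightarrow> idx \<Rightarrow> int \<Rightarrow> 'a \<Rightarrow> 'a" where
  "lower i j r = \<rho> (osp_unit j i) (- r)"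

text \<open>The value of a weight of level \<open>k\<close> on the coroot of
  \<open>wt i - wt j\<close> plus \<open>r\<close> delta. The coefficient of K is \<open>r\<close>
  for long roots but would be \<open>2 * r\<close> for short ones, whence the condition
  \<open>j = ng i \<or> r = 0\<close> in \<open>sl2_root\<close>.\<close>

definition hval :: "weight \<Rightarrow> idx \<Rightarrow> idx \<Rightarrow> int \<Rightarrow> complex" where
  "hval \<mu> i j r = coord \<mu> i - (if j = ng i then 0 else coord \<mu> j) + of_int r * k"

lemma sl2_root:
  assumes ij: "i \<in> Idx n m" "j \<in> Idx n m" and odd: "fst i" "fst j" and "i \<noteq> j" "j = ng i \<or> r = 0"
  shows "sl2_action scale (raise i j r) (lower i j r) (\<lambda>u. \<rho> (hmat i j) 0 u + (of_int r * k) *s u)"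
proof
  have e: "osp_unit i j \<in> osp n m" "osp_unit j i \<in> osp n m" using ij by (auto intro: osp_unit_osp)
  have p: "mpart False (osp_unit i j) = osp_unit i j" "mpart False (osp_unit j i) = osp_unit j i"
    using osp_unit_parity[of i j] osp_unit_parity[of j i] odd by auto
  have rs: "msc (if j = ng i then 1 / 4 else 1) (osp_unit i j) \<in> rootspace n m (wt i - wt j)" "osp_unit j i \<in> rootspace n m (wt j - wt i)"
    using osp_unit_rootspace[OF ij] osp_unit_rootspace[OF ij(2,1)] rootspace_msc by blast+
  have H: "hmat i j \<in> cartan n m" using ij by (rule hmat_cartan)
  show "lin (raise i j r)" "lin (lower i j r)"
    unfolding raise_def lower_def using e by (auto intro: lin_rho osp_msc)
  fix u
  show "raise i j r (lower i j r u) - lower i j r (raise i j r u) = \<rho> (hmat i j) 0 u + (of_int r * k) *s u"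
  proof (cases "j = ng i")
    case True
    note oi = osp_unit_osp[OF ij(1) ij(1)]
    have "\<rho> (osp_unit i j) r (\<rho> (osp_unit j i) (- r) u) - \<rho> (osp_unit j i) (- r) (\<rho> (osp_unit i j) r u)
        = 4 *s \<rho> (osp_unit i i) 0 u + (of_int r * 4) *s k *s u"
      using rho_sbr[OF e p, of r "- r" u] sbr_long_transpose[OF ij(1) odd(1)] bform_long_transpose[OF ij(1) odd(1)]
      by (simp add: psign_def True K_scalar rho_msc[OF oi])
    then have "(1/4) *s (\<rho> (osp_unit i j) r (\<rho> (osp_unit j i) (- r) u) - \<rho> (osp_unit j i) (- r) (\<rho> (osp_unit i j) r u))
        = \<rho> (osp_unit i i) 0 u + (of_int r * k) *s u"
      by (simp add: scale_right_distrib)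
    then show ?thesis
      using True by (simp add: raise_def lower_def hmat_def rho_msc[OF e(1)[unfolded True]]
          lin_scale[OF lin_rho[OF e(2)[unfolded True]]] scale_right_diff_distrib)
  next
    case False
    then have r: "r = 0" using assms by blast
    have s: "sbr n m (osp_unit i j) (osp_unit j i) = hmat i j"
      using sbr_osp_unit_transpose[OF ij assms(5) False] odd False by (simp add: hmat_def msc_def)
    have "msc 1 (osp_unit i j) = osp_unit i j" by (simp add: msc_def)
    then show ?thesis
      using False rho_sbr[OF e p, of 0 0 u] by (simp add: raise_def lower_def r s psign_def)
  qed
  have HX: "\<rho> (hmat i j) 0 (\<rho> X t u) + (of_int r * k) *s \<rho> X t u - \<rho> X t (\<rho> (hmat i j) 0 u + (of_int r * k) *s u)
      = wt_eval n m \<alpha> (hmat i j) *s \<rho> X t u" if X: "X \<in> rootspace n m \<alpha>" for X \<alpha> t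
  proof -
    have "X \<in> osp n m" using X by (simp add: rootspace_def)
    then show ?thesis
      using rho_comm[OF cartan_osp[OF H] _ cartan_even[OF H], of X 0 t u]
      by (simp add: rootspace_mcomm[OF H X] rho_msc lin_add[OF lin_rho] lin_scale[OF lin_rho])
  qed
  show "\<rho> (hmat i j) 0 (raise i j r u) + (of_int r * k) *s raise i j r u -
       raise i j r (\<rho> (hmat i j) 0 u + (of_int r * k) *s u) = 2 *s raise i j r u"
    unfolding raise_def HX[OF rs(1)] hmat_root[OF ij assms(5)] ..
  have "wt_eval n m (wt j - wt i) (hmat i j) = - wt_eval n m (wt i - wt j) (hmat i j)"
    by (simp add: wt_eval_diff)
  then show "\<rho> (hmat i j) 0 (lower i j r u) + (of_int r * k) *s lower i j r u -
       lower i j r (\<rho> (hmat i j) 0 u + (of_int r * k) *s u) = - 2 *s lower i j r u"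
    unfolding lower_def HX[OF rs(2)] hmat_root[OF ij assms(5)] by simp
qed

lemma hmat_weight:
  assumes "i \<in> Idx n m" "j \<in> Idx n m" "weight_vec \<mu> z u"
  shows "\<rho> (hmat i j) 0 u + (of_int r * k) *s u = hval \<mu> i j r *s u"
  using assms(3) hmat_cartan[OF assms(1,2)]
  by (simp add: weight_vec_def wt_eval_hmat[OF assms(1,2)] hval_def scale_left_distrib)

text \<open>Stronger than simplicity, since a sum of two positive roots cannot have least degree.
  The second index pair names the same root space, by \<open>osp_unit_ng\<close>.\<close>

definition minimal_root :: "(idx \<Rightarrow> int) \<Rightarrow> int \<Rightarrow> idx \<Rightarrow> idx \<Rightarrow> int \<Rightarrow> bool" where
  "minimal_root om D i j r \<longleftrightarrow> om i - om j + D * r > 0 \<and>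
    (\<forall>p\<in>Idx n m. \<forall>q\<in>Idx n m. \<forall>r'. (fst p \<or> q \<noteq> ng p) \<longrightarrow> om p - om q + D * r' > 0 \<longrightarrow>
      om p - om q + D * r' > om i - om j + D * r \<or> r' = r \<and> (p = i \<and> q = j \<or> p = ng j \<and> q = ng i))"

lemma minimal_rootD:
  assumes "minimal_root om D i j r" "p \<in> Idx n m" "q \<in> Idx n m" "fst p \<or> q \<noteq> ng p" "om p - om q + D * r' > 0"
  shows "om p - om q + D * r' > om i - om j + D * r \<or> r' = r \<and> (p = i \<and> q = j \<or> p = ng j \<and> q = ng i)"
  using assms unfolding minimal_root_def by blast

text \<open>Moving the raising operator past one lowering operator subtracts the minimal degree. The
  bracket still has positive degree, so each of its components either exceeds the minimal degree,
  where induction applies, or belongs to the minimal root, which \<open>sbr_lowering_entry\<close>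
  excludes.\<close>

lemma above_minimal_kills:
  assumes reg: "regular om D" and sing: "singular om D v" and min: "minimal_root om D i j r"
    and ij: "i \<in> Idx n m" "j \<in> Idx n m" "i \<noteq> j"
  shows "p \<in> Idx n m \<Longrightarrow> q \<in> Idx n m \<Longrightarrow> om p - om q + D * r' > om i - om j + D * r
    \<Longrightarrow> \<rho> (osp_unit p q) r' ((lower i j r ^^ N) v) = 0"
proof (induction N arbitrary: p q r')
  case 0
  have "om i - om j + D * r > 0" using min by (simp add: minimal_root_def)
  then show ?case using 0 sing by (simp add: singular_def)
next
  case (Suc N)
  have om: "om (ng p) = - om p" for p using reg unfolding regular_def odd_fun_def by blast
  define u where "u = (lower i j r ^^ N) v"
  note X = osp_unit_osp[OF Suc.prems(1,2)] and Y = osp_unit_osp[OF ij(2,1)]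
  have "\<rho> (osp_unit p q) r' u = 0"
    using Suc.IH[OF Suc.prems] by (simp add: u_def)
  moreover have "\<rho> (sbr n m (osp_unit p q) (osp_unit j i)) (r' + - r) u \<in> {0}"
  proof (rule rho_in_subspace[OF sbr_osp[OF X Y osp_unit_parity osp_unit_parity]])
    show "subspace {0}" by (simp add: subspace_single_0)
    fix p' q' assume pq': "p' \<in> Idx n m" "q' \<in> Idx n m" "sbr n m (osp_unit p q) (osp_unit j i) p' q' \<noteq> 0"
    have deg: "om p' - om q' + D * (r' + - r) = (om p - om q + D * r') - (om i - om j + D * r)"
      using sbr_osp_unit_degree[of om, OF om pq'(3)] by (simp add: algebra_simps)
    show "\<rho> (osp_unit p' q') (r' + - r) u \<in> {0}"
    proof (cases "fst p' \<or> q' \<noteq> ng p'")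
      case True
      have "om p' - om q' + D * (r' + - r) > om i - om j + D * r"
        using minimal_rootD[OF min pq'(1,2) True, of "r' + - r"] deg Suc.prems(3)
          sbr_lowering_entry[OF ij osp_unit_parity, of p q] pq'(3) by auto
      then show ?thesis
        using Suc.IH[OF pq'(1,2)] by (simp add: u_def)
    qed (simp add: osp_unit_even_ng rho_0)
  qed
  moreover have "bform n m (osp_unit p q) (osp_unit j i) = 0" if "r' + - r = 0"
    using that Suc.prems(3) by (intro bform_osp_unit_0[of om, OF om]) auto
  ultimately have "\<rho> (osp_unit p q) r' (\<rho> (osp_unit j i) (- r) u) = 0"
    using rho_sbr[OF X Y osp_unit_parity osp_unit_parity, of r' "- r" u] by (auto simp: lin_0[OF lin_rho[OF Y]])
  then show ?case by (simp add: u_def lower_def)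
qed

text \<open>By \<open>above_minimal_kills\<close> only the minimal root could act nontrivially on
  the power, so \<open>top\<close> makes it singular for the same functional. Its degree is below
  that of \<open>v\<close>, while \<open>degree_bound\<close> with the power as generator puts the
  degree of \<open>v\<close> at or below its own.\<close>

lemma lower_power_eq_0:
  assumes reg: "regular om D" and sing: "singular om D v" and min: "minimal_root om D i j r"
    and ij: "i \<in> Idx n m" "j \<in> Idx n m" "i \<noteq> j" and N: "N > 0"
    and top: "\<rho> (osp_unit i j) r ((lower i j r ^^ N) v) = 0"
  shows "(lower i j r ^^ N) v = 0"
proof (rule ccontr)
  define u where "u = (lower i j r ^^ N) v"
  assume "(lower i j r ^^ N) v \<noteq> 0"
  then have u0: "u \<noteq> 0" by (simp add: u_def)
  have odd: "odd_fun om" using reg by (simp add: regular_def)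
  have "\<rho> (osp_unit p q) r' u = 0" if pq: "p \<in> Idx n m" "q \<in> Idx n m" "om p - om q + D * r' > 0" for p q r'
  proof (cases "fst p \<or> q \<noteq> ng p")
    case True
    from minimal_rootD[OF min pq(1,2) True pq(3)]
    consider "om p - om q + D * r' > om i - om j + D * r" | "r' = r" "p = i" "q = j" | "r' = r" "p = ng j" "q = ng i"
      by blast
    then show ?thesis
    proof cases
      case 1
      then show ?thesis using above_minimal_kills[OF reg sing min ij pq(1,2)] by (simp add: u_def)
    next
      case 2
      then show ?thesis using top by (simp add: u_def)
    next
      case 3
      then show ?thesis
        using top osp_unit_osp[OF ij(1,2)] by (simp add: osp_unit_ng[OF ij(1,2)] rho_msc u_def)
    qed
  qed (simp add: osp_unit_even_ng rho_0)
  then have singu: "singular om D u" by (simp add: singular_def)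
  have wu: "weight_vec (lam + wsc (of_nat N) (wt j - wt i)) (c + of_nat N * of_int (- r)) u"
    unfolding u_def lower_def using weight_vec_funpow[OF v_weight osp_unit_rootspace[OF ij(2,1)]] .
  obtain M where "degree_val om D lam c = degree_val om D (lam + wsc (of_nat N) (wt j - wt i)) (c + of_nat N * of_int (- r)) - of_nat M"
    using degree_bound[OF reg singu wu u0 v_weight v_nonzero] by blast
  then have "of_int (int N * (om j - om i + D * - r)) = (of_int (int M) :: complex)"
    unfolding degree_val_unit[OF odd ij(2,1)] by simp
  then have "int N * (om j - om i + D * - r) \<ge> 0"
    by (simp only: of_int_eq_iff)
  moreover have "om j - om i + D * - r < 0"
    using min by (simp add: minimal_root_def)
  ultimately show False using N by (simp add: zero_le_mult_iff)
qed

text \<open>The vectors killed by some power form a submodule because the operator is ad-nilpotent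
  on the whole affine algebra; this submodule contains \<open>v\<close>.\<close>

lemma lower_locally_nilpotent:
  assumes ij: "i \<in> Idx n m" "j \<in> Idx n m" "i \<noteq> j" "fst i = fst j" and N: "(lower i j r ^^ N) v = 0"
  shows "\<exists>M. (lower i j r ^^ M) u = 0"
proof -
  define Y where "Y = osp_unit j i"
  have Y: "Y \<in> osp n m" "mpart False Y = Y" "mmul n m Y Y = (\<lambda>p q. 0)"
    unfolding Y_def using ij osp_unit_osp osp_unit_parity[of j i] mmul_lowering_self by auto
  have F: "lin (lower i j r)" unfolding lower_def using Y(1) lin_rho by (simp add: Y_def)
  let ?L = "{x. \<exists>N. (lower i j r ^^ N) x = 0}"
  have ad1: "lower i j r (\<rho> X t x + a *s x) - (\<rho> X t (lower i j r x) + a *s lower i j r x)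
      = \<rho> (mcomm n m Y X) (- r + t) x + ((if - r + t = 0 then of_int (- r) * bform n m Y X else 0) * k) *s x"
    if "X \<in> osp n m" for X t a x
    using rho_comm[OF Y(1) that Y(2), of "- r" t x]
    by (simp add: lower_def Y_def[symmetric] lin_add[OF lin_rho[OF Y(1)]] lin_scale[OF lin_rho[OF Y(1)]] K_scalar)
  \<comment> \<open>Three commutators annihilate the matrix by \<open>mcomm_cube_eq_0\<close> and
    leave a scalar from the central term, which the fourth commutator removes. The summand
    \<open>a *s x\<close> in \<open>ad1\<close> carries that scalar along.\<close>
  have ad0: "ad_nilpotent (lower i j r) 4 (\<rho> X t)" if X: "X \<in> osp n m" for X t
  proof -
    have X1: "mcomm n m Y X \<in> osp n m" and X2: "mcomm n m Y (mcomm n m Y X) \<in> osp n m"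
      using mcomm_osp X Y by blast+
    have s1: "lower i j r (\<rho> X t x) - \<rho> X t (lower i j r x)
      = \<rho> (mcomm n m Y X) (- r + t) x + ((if - r + t = 0 then of_int (- r) * bform n m Y X else 0) * k) *s x" for x
      using ad1[OF X, of t x 0] by simp
    show ?thesis
      unfolding numeral_eq_Suc ad_nilpotent.simps pred_numeral_simps BitM.simps
      unfolding s1 ad1[OF X1] ad1[OF X2] mcomm_cube_eq_0[OF Y(3)] rho_0
      by (simp add: lin_scale[OF F])
  qed
  have "?L = UNIV"
  proof (rule submodule_UNIV)
    show "subspace ?L" by (rule locally_nilpotent_subspace[OF F])
    show "v \<in> ?L" using N by blast
    show "v \<noteq> 0" by (rule v_nonzero)
    show "\<rho> X t w \<in> ?L" if "X \<in> osp n m" "w \<in> ?L" for X t w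
      using ad_nilpotent_funpow[OF F lin_rho[OF that(1)] ad0[OF that(1)]] that(2) by blast
    show "\<rho>K w \<in> ?L" if "w \<in> ?L" for w
      using that subspace_scale[OF locally_nilpotent_subspace[OF F]] by (simp only: K_scalar)
    show "\<rho>d w \<in> ?L" if "w \<in> ?L" for w
    proof -
      have "lower i j r (\<rho>d x) - \<rho>d (lower i j r x) = of_int r *s lower i j r x" for x
        using d_rho[OF Y(1), of "- r" x] by (simp add: lower_def Y_def[symmetric] algebra_simps)
      then have "ad_nilpotent (lower i j r) (Suc (Suc 0)) \<rho>d"
        by (simp add: lin_scale[OF F])
      then show ?thesis
        using ad_nilpotent_funpow[OF F lin_d] that by blast
    qed
  qed
  then show ?thesis by blast
qed

end

section \<open>Positive roots and Borel subalgebras\<close>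

text \<open>The functional of the given Borel subalgebra up to scale: eps x has height 2 x - 1 and
  del x has 2 x - 2. Both del 1 and - del 1 get 0; their difference is not a root, and the condition
  \<open>fst p \<or> q \<noteq> ng p\<close> keeps such pairs out.\<close>

definition height :: "idx \<Rightarrow> int" where
  "height p = (if snd p > 0 then (if fst p then 2 * snd p - 1 else 2 * snd p - 2)
     else if snd p < 0 then (if fst p then 2 * snd p + 1 else 2 * snd p + 2) else 0)"

text \<open>The condition in \<open>pos_roots\<close> without membership in \<open>roots\<close>,
  which makes it closed under addition.\<close>

definition cone :: "nat \<Rightarrow> nat \<Rightarrow> weight set" where
  "cone n m = {\<alpha>. \<exists>c :: weight \<Rightarrow> nat. \<alpha> = (\<Sum>\<beta>\<in>simple_roots n m. wsc (of_nat (c \<beta>)) \<beta>)}"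

lemma finite_simple_roots: "finite (simple_roots n m)"
proof -
  have "simple_roots n m \<subseteq> (\<lambda>j. eps (j + 1) - eps j) ` {..m} \<union> (\<lambda>i. eps i - del i) ` {..n}
     \<union> (\<lambda>i. del (i + 1) - eps i) ` {..n} \<union> {eps 1 + del 1}"
    unfolding simple_roots_def by force
  then show ?thesis by (rule finite_subset) simp
qed

lemma cone_add: "\<alpha> \<in> cone n m \<Longrightarrow> \<beta> \<in> cone n m \<Longrightarrow> \<alpha> + \<beta> \<in> cone n m"
proof -
  assume "\<alpha> \<in> cone n m" "\<beta> \<in> cone n m"
  then obtain c d :: "weight \<Rightarrow> nat" where "\<alpha> = (\<Sum>\<gamma>\<in>simple_roots n m. wsc (of_nat (c \<gamma>)) \<gamma>)"
    "\<beta> = (\<Sum>\<gamma>\<in>simple_roots n m. wsc (of_nat (d \<gamma>)) \<gamma>)"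
    unfolding cone_def by blast
  moreover have "wsc (of_nat a) \<gamma> + wsc (of_nat b) \<gamma> = wsc (of_nat (a + b)) \<gamma>" for a b \<gamma>
    by (simp add: wsc_def fun_eq_iff distrib_right)
  ultimately have "\<alpha> + \<beta> = (\<Sum>\<gamma>\<in>simple_roots n m. wsc (of_nat (c \<gamma> + d \<gamma>)) \<gamma>)"
    by (simp only: sum.distrib[symmetric])
  then show ?thesis unfolding cone_def by (intro CollectI exI[of _ "\<lambda>\<gamma>. c \<gamma> + d \<gamma>"])
qed

lemma cone_simple: "\<beta> \<in> simple_roots n m \<Longrightarrow> \<beta> \<in> cone n m"
proof -
  assume b: "\<beta> \<in> simple_roots n m"
  have "(\<Sum>\<gamma>\<in>simple_roots n m. wsc (of_nat (if \<gamma> = \<beta> then 1 else 0)) \<gamma>) = (\<Sum>\<gamma>\<in>simple_roots n m. if \<gamma> = \<beta> then \<beta> else 0)"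
    by (intro sum.cong refl) (auto simp: wsc_def fun_eq_iff)
  also have "\<dots> = \<beta>" using b finite_simple_roots by simp
  finally show ?thesis unfolding cone_def by (intro CollectI exI[of _ "\<lambda>\<gamma>. if \<gamma> = \<beta> then 1 else 0"]) simp
qed

lemma cone_0: "0 \<in> cone n m"
proof -
  have "wsc (of_nat 0) \<gamma> = 0" for \<gamma> by (simp add: wsc_def fun_eq_iff)
  then show ?thesis unfolding cone_def by (intro CollectI exI[of _ "\<lambda>_. 0"]) (simp only: sum.neutral_const)
qed

lemma cone_refl: "\<alpha> - \<alpha> \<in> cone n m"
  by (simp only: diff_self cone_0)

lemma cone_trans: "\<alpha> - \<beta> \<in> cone n m \<Longrightarrow> \<beta> - \<gamma> \<in> cone n m \<Longrightarrow> \<alpha> - \<gamma> \<in> cone n m"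
  using cone_add[of "\<alpha> - \<beta>" n m "\<beta> - \<gamma>"] by (simp only: diff_add_cancel add_diff_eq)

section \<open>Positive roots in terms of the height\<close>

context
  fixes n m :: nat
  assumes nm: "1 \<le> n" "n \<le> m"
begin

lemma eps_minus_del: "1 \<le> x \<Longrightarrow> x \<le> n \<Longrightarrow> eps x - del x \<in> cone n m"
  by (intro cone_simple) (auto simp: simple_roots_def)

lemma del_minus_eps: "1 \<le> x \<Longrightarrow> x < n \<Longrightarrow> del (Suc x) - eps x \<in> cone n m"
  by (intro cone_simple) (auto simp: simple_roots_def)

text \<open>For \<open>x < n\<close> the difference is the sum of the two odd simple roots that meet
  at \<open>del (Suc x)\<close>.\<close>

lemma eps_Suc_minus_eps:
  assumes "1 \<le> x" "x < m"
  shows "eps (Suc x) - eps x \<in> cone n m"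
proof (cases "x < n")
  case True
  then show ?thesis
    using cone_trans[OF eps_minus_del[of "Suc x"] del_minus_eps[of x]] assms by simp
next
  case False
  then show ?thesis
    using assms by (intro cone_simple) (auto simp: simple_roots_def)
qed

lemma eps_minus_eps:
  assumes "1 \<le> y" "y \<le> x" "x \<le> m"
  shows "eps x - eps y \<in> cone n m"
  using assms(2,3)
proof (induction x rule: dec_induct)
  case base
  show ?case by (rule cone_refl)
next
  case (step x)
  show ?case
    by (rule cone_trans[OF eps_Suc_minus_eps step.IH]) (use step.hyps step.prems assms(1) in auto)
qed

lemma eps_minus_del': "1 \<le> y \<Longrightarrow> y \<le> x \<Longrightarrow> x \<le> m \<Longrightarrow> y \<le> n \<Longrightarrow> eps x - del y \<in> cone n m"
  using cone_trans[OF eps_minus_eps[of y x] eps_minus_del[of y]] by blast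

lemma del_minus_eps':
  assumes "1 \<le> y" "y < x" "x \<le> n"
  shows "del x - eps y \<in> cone n m"
proof -
  have x: "Suc (x - 1) = x" using assms by simp
  have "del x - eps (x - 1) \<in> cone n m"
    using del_minus_eps[of "x - 1"] assms unfolding x by simp
  moreover have "eps (x - 1) - eps y \<in> cone n m" using assms nm by (intro eps_minus_eps) auto
  ultimately show ?thesis by (rule cone_trans)
qed

lemma del_minus_del:
  assumes "1 \<le> y" "y < x" "x \<le> n"
  shows "del x - del y \<in> cone n m"
  using cone_trans[OF del_minus_eps'[OF assms] eps_minus_del[of y]] assms by simp

lemma wt_pos: "snd p > 0 \<Longrightarrow> wt p = (if fst p then eps else del) (nat (snd p))"
  by (simp add: wt_def wsc_1)

lemma wt_diff_cone_pos:
  assumes "p \<in> Idx n m" "q \<in> Idx n m" "snd p > 0" "snd q > 0" "height p > height q"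
  shows "wt p - wt q \<in> cone n m"
proof -
  define x y where "x = nat (snd p)" and "y = nat (snd q)"
  have xy: "snd p = int x" "snd q = int y" "1 \<le> x" "1 \<le> y" using assms(3,4) by (auto simp: x_def y_def)
  have b: "x \<le> (if fst p then m else n)" "y \<le> (if fst q then m else n)"
    using assms(1,2) xy by (auto simp: Idx_iff)
  have h: "height p = (if fst p then 2 * int x - 1 else 2 * int x - 2)" "height q = (if fst q then 2 * int y - 1 else 2 * int y - 2)"
    using xy by (simp_all add: height_def)
  show ?thesis
    unfolding wt_pos[OF assms(3)] wt_pos[OF assms(4)] x_def[symmetric] y_def[symmetric]
    using assms(5) b xy(3,4) unfolding h
    by (cases "fst p"; cases "fst q") (auto intro: eps_minus_eps eps_minus_del' del_minus_eps' del_minus_del)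
qed

lemma wt_minus_del1:
  assumes "p \<in> Idx n m" "snd p > 0"
  shows "wt p - del 1 \<in> cone n m"
proof -
  have F1: "(False, 1) \<in> Idx n m" "wt (False, 1) = del 1" using nm by (simp_all add: Idx_iff wt_pos)
  show ?thesis
  proof (cases "p = (False, 1)")
    case True
    then show ?thesis unfolding True F1(2) by (intro cone_refl)
  next
    case False
    then have "height p > height (False, 1)" using assms(2) by (cases p; cases "fst p") (auto simp: height_def)
    then show ?thesis using wt_diff_cone_pos[OF assms(1) F1(1) assms(2)] F1(2) by simp
  qed
qed

lemma wt_minus_eps1:
  assumes "p \<in> Idx n m" "snd p > 0" "p \<noteq> (False, 1)"
  shows "wt p - eps 1 \<in> cone n m"
proof -
  have F1: "(True, 1) \<in> Idx n m" "wt (True, 1) = eps 1" using nm by (simp_all add: Idx_iff wt_pos)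
  show ?thesis
  proof (cases "p = (True, 1)")
    case True
    then show ?thesis unfolding True F1(2) by (intro cone_refl)
  next
    case False
    then have "height p > height (True, 1)" using assms(2,3) by (cases p; cases "fst p") (auto simp: height_def)
    then show ?thesis using wt_diff_cone_pos[OF assms(1) F1(1) assms(2)] F1(2) by simp
  qed
qed

text \<open>The sum is split through the simple root \<open>eps 1 + del 1\<close>, leaving
  \<open>wt p - eps 1\<close> and \<open>wt q - del 1\<close>. The excluded pair would give 2 del 1,
  which is not a root.\<close>

lemma wt_sum_cone:
  assumes "p \<in> Idx n m" "q \<in> Idx n m" "snd p > 0" "snd q > 0" "p \<noteq> (False, 1) \<or> q \<noteq> (False, 1)"
  shows "wt p + wt q \<in> cone n m"
proof -
  have *: "wt p + wt q \<in> cone n m"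
    if "p \<in> Idx n m" "q \<in> Idx n m" "snd p > 0" "snd q > 0" "p \<noteq> (False, 1)" for p q
  proof -
    have "eps 1 + del 1 \<in> cone n m" by (intro cone_simple) (simp add: simple_roots_def)
    then have "(wt p - eps 1) + ((wt q - del 1) + (eps 1 + del 1)) \<in> cone n m"
      using cone_add wt_minus_eps1 wt_minus_del1 that by blast
    also have "(wt p - eps 1) + ((wt q - del 1) + (eps 1 + del 1)) = wt p + wt q"
      by (simp add: fun_eq_iff)
    finally show ?thesis .
  qed
  show ?thesis using *[of p q] *[of q p] assms by (metis add.commute)
qed

lemma wt_diff_cone:
  assumes pq: "p \<in> Idx n m" "q \<in> Idx n m" "fst p \<or> q \<noteq> ng p" "height p > height q"
  shows "wt p - wt q \<in> cone n m"
proof -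
  have nz: "snd p \<noteq> 0" "snd q \<noteq> 0" using pq(1,2) by (auto simp: Idx_iff)
  have hng: "height (ng a) = - height a" for a by (auto simp: height_def)
  consider "snd p > 0" "snd q > 0" | "snd p < 0" "snd q < 0" | "snd p > 0" "snd q < 0" | "snd p < 0" "snd q > 0"
    using nz by linarith
  then show ?thesis
  proof cases
    case 1
    then show ?thesis using wt_diff_cone_pos pq by blast
  next
    case 2
    have "wt (ng q) - wt (ng p) \<in> cone n m"
      using 2 pq by (intro wt_diff_cone_pos) (auto simp: hng)
    moreover have "wt (ng q) - wt (ng p) = wt p - wt q"
      unfolding wt_ng by (simp add: fun_eq_iff)
    ultimately show ?thesis by simp
  next
    case 3
    have "p \<noteq> (False, 1) \<or> ng q \<noteq> (False, 1)" using pq(3) by (metis ng_ng fst_conv)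
    then have "wt p + wt (ng q) \<in> cone n m"
      using 3 pq by (intro wt_sum_cone) auto
    moreover have "wt p + wt (ng q) = wt p - wt q"
      unfolding wt_ng by (simp add: fun_eq_iff)
    ultimately show ?thesis by simp
  next
    case 4
    then have "height p \<le> 0" "height q \<ge> 0"
      by (auto simp: height_def)
    then show ?thesis using pq(4) by simp
  qed
qed

lemma wt_diff_roots:
  assumes pq: "p \<in> Idx n m" "q \<in> Idx n m" "fst p \<or> q \<noteq> ng p" "p \<noteq> q"
  shows "wt p - wt q \<in> roots n m" and "fst p \<Longrightarrow> fst q \<Longrightarrow> wt p - wt q \<in> roots_eps m"
proof -
  obtain b x b' y where p: "p = (b, x)" and q: "q = (b', y)" by (cases p; cases q)
  define i j where "i = nat \<bar>x\<bar>" and "j = nat \<bar>y\<bar>"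
  define S T :: complex where "S = of_int (sgn x)" and "T = of_int (- sgn y)"
  have ST: "S \<in> {1, -1}" "T \<in> {1, -1}" using pq by (auto simp: p q Idx_iff S_def T_def sgn_if)
  have ij: "1 \<le> i" "i \<le> (if b then m else n)" "1 \<le> j" "j \<le> (if b' then m else n)"
    using pq by (auto simp: p q Idx_iff i_def j_def split: if_splits)
  have w: "wt p - wt q = wsc S ((if b then eps else del) i) + wsc T ((if b' then eps else del) j)"
    by (simp add: wt_def p q S_def T_def i_def j_def wsc_def fun_eq_iff)
  have same: "i \<noteq> j \<or> (T = S \<and> b)" if "b = b'"
  proof (cases "i = j")
    case True
    then have "y = - x" using that pq(4) by (auto simp: p q i_def j_def)
    then show ?thesis using that pq(3) by (auto simp: p q S_def T_def ng_def sgn_if)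
  qed simp
  have eps: "wt p - wt q \<in> roots_eps m" if b: "b" "b'"
  proof -
    have ijm: "i \<in> {1..m}" "j \<in> {1..m}" using ij b by auto
    show ?thesis
    proof (cases "i = j")
      case True
      then have w2: "wt p - wt q = wsc (2 * S) (eps i)" using same b unfolding w by (simp add: wsc_def fun_eq_iff)
      show ?thesis unfolding roots_eps_def w2 using ST(1) ijm(1) by blast
    next
      case False
      have w2: "wt p - wt q = wsc S (eps i) + wsc T (eps j)" unfolding w by (simp only: b if_True)
      show ?thesis unfolding roots_eps_def w2 using ST ijm False by blast
    qed
  qed
  then show "fst p \<Longrightarrow> fst q \<Longrightarrow> wt p - wt q \<in> roots_eps m" by (simp add: p q)
  consider "b" "b'" | "\<not> b" "\<not> b'" | "b" "\<not> b'" | "\<not> b" "b'" by blast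
  then show "wt p - wt q \<in> roots n m"
  proof cases
    case 1
    then show ?thesis using eps by (simp add: roots_def)
  next
    case 2
    have ijm: "i \<in> {1..n}" "j \<in> {1..n}" using ij 2 by auto
    have ne: "i \<noteq> j" using same 2 by blast
    have w2: "wt p - wt q = wsc S (del i) + wsc T (del j)" unfolding w by (simp only: 2 if_False)
    show ?thesis unfolding roots_def roots_del_def w2 using ST ijm ne by blast
  next
    case 3
    have ijm: "i \<in> {1..m}" "j \<in> {1..n}" using ij 3 by auto
    have w2: "wt p - wt q = wsc S (eps i) + wsc T (del j)" unfolding w by (simp only: 3 if_True if_False)
    show ?thesis unfolding roots_def roots_odd_def w2 using ST ijm by blast
  next
    case 4
    have ijm: "i \<in> {1..n}" "j \<in> {1..m}" using ij 4 by auto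
    have w2: "wt p - wt q = wsc T (eps j) + wsc S (del i)" unfolding w by (simp only: 4 if_True if_False add.commute)
    show ?thesis unfolding roots_def roots_odd_def w2 using ST ijm by blast
  qed
qed

lemma wt_diff_pos_roots:
  assumes pq: "p \<in> Idx n m" "q \<in> Idx n m" "fst p \<or> q \<noteq> ng p" "height p > height q"
  shows "wt p - wt q \<in> pos_roots n m"
proof -
  have "p \<noteq> q" using pq(4) by blast
  then show ?thesis
    using wt_diff_roots(1)[OF pq(1-3)] wt_diff_cone[OF pq] by (simp add: pos_roots_def cone_def)
qed

end

section \<open>Functionals for the reflected Borel subalgebras\<close>

lemma height_bound:
  assumes "p \<in> Idx n m" "n \<le> m"
  shows "\<bar>height p\<bar> \<le> 2 * int m - 1"
  using assms by (cases p; cases "fst p") (auto simp: Idx_iff height_def)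

lemma height_ng: "height (ng p) = - height p"
  by (auto simp: height_def)

text \<open>The parity of the height separates eps from del, and the only tie is height 0 at del 1
  and - del 1, a pair that the third assumption excludes.\<close>

lemma height_inj:
  assumes "p \<in> Idx n m" "q \<in> Idx n m" "fst p \<or> q \<noteq> ng p" "height p = height q"
  shows "p = q"
proof -
  have par: "fst p = fst q"
  proof -
    have "odd (height a) \<longleftrightarrow> fst a" if "a \<in> Idx n m" for a
      using that by (auto simp: height_def Idx_iff)
    then show ?thesis using assms by metis
  qed
  moreover have "snd p = snd q"
    using assms par by (cases p; cases q) (auto simp: height_def Idx_iff ng_def split: if_splits)
  ultimately show ?thesis by (simp add: prod_eq_iff)
qed

lemma height_small:
  assumes "p \<in> Idx n m" "p \<notin> {(True, 1), (True, -1), (False, 1), (False, -1)}"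
  shows "height p \<ge> 2 \<or> height p \<le> -2"
  using assms by (cases p) (auto simp: height_def Idx_iff)

text \<open>Perturbations of \<open>4 * height\<close> for which \<open>2 eps 1\<close>, \<open>eps (i + 1) - eps i\<close> and \<open>eps i - del i\<close>,
  respectively, is the unique positive root of least degree. In the first two, the order of \<open>eps x\<close> and
  \<open>del x\<close> is reversed for \<open>x = 1\<close> and \<open>x = i + 1\<close>, which is the odd reflection in \<open>beta x\<close>.\<close>
definition om_long :: "idx \<Rightarrow> int" where
  "om_long p = (if p = (True, 1) then 1 else if p = (True, -1) then -1
     else if p = (False, 1) then 4 else if p = (False, -1) then -4 else 4 * height p)"

definition om_short :: "int \<Rightarrow> idx \<Rightarrow> int" where
  "om_short i p = (if p = (True, i + 1) then 8 * i - 3 else if p = (True, - i - 1) then 3 - 8 * i else 4 * height p)"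

definition om_odd :: "int \<Rightarrow> idx \<Rightarrow> int" where
  "om_odd i p = (if p = (False, i) then 8 * i - 5 else if p = (False, - i) then 5 - 8 * i else 4 * height p)"

lemma om_long_cases:
  assumes "p \<in> Idx n m"
  obtains "p = (True, 1)" "om_long p = 1" "height p = 1" | "p = (True, -1)" "om_long p = -1" "height p = -1"
    | "p = (False, 1)" "om_long p = 4" "height p = 0"| "p = (False, -1)" "om_long p = -4" "height p = 0"
    | "p \<notin> {(True, 1), (True, -1), (False, 1), (False, -1)}" "om_long p = 4 * height p" "height p \<ge> 2 \<or> height p \<le> -2"
  using height_small[OF assms] that
  by (cases "p \<in> {(True, 1), (True, -1), (False, 1), (False, -1)}") (auto simp: om_long_def height_def)

text \<open>With eps 1 at 1 and del 1 at 4, the roots 2 eps 1 and del 1 - eps 1 have degrees 2 and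
  3; all other indices have values of size at least 8. The last conjunct says that only - beta 1
  becomes newly positive.\<close>

lemma om_long_diff:
  assumes "p \<in> Idx n m" "q \<in> Idx n m" "fst p \<or> q \<noteq> ng p"
  shows "(om_long p = om_long q \<longrightarrow> p = q)
    \<and> (om_long p > om_long q \<longrightarrow> om_long p - om_long q > 2 \<or> p = (True, 1) \<and> q = (True, -1))
    \<and> (om_long p > om_long q \<longrightarrow> height p > height q \<or> p = (False, 1) \<and> q = (True, 1) \<or> p = (True, -1) \<and> q = (False, -1))"
  by (rule om_long_cases[OF assms(1)]; rule om_long_cases[OF assms(2)])
    (use height_inj[OF assms] assms(3) in \<open>auto simp: ng_def\<close>)

lemma om_short_cases:
  assumes "p \<in> Idx n m" "1 \<le> i"
  obtains "p = (True, i + 1)" "om_short i p = 8 * i - 3" "height p = 2 * i + 1"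
    | "p = (True, - i - 1)" "om_short i p = 3 - 8 * i" "height p = - 2 * i - 1"
    | "p \<notin> {(True, i + 1), (True, - i - 1)}" "om_short i p = 4 * height p"
      "height p = 2 * i - 1 \<longrightarrow> p = (True, i)" "height p = 1 - 2 * i \<longrightarrow> p = (True, - i)"
      "height p = 2 * i \<longrightarrow> p = (False, i + 1)" "height p = - 2 * i \<longrightarrow> p = (False, - i - 1)"
      "height p \<noteq> 2 * i + 1" "height p \<noteq> - 2 * i - 1"
proof (cases "p \<in> {(True, i + 1), (True, - i - 1)}")
  case True
  then show ?thesis using that(1,2) assms(2) by (auto simp: om_short_def height_def)
next
  case False
  obtain b x where p: "p = (b, x)" by (cases p)
  have x: "x \<noteq> 0" using assms(1) by (simp add: p Idx_iff)
  have o: "om_short i p = 4 * height p" using False by (simp add: om_short_def)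
  have "height p = 2 * i - 1 \<longrightarrow> p = (True, i)" "height p = 1 - 2 * i \<longrightarrow> p = (True, - i)"
      "height p = 2 * i \<longrightarrow> p = (False, i + 1)" "height p = - 2 * i \<longrightarrow> p = (False, - i - 1)"
      "height p \<noteq> 2 * i + 1" "height p \<noteq> - 2 * i - 1"
    using False x assms(2) unfolding p by (cases b; cases "x > 0"; simp add: height_def; presburger)+
  then show ?thesis using that(3) False o by blast
qed

text \<open>eps i and del (i + 1) sit at 8 i - 4 and 8 i, so 8 i - 3 for eps (i + 1) gives
  \<open>eps (i + 1) - eps i\<close> degree 1 and moves eps (i + 1) below del (i + 1) only. The
  remaining values are multiples of 4, so no other root has degree 1.\<close>

lemma om_short_diff:
  assumes "p \<in> Idx n m" "q \<in> Idx n m" "fst p \<or> q \<noteq> ng p" "1 \<le> i"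
  shows "(om_short i p = om_short i q \<longrightarrow> p = q)
    \<and> (om_short i p > om_short i q \<longrightarrow> om_short i p - om_short i q > 1 \<or> p = (True, i + 1) \<and> q = (True, i) \<or> p = (True, - i) \<and> q = (True, - i - 1))
    \<and> (om_short i p > om_short i q \<longrightarrow> height p > height q \<or> p = (False, i + 1) \<and> q = (True, i + 1) \<or> p = (True, - i - 1) \<and> q = (False, - i - 1))"
  by (rule om_short_cases[OF assms(1,4)]; rule om_short_cases[OF assms(2,4)];
      insert height_inj[OF assms(1-3)] assms(4); intro conjI impI; smt (verit, ccfv_threshold) prod.inject insertCI)

lemma om_odd_cases:
  assumes "p \<in> Idx n m" "1 \<le> i"
  obtains "p = (False, i)" "om_odd i p = 8 * i - 5" "height p = 2 * i - 2"
    | "p = (False, - i)" "om_odd i p = 5 - 8 * i" "height p = 2 - 2 * i"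
    | "p \<notin> {(False, i), (False, - i)}" "om_odd i p = 4 * height p"
      "height p = 2 * i - 1 \<longrightarrow> p = (True, i)" "height p = 1 - 2 * i \<longrightarrow> p = (True, - i)"
      "height p \<noteq> 2 * i - 2" "height p \<noteq> 2 - 2 * i"
proof (cases "p \<in> {(False, i), (False, - i)}")
  case True
  then show ?thesis using that(1,2) assms(2) by (auto simp: om_odd_def height_def)
next
  case False
  obtain b x where p: "p = (b, x)" by (cases p)
  have x: "x \<noteq> 0" using assms(1) by (simp add: p Idx_iff)
  have o: "om_odd i p = 4 * height p" using False by (simp add: om_odd_def)
  have "height p = 2 * i - 1 \<longrightarrow> p = (True, i)" "height p = 1 - 2 * i \<longrightarrow> p = (True, - i)"
      "height p \<noteq> 2 * i - 2" "height p \<noteq> 2 - 2 * i"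
    using False x assms(2) unfolding p by (cases b; cases "x > 0"; simp add: height_def; presburger)+
  then show ?thesis using that(3) False o by blast
qed

text \<open>Moving del i from 8 i - 8 up to 8 i - 5, next to eps i at 8 i - 4, reverses nothing:
  beta i is already simple and only has to receive the least degree 1.\<close>

lemma om_odd_diff:
  assumes "p \<in> Idx n m" "q \<in> Idx n m" "fst p \<or> q \<noteq> ng p" "1 \<le> i"
  shows "(om_odd i p = om_odd i q \<longrightarrow> p = q)
    \<and> (om_odd i p > om_odd i q \<longrightarrow> om_odd i p - om_odd i q > 1 \<or> p = (True, i) \<and> q = (False, i) \<or> p = (False, - i) \<and> q = (True, - i))
    \<and> (om_odd i p > om_odd i q \<longrightarrow> height p > height q)"
  by (rule om_odd_cases[OF assms(1,4)]; rule om_odd_cases[OF assms(2,4)];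
      insert height_inj[OF assms(1-3)] assms(3,4); intro conjI impI; smt (verit, ccfv_threshold) fst_conv snd_conv ng_def prod.inject insertCI)

lemma height_minus: "height (b, - x) = - height (b, x)"
  by (auto simp: height_def)

lemma mult_ge_pos: "(r::int) \<ge> 1 \<Longrightarrow> D \<ge> 0 \<Longrightarrow> D * r \<ge> D"
  using mult_left_mono[of 1 r D] by simp

lemma mult_le_neg: "(r::int) \<le> -1 \<Longrightarrow> D \<ge> 0 \<Longrightarrow> D * r \<le> - D"
  using mult_left_mono[of r "-1" D] by simp

section \<open>Odd reflections at the highest weight vector\<close>

locale orthogonal_hw = highest_weight_osp +
  assumes nm: "1 \<le> n" "n \<le> m"
    and orth: "\<forall>i\<in>{1..n}. wform n m lam (beta i) = 0"
begin

lemma lam_del: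
  assumes "i \<in> {1..n}"
  shows "lam (De i) = - lam (Ep i)"
proof -
  have im: "i \<in> {1..m}" using assms nm by auto
  have "(\<Sum>j=1..m. lam (Ep j) * beta i (Ep j)) = (\<Sum>j=1..m. if j = i then lam (Ep i) else 0)"
    by (intro sum.cong refl) (simp add: beta_def eps_def del_def)
  also have "\<dots> = lam (Ep i)" using im by simp
  finally have 1: "(\<Sum>j=1..m. lam (Ep j) * beta i (Ep j)) = lam (Ep i)" .
  have "(\<Sum>j=1..n. lam (De j) * beta i (De j)) = (\<Sum>j=1..n. if j = i then - lam (De i) else 0)"
    by (intro sum.cong refl) (simp add: beta_def eps_def del_def)
  also have "\<dots> = - lam (De i)" using assms by simp
  finally have 2: "(\<Sum>j=1..n. lam (De j) * beta i (De j)) = - lam (De i)" .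
  have "wform n m lam (beta i) = 0" using orth assms by blast
  then show ?thesis unfolding wform_def 1 2
    by (simp add: eq_neg_iff_add_eq_0 add.commute add_divide_distrib[symmetric])
qed

lemma positive_kills:
  assumes "p \<in> Idx n m" "q \<in> Idx n m" "fst p \<or> q \<noteq> ng p" "height p > height q"
  shows "\<rho> (osp_unit p q) 0 v = 0"
  using hw osp_unit_rootspace[OF assms(1,2)] wt_diff_pos_roots[OF nm assms]
  unfolding hw_vector_def by blast

lemma loop_kills: "X \<in> osp n m \<Longrightarrow> r > 0 \<Longrightarrow> \<rho> X r v = 0"
  using hw unfolding hw_vector_def by blast

text \<open>The bound is four times the greatest height, so roots without delta have degrees of size
  at most 16 m - 8. With delta at 16 m, every root with \<open>r \<ge> 1\<close> has degree at least
  8 and cannot compete with the minimal one; only \<open>r = 0\<close> remains to be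
  examined.\<close>

lemma functional_criterion:
  assumes odd: "odd_fun om" and bound: "\<And>p. p \<in> Idx n m \<Longrightarrow> \<bar>om p\<bar> \<le> 8 * int m - 4"
    and inj: "\<And>p q. p \<in> Idx n m \<Longrightarrow> q \<in> Idx n m \<Longrightarrow> fst p \<or> q \<noteq> ng p \<Longrightarrow> om p = om q \<Longrightarrow> p = q"
    and kills: "\<And>p q. p \<in> Idx n m \<Longrightarrow> q \<in> Idx n m \<Longrightarrow> fst p \<or> q \<noteq> ng p \<Longrightarrow> om p > om q \<Longrightarrow> \<rho> (osp_unit p q) 0 v = 0"
    and min: "\<And>p q. p \<in> Idx n m \<Longrightarrow> q \<in> Idx n m \<Longrightarrow> fst p \<or> q \<noteq> ng p \<Longrightarrow> om p > om q \<Longrightarrow>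
      om p - om q > om i - om j \<or> p = i \<and> q = j \<or> p = ng j \<and> q = ng i"
    and d: "om i - om j > 0" "om i - om j < 8"
  shows "regular om (16 * int m)" "singular om (16 * int m) v" "minimal_root om (16 * int m) i j 0"
proof -
  define D where "D = 16 * int m"
  have r_pos: "om p - om q + D * r \<ge> 8" if "p \<in> Idx n m" "q \<in> Idx n m" "r \<ge> 1" for p q r
    using bound[OF that(1)] bound[OF that(2)] mult_ge_pos[OF that(3), of D] D_def by linarith
  have r_neg: "om p - om q + D * r \<le> -8" if "p \<in> Idx n m" "q \<in> Idx n m" "r \<le> -1" for p q r
    using bound[OF that(1)] bound[OF that(2)] mult_le_neg[OF that(3), of D] D_def by linarith
  have tri: "r \<ge> 1 \<or> r = 0 \<or> r \<le> -1" for r :: int by linarith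
  show "regular om (16 * int m)"
    unfolding D_def[symmetric] regular_def
  proof (intro conjI odd ballI allI impI)
    fix p q r assume pq: "p \<in> Idx n m" "q \<in> Idx n m" "fst p \<or> q \<noteq> ng p" "om p - om q + D * r = 0"
    then have "r = 0" using r_pos[of p q r] r_neg[of p q r] tri[of r] by linarith
    then show "p = q" "r = 0" using inj pq by auto
  qed
  show "singular om (16 * int m) v"
    unfolding D_def[symmetric] singular_def
  proof (intro ballI allI impI)
    fix p q r assume pq: "p \<in> Idx n m" "q \<in> Idx n m" "0 < om p - om q + D * r"
    consider "r \<ge> 1" | "r = 0" using r_neg[of p q r] tri[of r] pq by linarith
    then show "\<rho> (osp_unit p q) r v = 0"
    proof cases
      case 1
      then show ?thesis using loop_kills osp_unit_osp pq by simp
    next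
      case 2
      then show ?thesis
        using kills[of p q] pq by (cases "fst p \<or> q \<noteq> ng p") (auto simp: osp_unit_even_ng rho_0)
    qed
  qed
  show "minimal_root om (16 * int m) i j 0"
    unfolding D_def[symmetric] minimal_root_def
  proof (intro conjI ballI allI impI)
    show "0 < om i - om j + D * 0" using d by simp
    fix p q r assume pq: "p \<in> Idx n m" "q \<in> Idx n m" "fst p \<or> q \<noteq> ng p" "0 < om p - om q + D * r"
    consider "r \<ge> 1" | "r = 0" using r_neg[of p q r] tri[of r] pq by linarith
    then show "om i - om j + D * 0 < om p - om q + D * r \<or> r = 0 \<and> (p = i \<and> q = j \<or> p = ng j \<and> q = ng i)"
    proof cases
      case 1
      then show ?thesis using r_pos[of p q r] pq d by auto
    next
      case 2
      then show ?thesis using min[of p q] pq by auto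
    qed
  qed
qed

lemma om_odd_functional:
  assumes i: "1 \<le> i" "i \<le> int n"
  shows "regular (om_odd i) (16 * int m)" "singular (om_odd i) (16 * int m) v"
    "minimal_root (om_odd i) (16 * int m) (True, i) (False, i) 0"
proof -
  have bound: "\<bar>om_odd i p\<bar> \<le> 8 * int m - 4" if p: "p \<in> Idx n m" for p
    using height_bound[OF p nm(2)] i nm(2) by (rule_tac om_odd_cases[OF p i(1)]) linarith+
  have odd: "odd_fun (om_odd i)"
    unfolding odd_fun_def using i by (auto simp: om_odd_def height_minus ng_def prod_eq_iff)
  have ij: "om_odd i (True, i) - om_odd i (False, i) = 1" using i by (simp add: om_odd_def height_def)
  have ngs: "ng (False, i) = (False, - i)" "ng (True, i) = (True, - i)" by (simp_all add: ng_def)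
  have kills: "\<rho> (osp_unit p q) 0 v = 0" if "p \<in> Idx n m" "q \<in> Idx n m" "fst p \<or> q \<noteq> ng p" "om_odd i p > om_odd i q" for p q
    using om_odd_diff[OF that(1-3) i(1)] that(4) positive_kills[OF that(1-3)] by blast
  have inj: "p = q" if "p \<in> Idx n m" "q \<in> Idx n m" "fst p \<or> q \<noteq> ng p" "om_odd i p = om_odd i q" for p q
    using om_odd_diff[OF that(1-3) i(1)] that(4) by blast
  have min: "om_odd i p - om_odd i q > om_odd i (True, i) - om_odd i (False, i) \<or> p = (True, i) \<and> q = (False, i) \<or> p = ng (False, i) \<and> q = ng (True, i)"
    if "p \<in> Idx n m" "q \<in> Idx n m" "fst p \<or> q \<noteq> ng p" "om_odd i p > om_odd i q" for p q
    unfolding ij ngs using om_odd_diff[OF that(1-3) i(1)] that(4) by blast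
  have d: "0 < om_odd i (True, i) - om_odd i (False, i)" "om_odd i (True, i) - om_odd i (False, i) < 8" unfolding ij by simp_all
  show "regular (om_odd i) (16 * int m)" "singular (om_odd i) (16 * int m) v"
    "minimal_root (om_odd i) (16 * int m) (True, i) (False, i) 0"
    by (rule functional_criterion[OF odd bound inj kills min d]; assumption)+
qed

text \<open>The bracket of the two opposite root vectors is a Cartan element on which
  \<open>lam\<close> vanishes by \<open>lam_del\<close>, so \<open>lower_power_eq_0\<close> applies
  with exponent 1. The second form is the same root vector under its other index pair.\<close>

lemma beta_lower_kills:
  assumes i: "1 \<le> i" "i \<le> int n"
  shows "\<rho> (osp_unit (False, i) (True, i)) 0 v = 0" "\<rho> (osp_unit (True, - i) (False, - i)) 0 v = 0"
proof -
  have idx: "(True, i) \<in> Idx n m" "(False, i) \<in> Idx n m" using i nm by (simp_all add: Idx_iff)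
  note e = osp_unit_osp[OF idx] and f = osp_unit_osp[OF idx(2,1)]
  have ngi: "(False, i) \<noteq> ng (True, i)" by (simp add: ng_def)
  have ev: "\<rho> (osp_unit (True, i) (False, i)) 0 v = 0"
    using idx i by (intro positive_kills) (auto simp: height_def)
  have s: "sbr n m (osp_unit (True, i) (False, i)) (osp_unit (False, i) (True, i))
      = madd (osp_unit (True, i) (True, i)) (osp_unit (False, i) (False, i))"
    using sbr_osp_unit_transpose[OF idx _ ngi] by (simp add: msub_def msc_def madd_def)
  have "coord lam (True, i) + coord lam (False, i) = 0"
  proof -
    have "nat i \<in> {1..n}" using i by auto
    then show ?thesis using i by (simp add: coord_def lam_del)
  qed
  then have "\<rho> (madd (osp_unit (True, i) (True, i)) (osp_unit (False, i) (False, i))) 0 v = 0"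
    using v_weight osp_unit_cartan[OF idx(1)] osp_unit_cartan[OF idx(2)] osp_unit_osp idx
    by (simp add: rho_madd weight_vec_def wt_eval_osp_unit scale_left_distrib[symmetric])
  then have "\<rho> (osp_unit (True, i) (False, i)) 0 ((lower (True, i) (False, i) 0 ^^ 1) v) = 0"
    using rho_sbr[OF e f osp_unit_parity osp_unit_parity, of 0 0 v] ev
    by (simp add: s lower_def lin_0[OF lin_rho[OF f]])
  then have "(lower (True, i) (False, i) 0 ^^ 1) v = 0"
    using lower_power_eq_0[OF om_odd_functional[OF i] idx, of 1] by simp
  then show *: "\<rho> (osp_unit (False, i) (True, i)) 0 v = 0"
    by (simp add: lower_def)
  have "osp_unit (True, - i) (False, - i) = msc (osgn (ng (False, i)) (ng (True, i))) (osp_unit (False, i) (True, i))"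
    using osp_unit_ng[OF idx(2,1)] by (simp add: ng_def)
  then show "\<rho> (osp_unit (True, - i) (False, - i)) 0 v = 0"
    using * by (simp add: rho_msc[OF f])
qed

lemma om_long_functional:
  shows "regular om_long (16 * int m)" "singular om_long (16 * int m) v" "minimal_root om_long (16 * int m) (True, 1) (True, -1) 0"
proof -
  have bound: "\<bar>om_long p\<bar> \<le> 8 * int m - 4" if p: "p \<in> Idx n m" for p
    using height_bound[OF p nm(2)] nm by (rule_tac om_long_cases[OF p]) linarith+
  have odd: "odd_fun om_long"
    unfolding odd_fun_def by (auto simp: om_long_def height_minus ng_def prod_eq_iff)
  have ij: "om_long (True, 1) - om_long (True, -1) = 2" by (simp add: om_long_def)
  have ngs: "ng (True, - 1) = (True, 1)" "ng (True, 1) = (True, - 1)" by (simp_all add: ng_def)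
  have kills: "\<rho> (osp_unit p q) 0 v = 0" if "p \<in> Idx n m" "q \<in> Idx n m" "fst p \<or> q \<noteq> ng p" "om_long p > om_long q" for p q
    using om_long_diff[OF that(1-3)] that positive_kills[OF that(1-3)] beta_lower_kills[of 1] nm by auto
  have inj: "p = q" if "p \<in> Idx n m" "q \<in> Idx n m" "fst p \<or> q \<noteq> ng p" "om_long p = om_long q" for p q
    using om_long_diff[OF that(1-3)] that(4) by blast
  have min: "om_long p - om_long q > om_long (True, 1) - om_long (True, -1) \<or> p = (True, 1) \<and> q = (True, -1) \<or> p = ng (True, -1) \<and> q = ng (True, 1)"
    if "p \<in> Idx n m" "q \<in> Idx n m" "fst p \<or> q \<noteq> ng p" "om_long p > om_long q" for p q
    unfolding ij ngs using om_long_diff[OF that(1-3)] that(4) by blast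
  have d: "0 < om_long (True, 1) - om_long (True, -1)" "om_long (True, 1) - om_long (True, -1) < 8" unfolding ij by simp_all
  show "regular om_long (16 * int m)" "singular om_long (16 * int m) v"
    "minimal_root om_long (16 * int m) (True, 1) (True, -1) 0"
    by (rule functional_criterion[OF odd bound inj kills min d]; assumption)+
qed

lemma om_short_functional:
  assumes i: "1 \<le> i" "i < int m"
  shows "regular (om_short i) (16 * int m)" "singular (om_short i) (16 * int m) v" "minimal_root (om_short i) (16 * int m) (True, i + 1) (True, i) 0"
proof -
  have bound: "\<bar>om_short i p\<bar> \<le> 8 * int m - 4" if p: "p \<in> Idx n m" for p
    using height_bound[OF p nm(2)] i nm(2) by (rule_tac om_short_cases[OF p i(1)]) linarith+
  have odd: "odd_fun (om_short i)"
    unfolding odd_fun_def using i by (auto simp: om_short_def height_minus ng_def prod_eq_iff)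
  have ij: "om_short i (True, i + 1) - om_short i (True, i) = 1" using i by (simp add: om_short_def height_def)
  have ngs: "ng (True, i) = (True, - i)" "ng (True, i + 1) = (True, - i - 1)" by (simp_all add: ng_def)
  have kills: "\<rho> (osp_unit p q) 0 v = 0" if pq: "p \<in> Idx n m" "q \<in> Idx n m" "fst p \<or> q \<noteq> ng p" "om_short i p > om_short i q" for p q
  proof -
    consider "height p > height q" | "p = (False, i + 1)" "q = (True, i + 1)" | "p = (True, - i - 1)" "q = (False, - i - 1)"
      using om_short_diff[OF pq(1-3) i(1)] pq(4) by blast
    then show ?thesis
    proof cases
      case 1
      then show ?thesis using positive_kills pq by blast
    next
      case 2
      \<comment> \<open>A reversed pair involves del (i + 1), which exists only for
        \<open>i < n\<close>; for larger \<open>i\<close> no odd reflection takes place.\<close>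
      then have "i + 1 \<le> int n" using pq(1) by (auto simp: Idx_iff)
      then show ?thesis using beta_lower_kills(1)[of "i + 1"] i 2 by simp
    next
      case 3
      then have "i + 1 \<le> int n" using pq(2) i by (auto simp: Idx_iff)
      then show ?thesis using beta_lower_kills(2)[of "i + 1"] i 3 by simp
    qed
  qed
  have inj: "p = q" if "p \<in> Idx n m" "q \<in> Idx n m" "fst p \<or> q \<noteq> ng p" "om_short i p = om_short i q" for p q
    using om_short_diff[OF that(1-3) i(1)] that(4) by blast
  have min: "om_short i p - om_short i q > om_short i (True, i + 1) - om_short i (True, i) \<or> p = (True, i + 1) \<and> q = (True, i) \<or> p = ng (True, i) \<and> q = ng (True, i + 1)"
    if "p \<in> Idx n m" "q \<in> Idx n m" "fst p \<or> q \<noteq> ng p" "om_short i p > om_short i q" for p q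
    unfolding ij ngs using om_short_diff[OF that(1-3) i(1)] that(4) by blast
  have d: "0 < om_short i (True, i + 1) - om_short i (True, i)" "om_short i (True, i + 1) - om_short i (True, i) < 8" unfolding ij by simp_all
  show "regular (om_short i) (16 * int m)" "singular (om_short i) (16 * int m) v"
    "minimal_root (om_short i) (16 * int m) (True, i + 1) (True, i) 0"
    by (rule functional_criterion[OF odd bound inj kills min d]; assumption)+
qed

text \<open>The root delta - 2 eps m is simple from the start, so the order of the indices is kept.
  As 2 eps m has degree 16 m - 8, the value 16 m - 7 for delta gives it degree 1; other roots with
  \<open>r = 1\<close> have degree at least 5, positive ones with \<open>r = 0\<close> at least
  4.\<close>

lemma om_affine_functional:
  defines "om \<equiv> \<lambda>p. 4 * height p" and "D \<equiv> 16 * int m - 7"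
  shows "regular om D" "singular om D v" "minimal_root om D (True, - int m) (True, int m) 1"
proof -
  have m1: "1 \<le> int m" using nm by linarith
  have D: "D = 16 * int m - 7" by (simp add: D_def)
  have bound: "\<bar>height p\<bar> \<le> 2 * int m - 1" if p: "p \<in> Idx n m" for p
    using height_bound[OF p nm(2)] .
  have top: "p = (True, - int m)" if "p \<in> Idx n m" "height p = 1 - 2 * int m" for p
    using height_inj[OF that(1), of "(True, - int m)"] that m1 by (simp add: Idx_iff height_def ng_def prod_eq_iff)
  have top': "q = (True, int m)" if "q \<in> Idx n m" "height q = 2 * int m - 1" for q
  proof -
    have "ng q = (True, - int m)" using that by (intro top) (simp_all add: height_ng)
    then show ?thesis by (simp add: ng_def prod_eq_iff)
  qed
  have r1: "om p - om q + D \<ge> 5 \<or> p = (True, - int m) \<and> q = (True, int m) \<and> om p - om q + D = 1"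
    if "p \<in> Idx n m" "q \<in> Idx n m" for p q
  proof (cases "height p = 1 - 2 * int m \<and> height q = 2 * int m - 1")
    case True
    then show ?thesis using top top' that by (simp add: om_def D_def)
  next
    case False
    then show ?thesis using bound[OF that(1)] bound[OF that(2)] unfolding om_def D_def by linarith
  qed
  have r2: "om p - om q + D * r \<ge> 5" if "p \<in> Idx n m" "q \<in> Idx n m" "r \<ge> 2" for p q r
  proof -
    have "D * r \<ge> D * 2" using that(3) m1 D by (intro mult_left_mono) auto
    then show ?thesis using bound[OF that(1)] bound[OF that(2)] m1 D unfolding om_def by linarith
  qed
  have rn: "om p - om q + D * r < 0" if "p \<in> Idx n m" "q \<in> Idx n m" "r \<le> -1" for p q r
    using bound[OF that(1)] bound[OF that(2)] mult_le_neg[OF that(3), of D] m1 D unfolding om_def by linarith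
  have tri: "r \<ge> 2 \<or> r = 1 \<or> r = 0 \<or> r \<le> -1" for r :: int by linarith
  have odd: "odd_fun om" by (simp add: odd_fun_def om_def height_ng)
  show "regular om D"
    unfolding regular_def
  proof (intro conjI odd ballI allI impI)
    fix p q r assume pq: "p \<in> Idx n m" "q \<in> Idx n m" "fst p \<or> q \<noteq> ng p" "om p - om q + D * r = 0"
    have "r \<noteq> 1" using r1[OF pq(1,2)] pq(4) by auto
    then show "r = 0" using r2[OF pq(1,2), of r] rn[OF pq(1,2), of r] tri[of r] pq(4) by linarith
    then show "p = q" using height_inj pq by (auto simp: om_def)
  qed
  show "singular om D v"
    unfolding singular_def
  proof (intro ballI allI impI)
    fix p q r assume pq: "p \<in> Idx n m" "q \<in> Idx n m" "0 < om p - om q + D * r"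
    consider "r \<ge> 1" | "r = 0" using rn[OF pq(1,2), of r] tri[of r] pq by linarith
    then show "\<rho> (osp_unit p q) r v = 0"
    proof cases
      case 1
      then show ?thesis using loop_kills osp_unit_osp pq by simp
    next
      case 2
      then show ?thesis
        using positive_kills[of p q] pq by (cases "fst p \<or> q \<noteq> ng p") (auto simp: osp_unit_even_ng rho_0 om_def)
    qed
  qed
  have i: "om (True, - int m) - om (True, int m) + D * 1 = 1"
    using m1 by (simp add: om_def D_def height_def)
  show "minimal_root om D (True, - int m) (True, int m) 1"
    unfolding minimal_root_def i
  proof (intro conjI ballI allI impI)
    show "0 < (1::int)" by simp
    fix p q r assume pq: "p \<in> Idx n m" "q \<in> Idx n m" "fst p \<or> q \<noteq> ng p" "0 < om p - om q + D * r"
    consider "r \<ge> 2" | "r = 1" | "r = 0" using rn[OF pq(1,2), of r] tri[of r] pq by linarith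
    then show "1 < om p - om q + D * r \<or> r = 1 \<and> (p = (True, - int m) \<and> q = (True, int m) \<or> p = ng (True, int m) \<and> q = ng (True, - int m))"
    proof cases
      case 1
      then show ?thesis using r2[OF pq(1,2), of r] by linarith
    next
      case 2
      then show ?thesis using r1[OF pq(1,2)] by auto
    next
      case 3
      then show ?thesis using pq(4) by (simp add: om_def)
    qed
  qed
qed

end

section \<open>Reflections of the weights and integrability\<close>

lemma roots_eps_wt:
  assumes "\<alpha> \<in> roots_eps m"
  obtains p q where "p \<in> Idx n m" "q \<in> Idx n m" "fst p" "fst q" "\<alpha> = wt p - wt q"
proof -
  define P where "P s i = (True, if s = 1 then int i else - int i)" for s :: complex and i
  have P: "P s i \<in> Idx n m \<and> fst (P s i) \<and> wt (P s i) = wsc s (eps i)" if "s \<in> {1, -1}" "i \<in> {1..m}" for s i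
    using that by (auto simp: P_def Idx_iff wt_def)
  have neg: "wt (ng (P s i)) = - wsc s (eps i)" if "s \<in> {1, -1}" "i \<in> {1..m}" for s i
    using P[OF that] by (simp add: wt_ng)
  from assms consider s t i j where "s \<in> {1, -1}" "t \<in> {1, -1}" "i \<in> {1..m}" "j \<in> {1..m}" "\<alpha> = wsc s (eps i) + wsc t (eps j)"
    | s i where "s \<in> {1, -1}" "i \<in> {1..m}" "\<alpha> = wsc (2 * s) (eps i)"
    unfolding roots_eps_def by blast
  then show ?thesis
  proof cases
    case 1
    then show ?thesis using P[of s i] P[of t j] neg[of t j] by (intro that[of "P s i" "ng (P t j)"]) auto
  next
    case 2
    have "wsc (2 * s) (eps i) = wsc s (eps i) + wsc s (eps i)" by (simp add: wsc_def fun_eq_iff)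
    then show ?thesis using P[of s i] neg[of s i] 2 by (intro that[of "P s i" "ng (P s i)"]) auto
  qed
qed

text \<open>The coefficient is the amount by which the translation along eps j shifts the multiple
  of delta; being nonzero, it makes the translation argument terminate.\<close>

lemma roots_eps_coefficient:
  assumes "\<alpha> \<in> roots_eps m"
  obtains j and a :: int where "j \<in> {1..m}" "a \<noteq> 0" "\<alpha> (Ep j) = of_int a"
proof -
  from assms consider s t i j where "s \<in> {1, -1}" "t \<in> {1, -1}" "i \<in> {1..m}" "j \<in> {1..m}" "i \<noteq> j" "\<alpha> = wsc s (eps i) + wsc t (eps j)"
    | s i where "s \<in> {1, -1}" "i \<in> {1..m}" "\<alpha> = wsc (2 * s) (eps i)"
    unfolding roots_eps_def by blast
  then show ?thesis
  proof cases
    case 1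
    then show ?thesis by (intro that[of i "if s = 1 then 1 else -1"]) (auto simp: wsc_def eps_def)
  next
    case 2
    then show ?thesis by (intro that[of i "if s = 1 then 2 else -2"]) (auto simp: wsc_def eps_def)
  qed
qed

section \<open>Simple roots of the affine sp(2m)\<close>

context orthogonal_hw
begin

text \<open>\<open>wt i - wt j + r delta\<close> is one of \<open>2 eps 1\<close>, \<open>eps (x + 1) - eps x\<close> and \<open>delta - 2 eps m\<close>.\<close>
definition simple_even :: "idx \<Rightarrow> idx \<Rightarrow> int \<Rightarrow> bool" where
  "simple_even i j r \<longleftrightarrow> i = (True, 1) \<and> j = (True, -1) \<and> r = 0
     \<or> (\<exists>x. 1 \<le> x \<and> x < int m \<and> i = (True, x + 1) \<and> j = (True, x) \<and> r = 0)
     \<or> i = (True, - int m) \<and> j = (True, int m) \<and> r = 1"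

lemma simple_even_idx:
  assumes "simple_even i j r"
  shows "i \<in> Idx n m" "j \<in> Idx n m" "fst i" "fst j" "i \<noteq> j" "j = ng i \<or> r = 0"
  using assms nm by (auto simp: simple_even_def Idx_iff ng_def)

lemma simple_even_functional:
  assumes "simple_even i j r"
  obtains om D where "regular om D" "singular om D v" "minimal_root om D i j r"
proof -
  from assms consider "i = (True, 1)" "j = (True, -1)" "r = 0"
    | x where "1 \<le> x" "x < int m" "i = (True, x + 1)" "j = (True, x)" "r = 0"
    | "i = (True, - int m)" "j = (True, int m)" "r = 1"
    unfolding simple_even_def by blast
  then show ?thesis
  proof cases
    case 1
    show ?thesis unfolding 1 by (rule that[unfolded 1, OF om_long_functional])
  next
    case 2
    show ?thesis by (rule that[unfolded 2(3-5), OF om_short_functional[OF 2(1,2)]])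
  next
    case 3
    show ?thesis unfolding 3 by (rule that[unfolded 3, OF om_affine_functional])
  qed
qed

lemma simple_even_sl2:
  assumes "simple_even i j r"
  shows "sl2_action scale (raise i j r) (lower i j r) (\<lambda>u. \<rho> (hmat i j) 0 u + (of_int r * k) *s u)"
  using sl2_root simple_even_idx[OF assms] by blast

lemma raise_eq_0_iff:
  assumes "i \<in> Idx n m" "j \<in> Idx n m"
  shows "raise i j r u = 0 \<longleftrightarrow> \<rho> (osp_unit i j) r u = 0"
  using osp_unit_osp[OF assms] by (simp add: raise_def rho_msc)

lemma simple_even_raise_v:
  assumes "simple_even i j r"
  shows "raise i j r v = 0"
proof -
  note ij = simple_even_idx[OF assms]
  obtain om D where "singular om D v" "minimal_root om D i j r"
    using simple_even_functional[OF assms] by blast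
  then show ?thesis
    using ij unfolding raise_eq_0_iff[OF ij(1,2)] singular_def minimal_root_def by blast
qed

lemma simple_even_lower_nilpotent:
  assumes se: "simple_even i j r" and N: "hval lam i j r = of_nat N"
  shows "\<exists>M. (lower i j r ^^ M) u = 0"
proof -
  note ij = simple_even_idx[OF se]
  interpret sl2: sl2_action scale "raise i j r" "lower i j r" "\<lambda>u. \<rho> (hmat i j) 0 u + (of_int r * k) *s u"
    by (rule simple_even_sl2[OF se])
  \<comment> \<open>The factor \<open>hval lam i j r - of_nat N\<close> in \<open>E_F_pow\<close>
    vanishes.\<close>
  have "raise i j r ((lower i j r ^^ Suc N) v) = 0"
    using sl2.E_F_pow[OF hmat_weight[OF ij(1,2) v_weight], of N] simple_even_raise_v[OF se] N
    by (simp add: lin_0[OF lin_funpow[OF sl2.linF]] lin_0[OF sl2.linF])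
  then have top: "\<rho> (osp_unit i j) r ((lower i j r ^^ Suc N) v) = 0"
    using raise_eq_0_iff[OF ij(1,2)] by blast
  obtain om D where om: "regular om D" "singular om D v" "minimal_root om D i j r"
    using simple_even_functional[OF se] by blast
  have "(lower i j r ^^ Suc N) v = 0"
    by (rule lower_power_eq_0[OF om ij(1,2,5) _ top]) simp
  then show ?thesis
    using lower_locally_nilpotent[OF ij(1,2,5)] ij(3,4) by blast
qed

text \<open>One fixed functional for bounding weights. Besides having \<open>v\<close> singular,
  \<open>om_odd 1\<close> agrees with \<open>4 * height\<close> on all indices of sp(2m).\<close>

abbreviation deg :: "weight \<Rightarrow> complex \<Rightarrow> complex" where
  "deg \<equiv> degree_val (om_odd 1) (16 * int m)"

lemma om_odd1: "regular (om_odd 1) (16 * int m)" "singular (om_odd 1) (16 * int m) v" "odd_fun (om_odd 1)"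
proof -
  show "regular (om_odd 1) (16 * int m)" "singular (om_odd 1) (16 * int m) v"
    using om_odd_functional[of 1] nm by auto
  then show "odd_fun (om_odd 1)" unfolding regular_def by blast
qed

definition is_weight :: "weight \<Rightarrow> complex \<Rightarrow> bool" where
  "is_weight \<mu> z \<longleftrightarrow> (\<exists>u. u \<noteq> 0 \<and> weight_vec \<mu> z u)"

lemma is_weight_deg: "is_weight \<mu> z \<Longrightarrow> \<exists>N. deg \<mu> z = deg lam c - of_nat N"
  unfolding is_weight_def using degree_bound[OF om_odd1(1,2) v_weight v_nonzero] by blast

text \<open>Each step raises the degree by at least 1, and the upper bound \<open>deg lam c\<close>
  lies \<open>N\<close> above the start, so \<open>Suc N\<close> steps leave the set of
  weights.\<close>

lemma is_weight_string_bounded: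
  assumes "is_weight \<mu> z" "i \<in> Idx n m" "j \<in> Idx n m" "om_odd 1 i - om_odd 1 j + 16 * int m * r > 0"
  shows "\<exists>N. \<not> is_weight (\<mu> + wsc (of_nat N) (wt i - wt j)) (z + of_nat N * of_int r)"
proof -
  obtain N where N: "deg \<mu> z = deg lam c - of_nat N" using is_weight_deg[OF assms(1)] by blast
  define g where "g = om_odd 1 i - om_odd 1 j + 16 * int m * r"
  have "\<not> is_weight (\<mu> + wsc (of_nat (Suc N)) (wt i - wt j)) (z + of_nat (Suc N) * of_int r)"
  proof
    assume "is_weight (\<mu> + wsc (of_nat (Suc N)) (wt i - wt j)) (z + of_nat (Suc N) * of_int r)"
    then obtain M where "deg (\<mu> + wsc (of_nat (Suc N)) (wt i - wt j)) (z + of_nat (Suc N) * of_int r) = deg lam c - of_nat M"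
      using is_weight_deg by blast
    then have "deg \<mu> z + of_nat (Suc N) * of_int g = deg lam c - of_nat M"
      unfolding degree_val_unit[OF om_odd1(3) assms(2,3)] g_def .
    then have "of_int (int (Suc N) * g) = (of_int (int N - int M) :: complex)"
      unfolding N by (simp add: algebra_simps)
    then have "int (Suc N) * g = int N - int M"
      by (simp only: of_int_eq_iff)
    moreover have "int (Suc N) * g \<ge> int (Suc N) * 1"
      using assms(4) by (unfold g_def, intro mult_left_mono) auto
    ultimately show False by simp
  qed
  then show ?thesis by blast
qed

lemma om_odd1_True: "fst p \<Longrightarrow> om_odd 1 p = 4 * height p"
  by (cases p) (simp add: om_odd_def)

lemma simple_even_om_odd:
  assumes "simple_even i j r"
  shows "om_odd 1 i - om_odd 1 j + 16 * int m * r > 0"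
proof -
  note ij = simple_even_idx[OF assms]
  have "4 * height i - 4 * height j + 16 * int m * r > 0"
    using assms nm unfolding simple_even_def by (elim disjE exE conjE) (simp_all add: height_def)
  then show ?thesis using om_odd1_True ij(3,4) by simp
qed

lemma raise_rootspace:
  assumes "i \<in> Idx n m" "j \<in> Idx n m"
  shows "msc (if j = ng i then 1 / 4 else 1) (osp_unit i j) \<in> rootspace n m (wt i - wt j)"
  by (rule rootspace_msc[OF osp_unit_rootspace[OF assms]])

lemma simple_even_raise_nilpotent:
  assumes se: "simple_even i j r" and u: "weight_vec \<mu> z u"
  shows "\<exists>M. (raise i j r ^^ M) u = 0"
proof (cases "u = 0")
  case False
  note ij = simple_even_idx[OF se]
  have "is_weight \<mu> z" using False u unfolding is_weight_def by blast
  then obtain N where "\<not> is_weight (\<mu> + wsc (of_nat N) (wt i - wt j)) (z + of_nat N * of_int r)"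
    using is_weight_string_bounded[OF _ ij(1,2) simple_even_om_odd[OF se]] by blast
  moreover have "weight_vec (\<mu> + wsc (of_nat N) (wt i - wt j)) (z + of_nat N * of_int r) ((raise i j r ^^ N) u)"
    unfolding raise_def by (rule weight_vec_funpow[OF u raise_rootspace[OF ij(1,2)]])
  ultimately show ?thesis unfolding is_weight_def by blast
qed (auto intro: exI[of _ 0])

lemma integrable_imp_dominant:
  assumes "integrable n m \<rho>" and se: "simple_even i j r"
  shows "hval lam i j r \<in> \<nat>"
proof -
  note ij = simple_even_idx[OF se]
  have re: "wt i - wt j \<in> roots_eps m"
    using wt_diff_roots(2)[OF nm ij(1,2)] ij(3-5) by blast
  have X: "osp_unit j i \<in> rootspace n m (- (wt i - wt j))"
    using osp_unit_rootspace[OF ij(2,1)] by (simp only: minus_diff_eq)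
  have "\<exists>N. (\<rho> (osp_unit j i) (- r) ^^ N) v = 0"
  proof (cases "r = 0")
    case True
    then have "height i > height j" using se by (auto simp: simple_even_def height_def)
    then have "wt i - wt j \<in> pos_roots n m \<inter> roots_eps m"
      using wt_diff_pos_roots[OF nm ij(1,2)] ij(3) re by blast
    then have "\<exists>N. (\<rho> (osp_unit j i) 0 ^^ N) v = 0"
      using assms(1) X unfolding integrable_def by blast
    then show ?thesis using True by simp
  next
    case False
    then have "r > 0" using se by (auto simp: simple_even_def)
    then show ?thesis using assms(1) X re unfolding integrable_def by blast
  qed
  then obtain N where N: "(lower i j r ^^ N) v = 0" unfolding lower_def by blast
  interpret sl2: sl2_action scale "raise i j r" "lower i j r" "\<lambda>u. \<rho> (hmat i j) 0 u + (of_int r * k) *s u"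
    by (rule simple_even_sl2[OF se])
  show ?thesis
    using sl2.highest_weight_nat[OF hmat_weight[OF ij(1,2) v_weight] simple_even_raise_v[OF se] v_nonzero N]
    by auto
qed

section \<open>The affine Weyl group and root strings\<close>

context
  assumes dominant: "\<And>i j r. simple_even i j r \<Longrightarrow> hval lam i j r \<in> \<nat>"
begin

text \<open>The raising string is finite by the degree bound and the lowering one by dominance, so
  \<open>weight_reflection\<close> yields a nonzero vector at the reflected weight.\<close>

lemma is_weight_reflection:
  assumes se: "simple_even i j r" and w: "is_weight \<mu> z"
  shows "is_weight (\<mu> - wsc (hval \<mu> i j r) (wt i - wt j)) (z - hval \<mu> i j r * of_int r)"
proof -
  note ij = simple_even_idx[OF se]
  interpret sl2: sl2_action scale "raise i j r" "lower i j r" "\<lambda>u. \<rho> (hmat i j) 0 u + (of_int r * k) *s u"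
    by (rule simple_even_sl2[OF se])
  obtain u where u: "u \<noteq> 0" "weight_vec \<mu> z u" using w unfolding is_weight_def by blast
  obtain p where p: "(raise i j r ^^ p) u = 0" using simple_even_raise_nilpotent[OF se u(2)] by blast
  obtain N where "hval lam i j r = of_nat N" using dominant[OF se] by (auto elim: Nats_cases)
  then obtain q where q: "(lower i j r ^^ q) u = 0" using simple_even_lower_nilpotent[OF se] by blast
  show ?thesis
  proof (rule sl2.weight_reflection[OF hmat_weight[OF ij(1,2) u(2)] u(1) p q])
    fix N assume N: "hval \<mu> i j r = of_nat N" "(lower i j r ^^ N) u \<noteq> 0"
    have "weight_vec (\<mu> + wsc (of_nat N) (wt j - wt i)) (z + of_nat N * of_int (- r)) ((lower i j r ^^ N) u)"
      unfolding lower_def by (rule weight_vec_funpow[OF u(2) osp_unit_rootspace[OF ij(2,1)]])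
    moreover have "\<mu> + wsc (of_nat N) (wt j - wt i) = \<mu> - wsc (of_nat N) (wt i - wt j)"
      by (simp add: wsc_def fun_eq_iff algebra_simps)
    ultimately show ?thesis unfolding is_weight_def N(1) using N(2) by auto
  next
    fix N assume N: "hval \<mu> i j r = - of_nat N" "(raise i j r ^^ N) u \<noteq> 0"
    have "weight_vec (\<mu> + wsc (of_nat N) (wt i - wt j)) (z + of_nat N * of_int r) ((raise i j r ^^ N) u)"
      unfolding raise_def by (rule weight_vec_funpow[OF u(2) raise_rootspace[OF ij(1,2)]])
    moreover have "\<mu> + wsc (of_nat N) (wt i - wt j) = \<mu> - wsc (- of_nat N) (wt i - wt j)"
      by (simp add: wsc_def fun_eq_iff algebra_simps)
    ultimately show ?thesis unfolding is_weight_def N(1) using N(2) by auto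
  qed
qed

definition swap :: "nat \<Rightarrow> weight \<Rightarrow> weight" where
  "swap x \<mu> = \<mu>(Ep x := \<mu> (Ep (Suc x)), Ep (Suc x) := \<mu> (Ep x))"

definition flip :: "nat \<Rightarrow> weight \<Rightarrow> weight" where
  "flip j \<mu> = \<mu>(Ep j := - \<mu> (Ep j))"

text \<open>Reflection in delta - 2 eps j at level \<open>k\<close>; the value on d changes by
  \<open>\<mu> (Ep j) - k\<close> at the same time.\<close>

definition affine_flip :: "nat \<Rightarrow> weight \<Rightarrow> weight" where
  "affine_flip j \<mu> = \<mu>(Ep j := 2 * k - \<mu> (Ep j))"

lemma is_weight_swap:
  assumes x: "1 \<le> x" "x < m" and w: "is_weight \<mu> z"
  shows "is_weight (swap x \<mu>) z"
proof -
  have "simple_even (True, int x + 1) (True, int x) 0" using x by (simp add: simple_even_def)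
  note is_weight_reflection[OF this w]
  moreover have h: "hval \<mu> (True, int x + 1) (True, int x) 0 = \<mu> (Ep (Suc x)) - \<mu> (Ep x)"
    using x by (simp add: hval_def coord_def ng_def nat_add_distrib)
  moreover have "wt (True, int x + 1) - wt (True, int x) = eps (Suc x) - eps x"
    using x by (simp add: wt_def wsc_1 nat_add_distrib)
  moreover have "\<mu> - wsc (\<mu> (Ep (Suc x)) - \<mu> (Ep x)) (eps (Suc x) - eps x) = swap x \<mu>"
    by (auto simp: wsc_def eps_def swap_def fun_eq_iff)
  ultimately show ?thesis by simp
qed

text \<open>Conjugation by adjacent swaps carries the sign change up from the simple root 2 eps
  1.\<close>

lemma is_weight_flip:
  assumes "1 \<le> j" "j \<le> m" and w: "is_weight \<mu> z"
  shows "is_weight (flip j \<mu>) z"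
  using assms
proof (induction j arbitrary: \<mu> rule: dec_induct)
  case base
  have "simple_even (True, 1) (True, - 1) 0" by (simp add: simple_even_def)
  note is_weight_reflection[OF this base(2)]
  moreover have "hval \<mu> (True, 1) (True, - 1) 0 = \<mu> (Ep 1)" by (simp add: hval_def coord_def ng_def)
  moreover have "wt (True, 1) - wt (True, - 1) = wsc 2 (eps 1)"
    by (simp add: wt_def wsc_def fun_eq_iff)
  moreover have "\<mu> - wsc (\<mu> (Ep 1)) (wsc 2 (eps 1)) = flip 1 \<mu>"
    by (auto simp: wsc_def eps_def flip_def fun_eq_iff)
  ultimately show ?case by simp
next
  case (step j)
  then have j: "1 \<le> j" "j < m" by auto
  have "is_weight (swap j (flip j (swap j \<mu>))) z"
    using step j by (intro is_weight_swap step.IH) auto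
  moreover have "swap j (flip j (swap j \<mu>)) = flip (Suc j) \<mu>"
    by (auto simp: swap_def flip_def fun_eq_iff)
  ultimately show ?case by simp
qed

text \<open>The simple root is now delta - 2 eps m, so the conjugations run down from
  \<open>m\<close>.\<close>

lemma is_weight_affine_flip:
  assumes "1 \<le> j" "j \<le> m" and w: "is_weight \<mu> z"
  shows "is_weight (affine_flip j \<mu>) (z - k + \<mu> (Ep j))"
  using assms(2,1,3)
proof (induction j arbitrary: \<mu> rule: inc_induct)
  case base
  have "simple_even (True, - int m) (True, int m) 1" by (simp add: simple_even_def)
  note is_weight_reflection[OF this base(2)]
  moreover have "hval \<mu> (True, - int m) (True, int m) 1 = k - \<mu> (Ep m)"
    using base(1) by (simp add: hval_def coord_def ng_def)
  moreover have "wt (True, - int m) - wt (True, int m) = wsc (-2) (eps m)"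
    using base(1) by (simp add: wt_def wsc_def fun_eq_iff)
  moreover have "\<mu> - wsc (k - \<mu> (Ep m)) (wsc (-2) (eps m)) = affine_flip m \<mu>"
    by (auto simp: wsc_def eps_def affine_flip_def fun_eq_iff)
  ultimately show ?case by (simp add: algebra_simps)
next
  case (step j)
  have "is_weight (swap j (affine_flip (Suc j) (swap j \<mu>))) (z - k + swap j \<mu> (Ep (Suc j)))"
    using step by (intro is_weight_swap step.IH) auto
  moreover have "swap j (affine_flip (Suc j) (swap j \<mu>)) = affine_flip j \<mu>"
    by (auto simp: swap_def affine_flip_def fun_eq_iff)
  ultimately show ?case by (simp add: swap_def)
qed

text \<open>Strings in the direction -(alpha + r delta), through all weights so that reflections
  carry the property along. One gap suffices: the corresponding power of a root vector maps into it
  and vanishes.\<close>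

definition string_bounded :: "weight \<Rightarrow> int \<Rightarrow> bool" where
  "string_bounded \<alpha> r \<longleftrightarrow> (\<forall>\<mu> z. is_weight \<mu> z \<longrightarrow> (\<exists>N. \<not> is_weight (\<mu> - wsc (of_nat N) \<alpha>) (z - of_nat N * of_int r)))"

lemma string_bounded_flip:
  assumes "1 \<le> j" "j \<le> m" "string_bounded \<alpha> r"
  shows "string_bounded (flip j \<alpha>) r"
  unfolding string_bounded_def
proof (intro allI impI)
  fix \<mu> z assume "is_weight \<mu> z"
  then have "is_weight (flip j \<mu>) z" using is_weight_flip assms by blast
  then obtain N where N: "\<not> is_weight (flip j \<mu> - wsc (of_nat N) \<alpha>) (z - of_nat N * of_int r)"
    using assms(3) unfolding string_bounded_def by blast
  have "flip j (\<mu> - wsc (of_nat N) (flip j \<alpha>)) = flip j \<mu> - wsc (of_nat N) \<alpha>"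
    by (auto simp: flip_def wsc_def fun_eq_iff)
  then have "\<not> is_weight (\<mu> - wsc (of_nat N) (flip j \<alpha>)) (z - of_nat N * of_int r)"
    using N is_weight_flip[OF assms(1,2), of "\<mu> - wsc (of_nat N) (flip j \<alpha>)"] by (simp only:) blast
  then show "\<exists>N. \<not> is_weight (\<mu> - wsc (of_nat N) (flip j \<alpha>)) (z - of_nat N * of_int r)" by blast
qed

text \<open>The reflection in delta - 2 eps j takes alpha + r delta to flip j alpha + (r + a) delta.
  The shift \<open>a\<close> stems from the term \<open>\<mu> (Ep j)\<close> in the change of the
  value on d.\<close>

lemma string_bounded_affine_flip:
  assumes "1 \<le> j" "j \<le> m" "string_bounded \<alpha> r" "\<alpha> (Ep j) = of_int a"
  shows "string_bounded (flip j \<alpha>) (r + a)"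
  unfolding string_bounded_def
proof (intro allI impI)
  fix \<mu> z assume "is_weight \<mu> z"
  then have "is_weight (affine_flip j \<mu>) (z - k + \<mu> (Ep j))" using is_weight_affine_flip assms by blast
  then obtain N where N: "\<not> is_weight (affine_flip j \<mu> - wsc (of_nat N) \<alpha>) (z - k + \<mu> (Ep j) - of_nat N * of_int r)"
    using assms(3) unfolding string_bounded_def by blast
  have "affine_flip j (\<mu> - wsc (of_nat N) (flip j \<alpha>)) = affine_flip j \<mu> - wsc (of_nat N) \<alpha>"
    by (auto simp: flip_def affine_flip_def wsc_def fun_eq_iff)
  moreover have "z - of_nat N * of_int (r + a) - k + (\<mu> - wsc (of_nat N) (flip j \<alpha>)) (Ep j) = z - k + \<mu> (Ep j) - of_nat N * of_int r"
    using assms(4) by (simp add: flip_def wsc_def algebra_simps)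
  ultimately have "\<not> is_weight (\<mu> - wsc (of_nat N) (flip j \<alpha>)) (z - of_nat N * of_int (r + a))"
    using N is_weight_affine_flip[OF assms(1,2), of "\<mu> - wsc (of_nat N) (flip j \<alpha>)" "z - of_nat N * of_int (r + a)"] by (simp only:) blast
  then show "\<exists>N. \<not> is_weight (\<mu> - wsc (of_nat N) (flip j \<alpha>)) (z - of_nat N * of_int (r + a))" by blast
qed

lemma flip_flip: "flip j (flip j \<mu>) = \<mu>"
  by (simp add: flip_def)

text \<open>The two reflections in \<open>eps j\<close> compose to a translation, which lowers the multiple of \<open>delta\<close>.\<close>
lemma string_bounded_translate:
  assumes j: "1 \<le> j" "j \<le> m" and a: "\<alpha> (Ep j) = of_int a" and sb: "string_bounded \<alpha> (r - \<bar>a\<bar>)"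
  shows "string_bounded \<alpha> r"
proof (cases "a \<ge> 0")
  case True
  have "string_bounded (flip j \<alpha>) r"
    using string_bounded_affine_flip[OF j sb a] True by simp
  from string_bounded_flip[OF j this] show ?thesis by (simp only: flip_flip)
next
  case False
  have "flip j \<alpha> (Ep j) = of_int (- a)" using a by (simp add: flip_def)
  from string_bounded_affine_flip[OF j string_bounded_flip[OF j sb] this]
  show ?thesis using False by (simp add: flip_flip)
qed

text \<open>For \<open>r < 0\<close> the root -(alpha + r delta) has positive degree, so its strings
  are bounded above. Larger \<open>r\<close> are brought down to this case by translations, each
  lowering \<open>r\<close> by a positive integer.\<close>

lemma string_bounded_roots_eps:
  assumes "\<alpha> \<in> roots_eps m"
  shows "string_bounded \<alpha> r"
proof -
  obtain j a where ja: "j \<in> {1..m}" "a \<noteq> 0" "\<alpha> (Ep j) = of_int a" using roots_eps_coefficient[OF assms] .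
  have neg: "string_bounded \<alpha> r" if r: "r < 0" for r
    unfolding string_bounded_def
  proof (intro allI impI)
    fix \<mu> z assume w: "is_weight \<mu> z"
    obtain p q where pq: "p \<in> Idx n m" "q \<in> Idx n m" "fst p" "fst q" "\<alpha> = wt p - wt q"
      using roots_eps_wt[OF assms] .
    have o: "om_odd 1 p = 4 * height p" "om_odd 1 q = 4 * height q" using pq(3,4) by (auto intro: om_odd1_True)
    \<comment> \<open>Roots of sp(2m) have degrees of size at most 16 m - 8, which a single delta
      outweighs.\<close>
    have "om_odd 1 q - om_odd 1 p + 16 * int m * (- r) > 0"
      using height_bound[OF pq(1) nm(2)] height_bound[OF pq(2) nm(2)] mult_ge_pos[of "- r" "16 * int m"] r
      unfolding o by linarith
    from is_weight_string_bounded[OF w pq(2,1) this]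
    obtain N where "\<not> is_weight (\<mu> + wsc (of_nat N) (wt q - wt p)) (z + of_nat N * of_int (- r))" by blast
    moreover have "\<mu> + wsc (of_nat N) (wt q - wt p) = \<mu> - wsc (of_nat N) \<alpha>"
      by (simp add: pq(5) wsc_def fun_eq_iff algebra_simps)
    ultimately show "\<exists>N. \<not> is_weight (\<mu> - wsc (of_nat N) \<alpha>) (z - of_nat N * of_int r)" by auto
  qed
  have "string_bounded \<alpha> r" if "r < int t" for t r
    using that
  proof (induction t arbitrary: r)
    case 0
    then show ?case using neg by simp
  next
    case (Suc t)
    have "string_bounded \<alpha> (r - \<bar>a\<bar>)" using Suc.prems ja(2) by (intro Suc.IH) auto
    then show ?case using string_bounded_translate[of j \<alpha> a r] ja by simp
  qed
  from this[of r "nat (r + 1)"] show ?thesis by auto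
qed

text \<open>A gap in the string settles weight vectors, for an arbitrary element of the root space.
  The words in \<open>descendants\<close> are weight vectors and span the module.\<close>

lemma rootspace_locally_nilpotent:
  assumes "\<alpha> \<in> roots_eps m" "X \<in> rootspace n m (- \<alpha>)"
  shows "\<exists>N. (\<rho> X (- r) ^^ N) u = 0"
proof -
  let ?L = "{x. \<exists>N. (\<rho> X (- r) ^^ N) x = 0}"
  have X: "X \<in> osp n m" using assms(2) by (simp add: rootspace_def)
  have sub: "subspace ?L" by (rule locally_nilpotent_subspace[OF lin_rho[OF X]])
  have "w \<in> ?L" if w: "weight_vec \<mu> z w" for \<mu> z w
  proof (cases "w = 0")
    case True
    then show ?thesis using subspace_0[OF sub] by simp
  next
    case False
    then have "is_weight \<mu> z" using w unfolding is_weight_def by blast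
    then obtain N where "\<not> is_weight (\<mu> - wsc (of_nat N) \<alpha>) (z - of_nat N * of_int r)"
      using string_bounded_roots_eps[OF assms(1), of r] unfolding string_bounded_def by blast
    moreover have "\<mu> - wsc (of_nat N) \<alpha> = \<mu> + wsc (of_nat N) (- \<alpha>)"
      by (simp add: wsc_def fun_eq_iff)
    moreover have "z - of_nat N * of_int r = z + of_nat N * of_int (- r)" by simp
    ultimately have "(\<rho> X (- r) ^^ N) w = 0"
      using weight_vec_funpow[OF w assms(2), of N "- r"] unfolding is_weight_def by metis
    then show ?thesis by blast
  qed
  then have "descendants (om_odd 1) (16 * int m) v \<subseteq> ?L"
    using descendants_weight[OF om_odd1(3) v_weight] by blast
  then have "span (descendants (om_odd 1) (16 * int m) v) \<subseteq> ?L"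
    by (rule span_minimal[OF _ sub])
  then show ?thesis
    unfolding span_descendants[OF om_odd1(1,2) v_weight v_nonzero] by blast
qed

lemma dominant_imp_integrable: "integrable n m \<rho>"
  unfolding integrable_def using rootspace_locally_nilpotent[where r = 0] rootspace_locally_nilpotent by auto

end

end

section \<open>Coordinates of the highest weight\<close>

context orthogonal_hw
begin

lemma integrable_iff_coordinates:
  "integrable n m \<rho> \<longleftrightarrow> lam (Ep 1) \<in> \<nat> \<and> (\<forall>x\<in>{1..<m}. lam (Ep (x + 1)) - lam (Ep x) \<in> \<nat>) \<and> k - lam (Ep m) \<in> \<nat>"
proof -
  have "integrable n m \<rho> \<longleftrightarrow> (\<forall>i j r. simple_even i j r \<longrightarrow> hval lam i j r \<in> \<nat>)"
    using integrable_imp_dominant dominant_imp_integrable by blast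
  also have "\<dots> \<longleftrightarrow> hval lam (True, 1) (True, -1) 0 \<in> \<nat>
      \<and> (\<forall>x. 1 \<le> x \<and> x < int m \<longrightarrow> hval lam (True, x + 1) (True, x) 0 \<in> \<nat>)
      \<and> hval lam (True, - int m) (True, int m) 1 \<in> \<nat>"
    unfolding simple_even_def by blast
  also have "hval lam (True, 1) (True, -1) 0 = lam (Ep 1)"
    by (simp add: hval_def coord_def ng_def)
  also have "hval lam (True, - int m) (True, int m) 1 = k - lam (Ep m)"
    using nm by (simp add: hval_def coord_def ng_def)
  also have "(\<forall>x. 1 \<le> x \<and> x < int m \<longrightarrow> hval lam (True, x + 1) (True, x) 0 \<in> \<nat>)
      \<longleftrightarrow> (\<forall>x\<in>{1..<m}. lam (Ep (x + 1)) - lam (Ep x) \<in> \<nat>)"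
  proof -
    have h: "hval lam (True, int x + 1) (True, int x) 0 = lam (Ep (x + 1)) - lam (Ep x)" if "1 \<le> x" for x
      using that by (simp add: hval_def coord_def ng_def nat_add_distrib)
    have "(\<forall>x. 1 \<le> x \<and> x < int m \<longrightarrow> P x) \<longleftrightarrow> (\<forall>x\<in>{1..<m}. P (int x))" for P
    proof (intro iffI allI impI ballI)
      fix x assume "\<forall>x\<in>{1..<m}. P (int x)" "1 \<le> x \<and> x < int m"
      then have "nat x \<in> {1..<m}" "int (nat x) = x" by auto
      then show "P x" using \<open>\<forall>x\<in>{1..<m}. P (int x)\<close> by metis
    qed auto
    then show ?thesis by (simp only:) (intro ball_cong refl, simp add: h)
  qed
  finally show ?thesis .
qed

end

lemma sum_fun_apply: "(\<Sum>i\<in>A. f i) w = (\<Sum>i\<in>A. f i w)"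
  for f :: "'i \<Rightarrow> weight"
  by (induction A rule: infinite_finite_induct) simp_all

lemma weight_expansion_coefficients:
  fixes g :: "nat \<Rightarrow> complex"
  assumes "n \<le> m" and "\<mu> = (\<Sum>i=1..n. wsc (g i) (beta i)) + (\<Sum>i=n+1..m. wsc (g i) (eps i))"
  shows "\<mu> (Ep x) = (if x \<in> {1..m} then g x else 0)" and "\<mu> (De x) = (if x \<in> {1..n} then - g x else 0)"
proof -
  have s: "(\<Sum>i\<in>A. if i = x then h i else 0) = (if x \<in> A then h x else 0)" if "finite A" for A and h :: "nat \<Rightarrow> complex"
    using that by simp
  have e: "(\<Sum>i=1..n. wsc (g i) (beta i) (Ep x)) = (\<Sum>i=1..n. if i = x then g i else 0)"
    "(\<Sum>i=n+1..m. wsc (g i) (eps i) (Ep x)) = (\<Sum>i=n+1..m. if i = x then g i else 0)"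
    "(\<Sum>i=1..n. wsc (g i) (beta i) (De x)) = (\<Sum>i=1..n. if i = x then - g i else 0)"
    "(\<Sum>i=n+1..m. wsc (g i) (eps i) (De x)) = 0"
    by (intro sum.cong sum.neutral ballI refl; simp add: wsc_def beta_def eps_def del_def)+
  show "\<mu> (Ep x) = (if x \<in> {1..m} then g x else 0)" "\<mu> (De x) = (if x \<in> {1..n} then - g x else 0)"
    unfolding assms(2) plus_fun_def sum_fun_apply e using assms(1) by (auto simp: s)
qed

theorem theorem5p5:
  fixes n m :: nat
    and s :: "complex \<Rightarrow> 'v::ab_group_add \<Rightarrow> 'v"
    and \<rho> :: "mat \<Rightarrow> int \<Rightarrow> 'v \<Rightarrow> 'v"
    and \<rho>K \<rho>d :: "'v \<Rightarrow> 'v"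
    and lam :: weight and k c :: complex
  assumes "1 \<le> n" and "n \<le> m"
    and "is_L n m s \<rho> \<rho>K \<rho>d lam k c"
    and "wsupp n m lam"
    and "k \<noteq> 0"
    and "\<forall>i\<in>{1..n}. wform n m lam (beta i) = 0"
  shows "integrable n m \<rho> \<longleftrightarrow>
    (\<exists>kk :: int. \<exists>ks :: nat \<Rightarrow> int. \<exists>c' :: complex.
       (lam, k, c) = ((\<Sum>i=1..n. wsc (of_int (ks i)) (beta i))
                        + (\<Sum>i=n+1..m. wsc (of_int (ks i)) (eps i)), of_int kk, c') \<and>
       kk > 0 \<and> (\<forall>i\<in>{1..m}. ks i \<ge> 0) \<and> kk \<ge> ks m \<and>
       (\<forall>i\<in>{1..<m}. ks (i + 1) \<ge> ks i))"
proof -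
  obtain v where L: "affine_module n m s \<rho> \<rho>K \<rho>d" "irreducible_mod n m s \<rho> \<rho>K \<rho>d" "hw_vector n m s \<rho> \<rho>K \<rho>d lam k c v"
    using assms(3) unfolding is_L_def by blast
  interpret vector_space s using L(1) unfolding affine_module_def by blast
  interpret orthogonal_hw s n m \<rho> \<rho>K \<rho>d lam k c v
    using L assms by unfold_locales
  show ?thesis
    unfolding integrable_iff_coordinates
  proof
    assume A: "lam (Ep 1) \<in> \<nat> \<and> (\<forall>x\<in>{1..<m}. lam (Ep (x + 1)) - lam (Ep x) \<in> \<nat>) \<and> k - lam (Ep m) \<in> \<nat>"
    have nat: "\<exists>a::nat. lam (Ep x) = of_nat a" if "1 \<le> x" "x \<le> m" for x
      using that
    proof (induction x rule: dec_induct)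
      case base
      then show ?case using A by (auto elim: Nats_cases)
    next
      case (step x)
      then obtain a where a: "lam (Ep x) = of_nat a" by auto
      have "lam (Ep (x + 1)) - lam (Ep x) \<in> \<nat>" using A step by simp
      then obtain b where "lam (Ep (x + 1)) - lam (Ep x) = of_nat b" by (auto elim: Nats_cases)
      then have "lam (Ep (Suc x)) = of_nat (a + b)" using a by (simp add: algebra_simps)
      then show ?case by blast
    qed
    then obtain f where f: "\<And>x. x \<in> {1..m} \<Longrightarrow> lam (Ep x) = of_nat (f x)"
      by (metis atLeastAtMost_iff)
    have m1: "m \<in> {1..m}" using assms by simp
    obtain K where K: "k - lam (Ep m) = of_nat K" using A by (auto elim: Nats_cases)
    then have k: "k = of_nat (f m + K)" using f[OF m1] by (simp add: algebra_simps)
    have mono: "f x \<le> f (x + 1)" if x: "x \<in> {1..<m}" for x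
    proof -
      have "lam (Ep (x + 1)) - lam (Ep x) \<in> \<nat>" using A x by blast
      then obtain b where "lam (Ep (x + 1)) - lam (Ep x) = of_nat b" by (auto elim: Nats_cases)
      then have "of_nat (f (x + 1)) = (of_nat (f x + b) :: complex)"
        using f[of x] f[of "x + 1"] x by (simp add: algebra_simps)
      then show ?thesis by (simp only: of_nat_eq_iff)
    qed
    \<comment> \<open>Only the eps coordinates are known so far; orthogonality determines the del
      coordinates through \<open>lam_del\<close>, and \<open>wsupp\<close> makes all remaining ones
      zero.\<close>
    have lam: "lam = (\<Sum>i=1..n. wsc (of_int (int (f i))) (beta i)) + (\<Sum>i=n+1..m. wsc (of_int (int (f i))) (eps i))"
    proof
      fix w
      show "lam w = ((\<Sum>i=1..n. wsc (of_int (int (f i))) (beta i)) + (\<Sum>i=n+1..m. wsc (of_int (int (f i))) (eps i))) w"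
      proof (cases w)
        case (Ep x)
        then show ?thesis
          using assms(4) f[of x] unfolding Ep weight_expansion_coefficients(1)[OF assms(2) refl] wsupp_def by auto
      next
        case (De x)
        then show ?thesis
          using assms(2,4) f[of x] lam_del[of x] unfolding De weight_expansion_coefficients(2)[OF assms(2) refl] wsupp_def by auto
      qed
    qed
    \<comment> \<open>The coordinates alone give a natural number; strict positivity comes from the
      nonzero level.\<close>
    have pos: "f m + K > 0" using k assms(5) by (intro Nat.gr0I) simp
    show "\<exists>kk ks c'. (lam, k, c) = ((\<Sum>i=1..n. wsc (of_int (ks i)) (beta i))
                        + (\<Sum>i=n+1..m. wsc (of_int (ks i)) (eps i)), of_int kk, c') \<and>
       kk > 0 \<and> (\<forall>i\<in>{1..m}. ks i \<ge> 0) \<and> kk \<ge> ks m \<and> (\<forall>i\<in>{1..<m}. ks (i + 1) \<ge> ks i)"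
      using lam k mono pos
      by (intro exI[of _ "int (f m + K)"] exI[of _ "\<lambda>i. int (f i)"] exI[of _ c]) (auto simp del: add_gr_0)
  next
    assume "\<exists>kk ks c'. (lam, k, c) = ((\<Sum>i=1..n. wsc (of_int (ks i)) (beta i))
                        + (\<Sum>i=n+1..m. wsc (of_int (ks i)) (eps i)), of_int kk, c') \<and>
       kk > 0 \<and> (\<forall>i\<in>{1..m}. ks i \<ge> 0) \<and> kk \<ge> ks m \<and> (\<forall>i\<in>{1..<m}. ks (i + 1) \<ge> ks i)"
    then obtain kk :: int and ks :: "nat \<Rightarrow> int" where
      lam: "lam = (\<Sum>i=1..n. wsc (of_int (ks i)) (beta i)) + (\<Sum>i=n+1..m. wsc (of_int (ks i)) (eps i))"
      and k: "k = of_int kk" and ks: "\<forall>i\<in>{1..m}. ks i \<ge> 0" "kk \<ge> ks m" "\<forall>i\<in>{1..<m}. ks (i + 1) \<ge> ks i"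
      by blast
    have E: "lam (Ep x) = of_int (ks x)" if "x \<in> {1..m}" for x
      unfolding lam weight_expansion_coefficients(1)[OF assms(2) refl] using that by simp
    have N: "of_int a \<in> (\<nat> :: complex set)" if "a \<ge> 0" for a
      using that by (metis of_nat_in_Nats of_int_of_nat_eq nat_0_le)
    have m: "1 \<in> {1..m}" "m \<in> {1..m}" using assms by auto
    have "lam (Ep 1) \<in> \<nat>" unfolding E[OF m(1)] using ks(1) m by (intro N) auto
    moreover have "lam (Ep (x + 1)) - lam (Ep x) \<in> \<nat>" if "x \<in> {1..<m}" for x
    proof -
      have "lam (Ep (x + 1)) - lam (Ep x) = of_int (ks (x + 1) - ks x)" using that E by simp
      then show ?thesis using ks(3) that N[of "ks (x + 1) - ks x"] by simp
    qed
    moreover have "k - lam (Ep m) \<in> \<nat>"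
    proof -
      have "k - lam (Ep m) = of_int (kk - ks m)" using E[OF m(2)] k by simp
      then show ?thesis using ks(2) N[of "kk - ks m"] by simp
    qed
    ultimately show "lam (Ep 1) \<in> \<nat> \<and> (\<forall>x\<in>{1..<m}. lam (Ep (x + 1)) - lam (Ep x) \<in> \<nat>) \<and> k - lam (Ep m) \<in> \<nat>"
      by blast
  qed
qed

end
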